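(* Let $M\ge 3$ be an integer and let $T_j:\mathbb C\to\mathbb C$, $j=1,\dots,M$, be the similarities $T_j(z)=\frac1M z+c_j$, where the points $c_1,\dots,c_M\in\mathbb C$ are not all collinear. Suppose the $T_j$ satisfy the open set condition with open set $U$, i.e. $U\subset\mathbb C$ is a nonempty bounded open set with $T_j(U)\subset U$ for all $j$ and $T_j(U)\cap T_k(U)=\emptyset$ for $j\ne k$. For $n\ge1$ let $E_n=\bigcup_{(j_1,\dots,j_n)\in\{1,\dots,M\}^n}T_{j_1}\circ\cdots\circ T_{j_n}(U)$. Then there are constants $c>0$, $C<\infty$ such that for all $n\ge 2$, $$\operatorname{Fav}(E_n)\le Ce^{-c\sqrt{\log n}}.$$
   Context: For $\theta\in[0,\pi)$ let $\operatorname{proj}_\theta(w)=\operatorname{Re}(we^{-i\theta})$ be orthogonal projection of $\mathbb C$ onto the line in direction $e^{i\theta}$. The Favard length of a bounded set $A\subset\mathbb C$ is $\operatorname{Fav}(A)=\frac1\pi\int_0^\pi|\operatorname{proj}_\theta(A)|\,d\theta$, with $|\cdot|$ Lebesgue measure. *)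

theory Defs
  imports "HOL-Analysis.Analysis"
begin

definition proj :: "real \<Rightarrow> complex \<Rightarrow> real" where
  "proj \<theta> w = Re (w * exp (- \<i> * complex_of_real \<theta>))"

definition Fav :: "complex set \<Rightarrow> real" where
  "Fav A = (1 / pi) * (LBINT \<theta>:{0..<pi}. measure lebesgue (proj \<theta> ` A))"

definition word_map :: "(nat \<Rightarrow> complex \<Rightarrow> complex) \<Rightarrow> nat list \<Rightarrow> complex \<Rightarrow> complex" where
  "word_map T w = foldr (\<lambda>j f. T j \<circ> f) w id"

definition gen_set :: "nat \<Rightarrow> (nat \<Rightarrow> complex \<Rightarrow> complex) \<Rightarrow> complex set \<Rightarrow> nat \<Rightarrow> complex set" where
  "gen_set M T U n = (\<Union>w\<in>{w. length w = n \<and> set w \<subseteq> {..<M}}. word_map T w ` U)"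

end

theory Submission
  imports Defs
begin

text \<open>
Rescale so that in direction \<open>\<theta>\<close> the \<open>n\<close>-th generation projects into the intervals of radius 1 around
the points \<open>\<Sum>k<n. M ^ k * lam (d k)\<close> attached to the words with digits \<open>d k\<close>, in units of \<open>M ^ (- n)\<close>.
Fix a threshold \<open>t\<close>. If, up to some level \<open>N\<close>, the cells met by at least \<open>t\<close> intervals have total length
at least of order \<open>t ^ (- 2)\<close>, then a proportion \<open>p\<close> of the words, of order at least \<open>1 / t\<close>, projects into
a set of measure \<open>O(p / t)\<close>, and iterating on the remaining words brings the projection down to \<open>O(1 / t)\<close>.
Otherwise a stopping time argument bounds the \<open>L\<^sup>2\<close> norms of the counting functions up to level \<open>N\<close>, so that
the Riesz product \<open>\<Prod>k<n. phi (M ^ k * x)\<close>, \<open>phi\<close> the average of the exponentials \<open>exp (\<i> * lam j * x)\<close>,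
has mean square \<open>O(t / M ^ n)\<close> on unit intervals.

This second alternative fails for \<open>\<theta>\<close> outside a set of measure \<open>O(1 / t)\<close> once \<open>N \<ge> exp (C * (ln t)\<^sup>2)\<close>.
Let \<open>M ^ m\<close> be comparable to \<open>t\<close> and \<open>l\<close> a large multiple of \<open>m\<close>. By positivity of the Fejer kernel the factors
of index at least \<open>m\<close> carry a definite mass on the unit interval. Off few tiny intervals each of the first
\<open>m\<close> factors is at least a power of \<open>1 / t\<close>, which is the loss \<open>exp (- C * (ln t)\<^sup>2)\<close>. Everywhere, the
block of indices \<open>m, ..., m + l - 1\<close> is smaller than a prescribed power of \<open>1 / t\<close>, which makes the mass on the
tiny intervals negligible: if that block is large, most of its factors are close to 1 in modulus, so two linear
functionals of \<open>x * exp (\<i> * \<theta>)\<close> stay near the integers under repeated multiplication by \<open>M\<close>, and since the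
\<open>c j\<close> are not collinear this singles out few points of the plane, hence few directions.
So each of many disjoint frequency blocks below level \<open>N\<close> has a definite mean square, against the \<open>L\<^sup>2\<close> bound.
\<close>

section \<open>Stopping cells and the energy of the counting function\<close>

text \<open>An integer \<open>q\<close> at level \<open>n\<close> stands for the interval from
  \<open>q\<close> to \<open>q + 1\<close> in units of \<open>M ^ (- n)\<close>, so that
  \<open>div\<close> by a power of \<open>M\<close> passes to an ancestor in the
  \<open>M\<close>-adic tree. \<open>N\<close> is the finest level, on which lengths are
  counted.\<close>

definition refines :: "nat \<Rightarrow> nat \<Rightarrow> nat \<Rightarrow> int \<Rightarrow> int set" where
  "refines M N n q = {i. i div int M ^ (N - n) = q}"

text \<open>The maximal cells with property \<open>H\<close>: the first such cell met on the way
  down from level 0. These are pairwise disjoint, which is what turns counts over them into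
  lengths.\<close>

definition stop_cells :: "nat \<Rightarrow> (nat \<Rightarrow> int \<Rightarrow> bool) \<Rightarrow> nat \<Rightarrow> (nat \<times> int) set" where
  "stop_cells M H N = {(n, q). n \<le> N \<and> H n q \<and> (\<forall>n'<n. \<not> H n' (q div int M ^ (n - n')))}"

definition stop_set :: "nat \<Rightarrow> (nat \<Rightarrow> int \<Rightarrow> bool) \<Rightarrow> nat \<Rightarrow> int set" where
  "stop_set M H N = {i. \<exists>n\<le>N. H n (i div int M ^ (N - n))}"

lemma sum_UNION_le:
  fixes f :: "'b \<Rightarrow> real"
  assumes "finite C" "\<And>c. c \<in> C \<Longrightarrow> finite (D c)" "\<And>x. f x \<ge> 0"
  shows "sum f (\<Union>c\<in>C. D c) \<le> (\<Sum>c\<in>C. sum f (D c))"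
  using assms(1,2)
proof (induction C rule: finite_induct)
  case (insert c C)
  have "sum f (\<Union>c\<in>insert c C. D c) \<le> sum f (D c) + sum f (\<Union>c\<in>C. D c)"
    using insert assms(3) sum.union_inter[of "D c" "\<Union>c\<in>C. D c" f]
      sum_nonneg[of "D c \<inter> (\<Union>c\<in>C. D c)" f] by auto
  then show ?case using insert by simp
qed simp

lemma div_power_div_power: "(i::int) div int M ^ a div int M ^ b = i div int M ^ (a + b)"
  by (simp add: power_add zdiv_zmult2_eq)

lemma refines_eq:
  assumes "M > 0"
  shows "refines M N n q = {q * int M ^ (N - n)..<(q + 1) * int M ^ (N - n)}"
proof -
  define P where "P = int M ^ (N - n)"
  have P: "P > 0" using assms by (simp add: P_def)
  have "(i div P = q) = (q * P \<le> i \<and> i < (q + 1) * P)" for i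
  proof
    assume "i div P = q"
    then show "q * P \<le> i \<and> i < (q + 1) * P"
      using div_mult_mod_eq[of i P] pos_mod_bound[OF P, of i] pos_mod_sign[OF P, of i]
      by (simp only: distrib_right) linarith
  next
    assume "q * P \<le> i \<and> i < (q + 1) * P"
    then have "0 \<le> i - q * P" "i - q * P < P"
      by (simp_all only: distrib_right) linarith+
    then show "i div P = q" by (intro int_div_pos_eq[of i P q "i - q * P"]) simp_all
  qed
  then show ?thesis unfolding refines_def P_def[symmetric] set_eq_iff
    by (simp only: atLeastLessThan_iff mem_Collect_eq) blast
qed

lemma card_refines: "M > 0 \<Longrightarrow> card (refines M N n q) = M ^ (N - n)"
  by (simp add: refines_eq algebra_simps nat_power_eq)

lemma finite_refines: "M > 0 \<Longrightarrow> finite (refines M N n q)"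
  by (simp add: refines_eq)

text \<open>The coarsest ancestor with property \<open>H\<close> has no such ancestor
  itself.\<close>

lemma stop_cells_ancestor:
  assumes "n \<le> N" "H n q"
  obtains n' where "n' \<le> n" "(n', q div int M ^ (n - n')) \<in> stop_cells M H N"
proof -
  define n' where "n' = (LEAST k. k \<le> n \<and> H k (q div int M ^ (n - k)))"
  have ex: "n \<le> n \<and> H n (q div int M ^ (n - n))" using assms by simp
  have n': "n' \<le> n" "H n' (q div int M ^ (n - n'))"
    using LeastI[of "\<lambda>k. k \<le> n \<and> H k (q div int M ^ (n - k))", OF ex] by (auto simp: n'_def)
  have "\<not> H k (q div int M ^ (n - n') div int M ^ (n' - k))" if "k < n'" for k
  proof -
    have "n - n' + (n' - k) = n - k" using that n' by simp
    then show ?thesis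
      using not_less_Least[of k "\<lambda>k. k \<le> n \<and> H k (q div int M ^ (n - k))"] that n'
      by (auto simp: n'_def[symmetric] div_power_div_power)
  qed
  then show ?thesis using that[of n'] n' assms by (auto simp: stop_cells_def)
qed

lemma stop_set_eq: "stop_set M H N = (\<Union>(n, q)\<in>stop_cells M H N. refines M N n q)"
proof -
  have "\<exists>(n, q)\<in>stop_cells M H N. i \<in> refines M N n q" if i: "i \<in> stop_set M H N" for i
  proof -
    from i obtain n where n: "n \<le> N" "H n (i div int M ^ (N - n))" by (auto simp: stop_set_def)
    from n obtain n' where n': "n' \<le> n" "(n', i div int M ^ (N - n) div int M ^ (n - n')) \<in> stop_cells M H N"
      by (rule stop_cells_ancestor)
    have "N - n + (n - n') = N - n'" using n n' by simp
    with n'(2) show ?thesis by (auto simp: div_power_div_power refines_def)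
  qed
  then show ?thesis by (fastforce simp: stop_set_def refines_def stop_cells_def)
qed

text \<open>A common descendant would make the coarser cell an ancestor of the finer one, which
  stopping excludes; at equal levels it determines the cell.\<close>

lemma disjoint_refines_stop_cells:
  assumes "(n, q) \<in> stop_cells M H N" "(n', q') \<in> stop_cells M H N" "(n, q) \<noteq> (n', q')"
  shows "refines M N n q \<inter> refines M N n' q' = {}"
proof -
  have *: False if "n1 < n2" "(n1, q1) \<in> stop_cells M H N" "(n2, q2) \<in> stop_cells M H N"
    "i \<in> refines M N n1 q1" "i \<in> refines M N n2 q2" for n1 n2 q1 q2 i
  proof -
    have "n2 \<le> N" using that(3) by (auto simp: stop_cells_def)
    then have "q2 div int M ^ (n2 - n1) = q1" using that(1,4,5)
      by (auto simp: refines_def div_power_div_power)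
    then show False using that by (auto simp: stop_cells_def)
  qed
  show ?thesis
  proof (cases "n = n'")
    case True
    then show ?thesis using assms by (auto simp: refines_def)
  next
    case False
    then consider "n < n'" | "n' < n" by linarith
    then show ?thesis using *[of n n' q q'] *[of n' n q' q] assms by cases blast+
  qed
qed

lemma finite_stop_cells:
  assumes "M > 0" "finite (stop_set M H N)"
  shows "finite (stop_cells M H N)"
proof -
  \<comment> \<open>A cell is identified by its level together with its leftmost descendant on level
    \<open>N\<close>.\<close>
  have "inj_on (\<lambda>(n, q). (n, q * int M ^ (N - n))) (stop_cells M H N)"
    using assms(1) by (auto simp: inj_on_def)
  moreover have "(\<lambda>(n, q). (n, q * int M ^ (N - n))) ` stop_cells M H N \<subseteq> {..N} \<times> stop_set M H N"
  proof (rule image_subsetI)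
    fix c assume c: "c \<in> stop_cells M H N"
    obtain n q where nq: "c = (n, q)" by (cases c)
    have "q * int M ^ (N - n) \<in> refines M N n q" using assms(1) by (simp add: refines_def)
    then show "(\<lambda>(n, q). (n, q * int M ^ (N - n))) c \<in> {..N} \<times> stop_set M H N"
      using c nq by (force simp: stop_set_eq stop_cells_def)
  qed
  ultimately show ?thesis
    by (meson assms(2) finite_SigmaI finite_atMost finite_imageD finite_subset)
qed

lemma card_stop_set:
  assumes "M > 0" "finite (stop_set M H N)"
  shows "card (stop_set M H N) = (\<Sum>(n, q)\<in>stop_cells M H N. M ^ (N - n))"
proof -
  have "card (stop_set M H N) = (\<Sum>x\<in>stop_cells M H N. card (case x of (n, q) \<Rightarrow> refines M N n q))"
    unfolding stop_set_eq
    using finite_stop_cells[OF assms] disjoint_refines_stop_cells[of _ _ M H N]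
    by (intro card_UN_disjoint) (fastforce simp: finite_refines assms(1))+
  also have "\<dots> = (\<Sum>(n, q)\<in>stop_cells M H N. M ^ (N - n))"
    by (intro sum.cong) (auto simp: card_refines assms(1))
  finally show ?thesis .
qed

section \<open>Words, their positions, and the number of words near a cell\<close>

locale digit_system =
  fixes M :: nat and lam :: "nat \<Rightarrow> real"
  assumes M3: "M \<ge> 3" and lam: "\<And>j. j < M \<Longrightarrow> \<bar>lam j\<bar> \<le> 1 / 4"
begin

definition wrds :: "nat \<Rightarrow> nat list set" where
  "wrds n = {w. set w \<subseteq> {..<M} \<and> length w = n}"

text \<open>With \<open>lam\<close> the scaled projections of the translation parts, this is the
  projected place of the cylinder of a word, in units of its own generation. The first letter is the
  most significant digit.\<close>

primrec pos :: "nat list \<Rightarrow> real" where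
  "pos [] = 0"
| "pos (j # u) = real M ^ length u * lam j + pos u"

text \<open>The neighbouring cells are included so that the relation survives passage to ancestors:
  a prefix need not lie in the cell above, only next to it.\<close>

definition hits :: "nat list \<Rightarrow> int \<Rightarrow> bool" where
  "hits w i \<longleftrightarrow> \<bar>\<lfloor>pos w\<rfloor> - i\<bar> \<le> 1"

definition hitcount :: "nat \<Rightarrow> int \<Rightarrow> nat" where
  "hitcount n i = card {w \<in> wrds n. hits w i}"

lemma M_pos: "M > 0" using M3 by simp

lemma finite_wrds [simp]: "finite (wrds n)"
  unfolding wrds_def by (rule finite_lists_length_eq) simp

lemma card_wrds: "card (wrds n) = M ^ n"
  unfolding wrds_def by (simp add: card_lists_length_eq)

lemma wrds_0 [simp]: "wrds 0 = {[]}" by (auto simp: wrds_def)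

lemma length_wrds: "w \<in> wrds n \<Longrightarrow> length w = n" by (simp add: wrds_def)

lemma pos_append: "pos (v @ u) = real M ^ length u * pos v + pos u"
  by (induction v) (auto simp: power_add algebra_simps)

text \<open>The geometric series: digits of size 1/4 give at most
  \<open>1 / 4 * (M ^ n - 1) / (M - 1)\<close>, and \<open>M - 1\<close> is at least 2.\<close>

lemma abs_pos_le: "set u \<subseteq> {..<M} \<Longrightarrow> \<bar>pos u\<bar> \<le> (real M ^ length u - 1) / 8"
proof (induction u)
  case (Cons j u)
  define P where "P = real M ^ length u"
  have "P \<ge> 1" unfolding P_def using M3 by simp
  have j: "\<bar>lam j\<bar> \<le> 1 / 4" using lam Cons by simp
  have "\<bar>P * lam j\<bar> \<le> P * (1 / 4)"
    using j \<open>P \<ge> 1\<close> by (simp add: abs_mult)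
  moreover have "real M * P \<ge> 3 * P" using M3 \<open>P \<ge> 1\<close> by simp
  moreover have "\<bar>pos u\<bar> \<le> (P - 1) / 8" using Cons by (simp add: P_def)
  ultimately have "\<bar>P * lam j + pos u\<bar> \<le> (real M * P - 1) / 8" by argo
  then show ?case by (simp add: P_def[symmetric])
qed simp

lemma bij_betw_wrds_append: "bij_betw (\<lambda>(v, u). v @ u) (wrds a \<times> wrds b) (wrds (a + b))"
proof (rule bij_betw_byWitness[where f' = "\<lambda>w. (take a w, drop a w)"])
  show "(\<lambda>w. (take a w, drop a w)) ` wrds (a + b) \<subseteq> wrds a \<times> wrds b"
    by (auto simp: wrds_def dest: in_set_takeD in_set_dropD)
qed (auto simp: wrds_def)

lemma sum_wrds_append:
  "(\<Sum>w\<in>wrds (a + b). f w) = (\<Sum>v\<in>wrds a. \<Sum>u\<in>wrds b. f (v @ u))"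
  unfolding sum.cartesian_product
  by (subst sum.reindex_bij_betw[OF bij_betw_wrds_append, symmetric]) (simp add: case_prod_beta)

text \<open>The suffix moves the position by less than an eighth of a coarse cell, so the tolerance
  of one cell on either side has room for it.\<close>

lemma hits_append:
  assumes "u \<in> wrds k" "hits (v @ u) i"
  shows "hits v (i div int M ^ k)"
proof -
  define P where "P = real M ^ k"
  define d where "d = i div int M ^ k"
  have P1: "P \<ge> 1" unfolding P_def using M3 by simp
  have d1: "int M ^ k * d \<le> i"
    using M_pos pos_mod_sign[of "int M ^ k" i] mult_div_mod_eq[of "int M ^ k" i] unfolding d_def
    by (smt (verit) of_nat_0_less_iff zero_less_power)
  have d2: "i + 1 \<le> int M ^ k * d + int M ^ k"
    using M_pos pos_mod_bound[of "int M ^ k" i] mult_div_mod_eq[of "int M ^ k" i] unfolding d_def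
    by (smt (verit) of_nat_0_less_iff zero_less_power)
  have "real_of_int (int M ^ k * d) \<le> real_of_int i" using d1 by linarith
  then have d1': "P * d \<le> i" by (simp add: P_def)
  have "real_of_int (i + 1) \<le> real_of_int (int M ^ k * d + int M ^ k)" using d2 by linarith
  then have d2': "i + 1 \<le> P * d + P" by (simp add: P_def)
  have aux: "x \<ge> y - P \<and> x < y + 2 * P"
    if "\<bar>r\<bar> \<le> (P - 1) / 8" "z = x + r" "j - 1 \<le> z" "z < j + 2" "j + 1 \<le> y + P" "y \<le> j"
    for x y z r j :: real
    using that P1 by (intro conjI; simp add: abs_le_iff)
  have "\<bar>pos u\<bar> \<le> (P - 1) / 8"
    using abs_pos_le[of u] assms(1) by (simp add: wrds_def P_def)
  moreover have "pos (v @ u) = P * pos v + pos u"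
    using assms(1) by (simp add: pos_append wrds_def P_def)
  moreover have "real_of_int i - 1 \<le> pos (v @ u)" "pos (v @ u) < real_of_int i + 2"
    using assms(2) unfolding hits_def by linarith+
  moreover have "real_of_int i + 1 \<le> P * d + P" using d2' by simp
  ultimately have "P * pos v \<ge> P * d - P \<and> P * pos v < P * d + 2 * P"
    using d1' aux by blast
  then have "P * pos v \<ge> P * (d - 1)" "P * pos v < P * (d + 2)" by (auto simp: algebra_simps)
  then have "pos v \<ge> d - 1" "pos v < d + 2" using P1 by auto
  then show ?thesis unfolding hits_def d_def[symmetric] by linarith
qed

lemma hitcount_eq_sum: "hitcount n i = (\<Sum>w\<in>wrds n. of_bool (hits w i))"
  unfolding hitcount_def by (simp add: Int_def conj_commute)

text \<open>Each prefix hitting the parent has \<open>M\<close> one-letter extensions. This keeps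
  the count at a first heavy cell below \<open>M * t\<close>.\<close>

lemma hitcount_Suc_le: "hitcount (Suc n) i \<le> M * hitcount n (i div int M)"
proof -
  have "hitcount (Suc n) i = (\<Sum>v\<in>wrds n. \<Sum>u\<in>wrds 1. of_bool (hits (v @ u) i))"
    using sum_wrds_append[of "\<lambda>w. of_bool (hits w i) :: nat" n 1] by (simp add: hitcount_eq_sum)
  also have "\<dots> \<le> (\<Sum>v\<in>wrds n. \<Sum>u\<in>wrds 1. of_bool (hits v (i div int M)))"
    using hits_append[of _ 1] by (intro sum_mono) auto
  also have "\<dots> = M * hitcount n (i div int M)"
    by (simp add: hitcount_eq_sum card_wrds flip: sum_distrib_left)
  finally show ?thesis .
qed

lemma hitcount_0_le: "hitcount 0 i \<le> 1"
  unfolding hitcount_def by (simp add: card_le_Suc0_iff_eq)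

text \<open>Prepending a prefix is a translation up to rounding: floors are additive with error 0 or
  1, whence the two shifts.\<close>

lemma hits_append_shift:
  assumes "u \<in> wrds k" "hits (v @ u) i"
  defines "a \<equiv> \<lfloor>real M ^ k * pos v\<rfloor>"
  shows "hits u (i - a) \<or> hits u (i - a - 1)"
proof -
  have "pos (v @ u) = real M ^ k * pos v + pos u"
    using assms(1) by (simp add: pos_append wrds_def)
  then have "\<lfloor>pos (v @ u)\<rfloor> = a + \<lfloor>pos u\<rfloor> \<or> \<lfloor>pos (v @ u)\<rfloor> = a + \<lfloor>pos u\<rfloor> + 1"
    unfolding a_def by linarith
  then show ?thesis using assms(2) unfolding hits_def by linarith
qed

lemma sum_hitcount_le:
  assumes "finite I"
  shows "(\<Sum>i\<in>I. hitcount n i) \<le> 3 * M ^ n"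
proof -
  have "(\<Sum>i\<in>I. hitcount n i) = (\<Sum>w\<in>wrds n. \<Sum>i\<in>I. of_bool (hits w i))"
    unfolding hitcount_eq_sum by (rule sum.swap)
  also have "\<dots> \<le> (\<Sum>w\<in>wrds n. 3)"
  proof (rule sum_mono)
    fix w
    have "(\<Sum>i\<in>I. of_bool (hits w i)) = card (I \<inter> {i. hits w i})" using assms by simp
    also have "\<dots> \<le> card {\<lfloor>pos w\<rfloor> - 1..\<lfloor>pos w\<rfloor> + 1}"
      by (rule card_mono) (auto simp: hits_def)
    finally show "(\<Sum>i\<in>I. of_bool (hits w i)) \<le> (3::nat)" by simp
  qed
  finally show ?thesis by (simp add: card_wrds)
qed

lemma finite_hitcount_ge:
  assumes "t > 0"
  shows "finite {i. real (hitcount n i) \<ge> t}"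
proof (rule finite_subset)
  show "{i. real (hitcount n i) \<ge> t} \<subseteq> (\<Union>w\<in>wrds n. {\<lfloor>pos w\<rfloor> - 1..\<lfloor>pos w\<rfloor> + 1})"
  proof
    fix i assume "i \<in> {i. real (hitcount n i) \<ge> t}"
    then have "hitcount n i \<noteq> 0" using assms by (cases "hitcount n i = 0") auto
    then obtain w where "w \<in> wrds n" "hits w i" unfolding hitcount_def by (metis (mono_tags, lifting) card.empty empty_Collect_eq)
    then show "i \<in> (\<Union>w\<in>wrds n. {\<lfloor>pos w\<rfloor> - 1..\<lfloor>pos w\<rfloor> + 1})" by (force simp: hits_def)
  qed
qed auto

lemma finite_vimage_div:
  assumes "finite A"
  shows "finite {i. i div int M ^ k \<in> A}"
proof -
  have "{i. i div int M ^ k \<in> A} = (\<Union>q\<in>A. refines M k 0 q)" by (auto simp: refines_def)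
  then show ?thesis using assms finite_refines[OF M_pos] by auto
qed

section \<open>Energy of the counts when the heavy cells have small total length\<close>

definition heavy :: "real \<Rightarrow> nat \<Rightarrow> int \<Rightarrow> bool" where
  "heavy t n q \<longleftrightarrow> real (hitcount n q) \<ge> t"

lemma finite_stop_set_heavy:
  assumes "t > 0"
  shows "finite (stop_set M (heavy t) N)"
proof -
  have "stop_set M (heavy t) N = (\<Union>n\<in>{..N}. {i. i div int M ^ (N - n) \<in> {i. real (hitcount n i) \<ge> t}})"
    by (auto simp: stop_set_def heavy_def)
  then show ?thesis
    by (simp only:) (intro finite_UN_I finite_atMost finite_vimage_div finite_hitcount_ge assms)
qed

lemma hitcount_le_sum_shift:
  assumes "n1 \<le> n" "i div int M ^ (n - n1) = q"
  defines "k \<equiv> n - n1"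
  shows "hitcount n i \<le> (\<Sum>v | v \<in> wrds n1 \<and> hits v q.
      hitcount k (i - \<lfloor>real M ^ k * pos v\<rfloor>) + hitcount k (i - \<lfloor>real M ^ k * pos v\<rfloor> - 1))"
proof -
  have n: "n = n1 + k" using assms by simp
  have "hitcount n i = (\<Sum>v\<in>wrds n1. \<Sum>u\<in>wrds k. of_bool (hits (v @ u) i))"
    unfolding hitcount_eq_sum n by (rule sum_wrds_append)
  also have "\<dots> = (\<Sum>v | v \<in> wrds n1 \<and> hits v q. \<Sum>u\<in>wrds k. of_bool (hits (v @ u) i))"
  proof (rule sum.mono_neutral_right)
    show "\<forall>v\<in>wrds n1 - {v \<in> wrds n1. hits v q}. (\<Sum>u\<in>wrds k. of_bool (hits (v @ u) i)) = (0::nat)"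
      using hits_append[of _ k _ i] assms(2) by (auto simp: k_def)
  qed auto
  also have "\<dots> \<le> (\<Sum>v | v \<in> wrds n1 \<and> hits v q. \<Sum>u\<in>wrds k.
      of_bool (hits u (i - \<lfloor>real M ^ k * pos v\<rfloor>)) + of_bool (hits u (i - \<lfloor>real M ^ k * pos v\<rfloor> - 1)))"
    using hits_append_shift[of _ k _ i] by (intro sum_mono) fastforce
  finally show ?thesis by (simp add: sum.distrib hitcount_eq_sum)
qed

text \<open>Self-similarity below one cell: each word hitting the cell contributes two translates of
  the count of level \<open>n - n1\<close>. Cauchy-Schwarz over those words costs their number, and
  summing over them costs it again.\<close>

lemma energy_under_cell:
  assumes "n1 \<le> n" "finite I"
    and q: "\<And>i. i \<in> I \<Longrightarrow> i div int M ^ (n - n1) = q"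
    and S: "\<And>J. finite J \<Longrightarrow> (\<Sum>i\<in>J. (real (hitcount (n - n1) i))\<^sup>2) \<le> S"
  shows "(\<Sum>i\<in>I. (real (hitcount n i))\<^sup>2) \<le> 4 * (real (hitcount n1 q))\<^sup>2 * S"
proof -
  define k where "k = n - n1"
  define V where "V = {v \<in> wrds n1. hits v q}"
  define a where "a v = \<lfloor>real M ^ k * pos v\<rfloor>" for v
  define f where "f v i = (real (hitcount k (i - a v)))\<^sup>2 + (real (hitcount k (i - a v - 1)))\<^sup>2" for v i
  have finV: "finite V" unfolding V_def by simp
  have cardV: "real (hitcount n1 q) = real (card V)" by (simp add: hitcount_def V_def)
  have 1: "(real (hitcount n i))\<^sup>2 \<le> 2 * real (card V) * (\<Sum>v\<in>V. f v i)" if "i \<in> I" for i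
  proof -
    define g where "g v = real (hitcount k (i - a v)) + real (hitcount k (i - a v - 1))" for v
    have "real (hitcount n i) \<le> (\<Sum>v\<in>V. g v)"
      using hitcount_le_sum_shift[OF assms(1) q[OF that]] unfolding V_def a_def k_def g_def
      by (metis (mono_tags, lifting) of_nat_add of_nat_le_iff of_nat_sum sum.cong)
    then have "(real (hitcount n i))\<^sup>2 \<le> (\<Sum>v\<in>V. 1 * g v)\<^sup>2" by (intro power_mono) auto
    also have "\<dots> \<le> (\<Sum>v\<in>V. 1\<^sup>2) * (\<Sum>v\<in>V. (g v)\<^sup>2)" by (rule Cauchy_Schwarz_ineq_sum)
    also have "\<dots> = card V * (\<Sum>v\<in>V. (g v)\<^sup>2)" by simp
    also have "\<dots> \<le> card V * (\<Sum>v\<in>V. 2 * f v i)"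
    proof (intro mult_left_mono sum_mono)
      fix v
      show "(g v)\<^sup>2 \<le> 2 * f v i" unfolding f_def g_def
        using sum_squares_bound[of "real (hitcount k (i - a v))" "real (hitcount k (i - a v - 1))"]
        by (simp add: power2_sum)
    qed simp
    finally show ?thesis by (simp add: sum_distrib_left mult_ac)
  qed
  have sh: "(\<Sum>i\<in>I. (real (hitcount k (i - b)))\<^sup>2) \<le> S" for b
  proof -
    have "(\<Sum>i\<in>I. (real (hitcount k (i - b)))\<^sup>2) = (\<Sum>i\<in>(\<lambda>i. i - b) ` I. (real (hitcount k i))\<^sup>2)"
      by (subst sum.reindex) (auto simp: inj_on_def)
    then show ?thesis using S[of "(\<lambda>i. i - b) ` I"] assms(2) by (simp add: k_def)
  qed
  have "(\<Sum>i\<in>I. (real (hitcount n i))\<^sup>2) \<le> (\<Sum>i\<in>I. 2 * real (card V) * (\<Sum>v\<in>V. f v i))"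
    by (intro sum_mono 1)
  also have "\<dots> = 2 * real (card V) * (\<Sum>v\<in>V. \<Sum>i\<in>I. f v i)"
    by (subst sum.swap) (simp add: sum_distrib_left)
  also have "\<dots> \<le> 2 * real (card V) * (\<Sum>v\<in>V. 2 * S)"
  proof (intro mult_left_mono sum_mono)
    fix v
    show "(\<Sum>i\<in>I. f v i) \<le> 2 * S"
      using sh[of "a v"] sh[of "a v + 1"] by (simp add: f_def sum.distrib diff_diff_eq)
  qed simp
  finally show ?thesis by (simp add: cardV power2_eq_square)
qed

text \<open>Strong induction on the level. Cells under no stopping cell have count at most
  \<open>t\<close> and give \<open>3 * t * M ^ n\<close>. Below a stopping cell the induction
  hypothesis applies to the remaining levels, and the smallness of the stopping set limits the sum
  of these contributions to as much again.\<close>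

lemma energy_bound:
  assumes t: "t > 1"
    and small: "8 * (real M)\<^sup>2 * t\<^sup>2 * real (card (stop_set M (heavy t) N)) \<le> real M ^ N"
  shows "n \<le> N \<Longrightarrow> finite I \<Longrightarrow> (\<Sum>i\<in>I. (real (hitcount n i))\<^sup>2) \<le> 6 * t * real M ^ n"
proof (induction n arbitrary: I rule: less_induct)
  case (less n)
  define C where "C = {(n1, q) \<in> stop_cells M (heavy t) N. n1 \<le> n}"
  define D where "D = (\<lambda>(n1, q). {i \<in> I. i div int M ^ (n - n1) = q})"
  have finC: "finite C" unfolding C_def
    using finite_stop_cells[OF M_pos finite_stop_set_heavy, of t N] t
    by (auto intro: finite_subset)
  have light: "real (hitcount n i) \<le> t" if "i \<in> I - (\<Union>c\<in>C. D c)" for i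
  proof (rule ccontr)
    assume "\<not> real (hitcount n i) \<le> t"
    then have "heavy t n i" by (simp add: heavy_def)
    then obtain n' where "n' \<le> n" "(n', i div int M ^ (n - n')) \<in> stop_cells M (heavy t) N"
      using less.prems by (rule_tac stop_cells_ancestor)
    then have "i \<in> (\<Union>c\<in>C. D c)" using that by (force simp: C_def D_def)
    then show False using that by simp
  qed
  have "(\<Sum>i\<in>I - (\<Union>c\<in>C. D c). (real (hitcount n i))\<^sup>2) \<le> (\<Sum>i\<in>I - (\<Union>c\<in>C. D c). t * real (hitcount n i))"
    using light by (intro sum_mono) (auto simp: power2_eq_square intro: mult_right_mono)
  also have "\<dots> = t * real (\<Sum>i\<in>I - (\<Union>c\<in>C. D c). hitcount n i)" by (simp add: sum_distrib_left)
  also have "\<dots> \<le> t * real (3 * M ^ n)"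
    using t less.prems by (intro mult_left_mono of_nat_mono sum_hitcount_le) auto
  finally have L: "(\<Sum>i\<in>I - (\<Union>c\<in>C. D c). (real (hitcount n i))\<^sup>2) \<le> 3 * t * real M ^ n" by simp
  have under: "(\<Sum>i\<in>D c. (real (hitcount n i))\<^sup>2) \<le> 24 * (real M)\<^sup>2 * t ^ 3 * real M ^ (n - fst c)"
    if cC: "c \<in> C" for c
  proof -
    obtain n1 q where c: "c = (n1, q)" "(n1, q) \<in> stop_cells M (heavy t) N" "n1 \<le> n"
      using cC unfolding C_def by blast
    \<comment> \<open>At level 0 the only word is the empty one, so a count of \<open>t > 1\<close>
      cannot occur. Hence the stopping cell has a parent, and that parent is not heavy.\<close>
    have "n1 \<noteq> 0"
    proof
      assume "n1 = 0"
      then have "real (hitcount 0 q) \<ge> t" using c by (simp add: stop_cells_def heavy_def)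
      then show False using hitcount_0_le[of q] t by linarith
    qed
    then obtain n0 where n0: "n1 = Suc n0" by (cases n1) auto
    have "\<not> heavy t n0 (q div int M ^ (n1 - n0))" using c n0 by (auto simp: stop_cells_def)
    then have "real (hitcount n0 (q div int M)) < t" by (simp add: heavy_def n0)
    moreover have "real (hitcount n1 q) \<le> real M * real (hitcount n0 (q div int M))"
      using hitcount_Suc_le[of n0 q] n0 by (metis of_nat_le_iff of_nat_mult)
    ultimately have m: "real (hitcount n1 q) \<le> real M * t"
      by (meson less_eq_real_def mult_left_mono of_nat_0_le_iff order_trans)
    have "(\<Sum>i\<in>D c. (real (hitcount n i))\<^sup>2) \<le> 4 * (real (hitcount n1 q))\<^sup>2 * (6 * t * real M ^ (n - n1))"
    proof (rule energy_under_cell)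
      show "finite (D c)" using less.prems by (auto simp: D_def c)
      show "(\<Sum>i\<in>J. (real (hitcount (n - n1) i))\<^sup>2) \<le> 6 * t * real M ^ (n - n1)" if "finite J" for J
        using that \<open>n1 \<noteq> 0\<close> c less.prems by (intro less.IH) auto
    qed (use c in \<open>auto simp: D_def\<close>)
    also have "\<dots> \<le> 4 * (real M * t)\<^sup>2 * (6 * t * real M ^ (n - n1))"
      using m t by (intro mult_right_mono mult_left_mono power_mono) auto
    finally show ?thesis by (simp add: c power2_eq_square power3_eq_cube mult_ac)
  qed
  \<comment> \<open>Measured on level \<open>N\<close>, the stopping cells down to level
    \<open>n\<close> fill a part of the stopping set.\<close>
  have scale: "real M ^ (N - n) * (\<Sum>c\<in>C. real M ^ (n - fst c)) \<le> real (card (stop_set M (heavy t) N))"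
  proof -
    have "real M ^ (N - n) * (\<Sum>c\<in>C. real M ^ (n - fst c)) = (\<Sum>c\<in>C. real M ^ (N - fst c))"
      unfolding sum_distrib_left
    proof (rule sum.cong)
      fix c assume "c \<in> C"
      then have "N - n + (n - fst c) = N - fst c" using less.prems by (auto simp: C_def)
      then show "real M ^ (N - n) * real M ^ (n - fst c) = real M ^ (N - fst c)"
        by (metis power_add)
    qed simp
    also have "\<dots> \<le> (\<Sum>c\<in>stop_cells M (heavy t) N. real M ^ (N - fst c))"
      using t by (intro sum_mono2 finite_stop_cells[OF M_pos finite_stop_set_heavy]) (auto simp: C_def)
    also have "\<dots> = real (card (stop_set M (heavy t) N))"
      using t by (subst card_stop_set[OF M_pos finite_stop_set_heavy]) (auto simp: case_prod_beta)
    finally show ?thesis .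
  qed
  have "(\<Sum>i\<in>(\<Union>c\<in>C. D c). (real (hitcount n i))\<^sup>2) \<le> (\<Sum>c\<in>C. \<Sum>i\<in>D c. (real (hitcount n i))\<^sup>2)"
    using less.prems
    by (intro sum_UNION_le finC) (auto simp: D_def)
  also have "\<dots> \<le> (\<Sum>c\<in>C. 24 * (real M)\<^sup>2 * t ^ 3 * real M ^ (n - fst c))"
    by (intro sum_mono under)
  also have "\<dots> = 24 * (real M)\<^sup>2 * t ^ 3 * (\<Sum>c\<in>C. real M ^ (n - fst c))"
    by (simp add: sum_distrib_left)
  \<comment> \<open>The factor \<open>24 * M^2 * t^3\<close> meets a length fraction of at most
    \<open>1 / (8 * M^2 * t^2)\<close>.\<close>
  also have "\<dots> \<le> 3 * t * real M ^ n"
  proof -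
    have "real M ^ (N - n) * (24 * (real M)\<^sup>2 * t ^ 3 * (\<Sum>c\<in>C. real M ^ (n - fst c)))
        = 3 * t * (8 * (real M)\<^sup>2 * t\<^sup>2 * (real M ^ (N - n) * (\<Sum>c\<in>C. real M ^ (n - fst c))))"
      by (simp add: power2_eq_square power3_eq_cube mult_ac)
    also have "\<dots> \<le> 3 * t * (8 * (real M)\<^sup>2 * t\<^sup>2 * real (card (stop_set M (heavy t) N)))"
      using scale t by (intro mult_left_mono) auto
    also have "\<dots> \<le> 3 * t * real M ^ N" using small t by (intro mult_left_mono) auto
    also have "\<dots> = real M ^ (N - n) * (3 * t * real M ^ n)"
      using less.prems by (simp add: power_add[symmetric] mult_ac)
    finally show ?thesis using M_pos by (simp only: mult_le_cancel_left_pos zero_less_power of_nat_0_less_iff)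
  qed
  finally have H: "(\<Sum>i\<in>(\<Union>c\<in>C. D c). (real (hitcount n i))\<^sup>2) \<le> 3 * t * real M ^ n" .
  have "I = (I - (\<Union>c\<in>C. D c)) \<union> (\<Union>c\<in>C. D c)" by (auto simp: D_def)
  then have "(\<Sum>i\<in>I. (real (hitcount n i))\<^sup>2)
      = (\<Sum>i\<in>I - (\<Union>c\<in>C. D c). (real (hitcount n i))\<^sup>2) + (\<Sum>i\<in>(\<Union>c\<in>C. D c). (real (hitcount n i))\<^sup>2)"
    using less.prems finC by (metis (no_types, lifting) Diff_disjoint finite_Un inf_commute sum.union_disjoint)
  then show ?case using L H by linarith
qed

end

section \<open>Heavy words and the length of the shadow\<close>

lemma abs_div_shift_le:
  fixes q r D :: int
  assumes "D > 0" "\<bar>r\<bar> \<le> 2"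
  shows "\<bar>q div D - (q + r) div D\<bar> \<le> 2"
proof -
  have "(q + 2 * D) div D = q div D + 2" "(q + (- 2) * D) div D = q div D + (- 2)"
    using assms by (simp_all only: div_mult_self1 less_imp_neq[symmetric] not_False_eq_True)
  moreover have "(q + r) div D \<le> (q + 2 * D) div D"
    using assms by (intro zdiv_mono1) linarith+
  moreover have "(q + (- 2) * D) div D \<le> (q + r) div D"
    using assms by (intro zdiv_mono1) linarith+
  ultimately show ?thesis by linarith
qed

lemma measure_translate_lebesgue: "measure lebesgue ((\<lambda>x. a + x) ` S) = measure lebesgue (S :: real set)"
  using measure_translation[of a S] by simp

lemma measure_scale_lebesgue:
  fixes S :: "real set"
  shows "measure lebesgue ((\<lambda>x. a * x) ` S) = \<bar>a\<bar> * measure lebesgue S"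
  using measure_lebesgue_affine[of a 0 S] by simp

context digit_system
begin

lemma wrds_appendE:
  assumes "w \<in> wrds (a + b)"
  obtains v u where "v \<in> wrds a" "u \<in> wrds b" "w = v @ u"
proof -
  have "w \<in> (\<lambda>(v, u). v @ u) ` (wrds a \<times> wrds b)"
    using bij_betw_wrds_append[of a b] assms unfolding bij_betw_def by simp
  then show ?thesis using that by auto
qed

text \<open>Counts every word of length \<open>N\<close> once, in the cell containing it, whereas
  \<open>heavy\<close> counts a word in three cells. Density is thus a statement about proportions
  of words and adds over disjoint cells.\<close>

definition dense :: "nat \<Rightarrow> real \<Rightarrow> nat \<Rightarrow> int \<Rightarrow> bool" where
  "dense N K n q \<longleftrightarrow> real (card {w \<in> wrds N. \<lfloor>pos w\<rfloor> div int M ^ (N - n) = q}) \<ge> K * real M ^ (N - n)"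

lemma finite_stop_set_dense:
  assumes "K > 0"
  shows "finite (stop_set M (dense N K) N)"
proof (rule finite_subset)
  show "stop_set M (dense N K) N \<subseteq> (\<Union>n\<in>{..N}. {i. i div int M ^ (N - n) \<in> (\<lambda>w. \<lfloor>pos w\<rfloor> div int M ^ (N - n)) ` wrds N})"
  proof
    fix i assume "i \<in> stop_set M (dense N K) N"
    then obtain n where n: "n \<le> N" "dense N K n (i div int M ^ (N - n))" by (auto simp: stop_set_def)
    have "K * real M ^ (N - n) > 0" using assms M_pos by simp
    then have "card {w \<in> wrds N. \<lfloor>pos w\<rfloor> div int M ^ (N - n) = i div int M ^ (N - n)} > 0"
      using n(2) unfolding dense_def by linarith
    then have "{w \<in> wrds N. \<lfloor>pos w\<rfloor> div int M ^ (N - n) = i div int M ^ (N - n)} \<noteq> {}"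
      by (metis card.empty less_irrefl)
    then have "i div int M ^ (N - n) \<in> (\<lambda>w. \<lfloor>pos w\<rfloor> div int M ^ (N - n)) ` wrds N" by (auto intro: rev_image_eqI)
    then show "i \<in> (\<Union>n\<in>{..N}. {i. i div int M ^ (N - n) \<in> (\<lambda>w. \<lfloor>pos w\<rfloor> div int M ^ (N - n)) ` wrds N})"
      using n(1) by blast
  qed
  show "finite (\<Union>n\<in>{..N}. {i. i div int M ^ (N - n) \<in> (\<lambda>w. \<lfloor>pos w\<rfloor> div int M ^ (N - n)) ` wrds N})"
    by (intro finite_UN_I finite_atMost finite_vimage_div finite_imageI finite_wrds)
qed

definition dense_words :: "nat \<Rightarrow> real \<Rightarrow> nat list set" where
  "dense_words N K = {w \<in> wrds N. \<lfloor>pos w\<rfloor> \<in> stop_set M (dense N K) N}"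

text \<open>A stopping cell consists of \<open>M ^ (N - n)\<close> fine cells and carries at least
  \<open>K\<close> times as many words; distinct stopping cells share none.\<close>

lemma dense_words_ge:
  assumes "K > 0"
  shows "K * real (card (stop_set M (dense N K) N)) \<le> real (card (dense_words N K))"
proof -
  define C where "C = stop_cells M (dense N K) N"
  define E where "E = (\<lambda>(n, q). {w \<in> wrds N. \<lfloor>pos w\<rfloor> \<in> refines M N n q})"
  have finC: "finite C" unfolding C_def by (rule finite_stop_cells[OF M_pos finite_stop_set_dense[OF assms]])
  have eq: "dense_words N K = (\<Union>c\<in>C. E c)"
    unfolding dense_words_def stop_set_eq C_def E_def by blast
  have "card (\<Union>c\<in>C. E c) = (\<Sum>c\<in>C. card (E c))"
  proof (rule card_UN_disjoint[OF finC])
    show "\<forall>c\<in>C. finite (E c)" by (auto simp: E_def)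
    show "\<forall>c\<in>C. \<forall>d\<in>C. c \<noteq> d \<longrightarrow> E c \<inter> E d = {}"
      unfolding C_def E_def using disjoint_refines_stop_cells[of _ _ M "dense N K" N] by fast
  qed
  then have "real (card (dense_words N K)) = (\<Sum>c\<in>C. real (card (E c)))" by (simp add: eq)
  also have "\<dots> \<ge> (\<Sum>c\<in>C. K * real M ^ (N - fst c))"
  proof (rule sum_mono)
    fix c assume "c \<in> C"
    moreover obtain n q where "c = (n, q)" by (cases c)
    ultimately show "K * real M ^ (N - fst c) \<le> real (card (E c))"
      by (simp add: C_def E_def stop_cells_def dense_def refines_def)
  qed
  also have "(\<Sum>c\<in>C. K * real M ^ (N - fst c)) = K * real (card (stop_set M (dense N K) N))"
    unfolding card_stop_set[OF M_pos finite_stop_set_dense[OF assms]] C_def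
    by (simp add: case_prod_beta sum_distrib_left)
  finally show ?thesis .
qed

text \<open>All extensions of a word hitting \<open>q\<close> stay within two cells of
  \<open>q\<close>: one for the prefix and one for the extension. Five cells thus share at least
  \<open>t * M ^ k\<close> words, and one of them gets a fifth.\<close>

lemma heavy_imp_dense_nearby:
  assumes "n \<le> N" "heavy t n q"
  obtains r where "\<bar>r\<bar> \<le> 2" "dense N (t / 5) n (q + r)"
proof -
  define k where "k = N - n"
  have N: "N = n + k" using assms by (simp add: k_def)
  define g where "g r = card {w \<in> wrds N. \<lfloor>pos w\<rfloor> div int M ^ k = q + r}" for r
  have "t * real M ^ k \<le> real (hitcount n q * M ^ k)"
    using assms(2) by (auto simp: heavy_def intro: mult_right_mono)
  also have "hitcount n q * M ^ k = (\<Sum>v\<in>wrds n. \<Sum>u\<in>wrds k. of_bool (hits v q))"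
    by (simp add: hitcount_eq_sum card_wrds sum_distrib_left mult.commute)
  also have "\<dots> \<le> (\<Sum>v\<in>wrds n. \<Sum>u\<in>wrds k. \<Sum>r\<in>{-2..2}. of_bool (\<lfloor>pos (v @ u)\<rfloor> div int M ^ k = q + r))"
  proof (intro sum_mono)
    fix v u assume u: "u \<in> wrds k"
    define s where "s = \<lfloor>pos (v @ u)\<rfloor> div int M ^ k - q"
    have "hits v (\<lfloor>pos (v @ u)\<rfloor> div int M ^ k)"
      by (rule hits_append[OF u]) (simp add: hits_def)
    then have "s \<in> {-2..2}" if "hits v q" using that unfolding hits_def s_def by auto
    moreover have "(of_bool True :: nat) \<le> (\<Sum>r\<in>{-2..2}. of_bool (\<lfloor>pos (v @ u)\<rfloor> div int M ^ k = q + r))"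
      if "s \<in> {-2..2}"
    proof -
      have "(of_bool (\<lfloor>pos (v @ u)\<rfloor> div int M ^ k = q + s) :: nat)
          \<le> (\<Sum>r\<in>{-2..2}. of_bool (\<lfloor>pos (v @ u)\<rfloor> div int M ^ k = q + r))"
        using that by (intro member_le_sum) auto
      then show ?thesis by (simp add: s_def)
    qed
    ultimately show "(of_bool (hits v q) :: nat)
        \<le> (\<Sum>r\<in>{-2..2}. of_bool (\<lfloor>pos (v @ u)\<rfloor> div int M ^ k = q + r))" by auto
  qed
  also have "\<dots> = (\<Sum>w\<in>wrds N. \<Sum>r\<in>{-2..2}. of_bool (\<lfloor>pos w\<rfloor> div int M ^ k = q + r))"
    unfolding N by (rule sum_wrds_append[symmetric])
  also have "\<dots> = (\<Sum>r\<in>{-2..2}. g r)"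
    by (subst sum.swap) (simp add: g_def Int_def conj_commute)
  finally have *: "t * real M ^ k \<le> (\<Sum>r\<in>{-2..2}. real (g r))" by simp
  have "\<exists>r\<in>{-2..2}. real (g r) \<ge> t / 5 * real M ^ k"
  proof (rule ccontr)
    assume "\<not> (\<exists>r\<in>{-2..2}. real (g r) \<ge> t / 5 * real M ^ k)"
    then have "(\<Sum>r\<in>{-2..2}. real (g r)) < (\<Sum>r\<in>{-2..2::int}. t / 5 * real M ^ k)"
      by (intro sum_strict_mono) (auto simp: not_le)
    then show False using * by simp
  qed
  then obtain r where "r \<in> {-2..2}" "real (g r) \<ge> t / 5 * real M ^ k" by blast
  then show ?thesis using that[of r] by (simp add: dense_def g_def k_def abs_le_iff)
qed

text \<open>Every heavy cell is within two cells of a dense one, and this distance does not grow on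
  passing to the stopping ancestor, so five translates of the dense stopping cells cover the heavy
  set.\<close>

lemma card_heavy_le_dense:
  assumes "t > 0"
  shows "card (stop_set M (heavy t) N) \<le> 5 * card (stop_set M (dense N (t / 5)) N)"
proof -
  define C where "C = stop_cells M (dense N (t / 5)) N"
  have t5: "t / 5 > 0" using assms by simp
  have finC: "finite C" unfolding C_def by (rule finite_stop_cells[OF M_pos finite_stop_set_dense[OF t5]])
  have sub: "stop_set M (heavy t) N \<subseteq> (\<Union>c\<in>C. \<Union>r\<in>{-2..2}. refines M N (fst c) (snd c + r))"
  proof
    fix i assume "i \<in> stop_set M (heavy t) N"
    then obtain n where n: "n \<le> N" "heavy t n (i div int M ^ (N - n))" by (auto simp: stop_set_def)
    define q where "q = i div int M ^ (N - n)"
    obtain r where r: "\<bar>r\<bar> \<le> 2" "dense N (t / 5) n (q + r)"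
      using heavy_imp_dense_nearby[OF n] unfolding q_def by blast
    obtain n' where n': "n' \<le> n" "(n', (q + r) div int M ^ (n - n')) \<in> C"
      using stop_cells_ancestor[of n N "dense N (t / 5)" "q + r", OF n(1) r(2)] unfolding C_def by blast
    define s where "s = q div int M ^ (n - n') - (q + r) div int M ^ (n - n')"
    have "N - n + (n - n') = N - n'" using n n' by simp
    then have "i div int M ^ (N - n') = q div int M ^ (n - n')" by (simp add: q_def div_power_div_power)
    then have "i \<in> refines M N n' ((q + r) div int M ^ (n - n') + s)" by (simp add: refines_def s_def)
    moreover have "s \<in> {-2..2}"
      using abs_div_shift_le[OF _ r(1), of "int M ^ (n - n')" q] M_pos unfolding s_def by auto
    ultimately show "i \<in> (\<Union>c\<in>C. \<Union>r\<in>{-2..2}. refines M N (fst c) (snd c + r))"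
      using n'(2) by (intro UN_I[of "(n', (q + r) div int M ^ (n - n'))"]) auto
  qed
  have "card (stop_set M (heavy t) N) \<le> card (\<Union>c\<in>C. \<Union>r\<in>{-2..2}. refines M N (fst c) (snd c + r))"
    using finC by (intro card_mono sub) (auto simp: finite_refines[OF M_pos])
  also have "\<dots> \<le> (\<Sum>c\<in>C. card (\<Union>r\<in>{-2..2}. refines M N (fst c) (snd c + r)))"
    by (rule card_UN_le[OF finC])
  also have "\<dots> \<le> (\<Sum>c\<in>C. \<Sum>r\<in>{-2..2}. card (refines M N (fst c) (snd c + r)))"
    by (intro sum_mono card_UN_le) auto
  also have "\<dots> = (\<Sum>c\<in>C. 5 * M ^ (N - fst c))" by (simp add: card_refines[OF M_pos])
  also have "\<dots> = 5 * card (stop_set M (dense N (t / 5)) N)"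
    unfolding card_stop_set[OF M_pos finite_stop_set_dense[OF t5]] C_def
    by (simp add: case_prod_beta sum_distrib_left)
  finally show ?thesis .
qed

section \<open>Length of the projected generations and its contraction\<close>

definition shadow :: "nat \<Rightarrow> real set" where
  "shadow n = (\<Union>w\<in>wrds n. {pos w - 1..pos w + 1})"

definition shadow_length :: "nat \<Rightarrow> real" where
  "shadow_length n = measure lebesgue (shadow n) / real M ^ n"

lemma compact_shadow: "compact (shadow n)"
  unfolding shadow_def by (intro compact_UN) auto

lemma lmeasurable_shadow: "shadow n \<in> lmeasurable"
  by (intro lmeasurable_compact compact_shadow)

text \<open>Intervals of extensions nest inside the rescaled interval of the prefix; this makes the
  normalized lengths decrease.\<close>

lemma pos_append_interval:
  assumes "u \<in> wrds k"
  shows "{pos (v @ u) - 1..pos (v @ u) + 1} \<subseteq> {real M ^ k * (pos v - 1)..real M ^ k * (pos v + 1)}"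
proof -
  define P where "P = real M ^ k"
  have "P \<ge> 1" using M3 by (simp add: P_def)
  moreover have "\<bar>pos u\<bar> \<le> (P - 1) / 8"
    using abs_pos_le[of u] assms by (simp add: wrds_def P_def)
  ultimately have "\<bar>pos u\<bar> + 1 \<le> P" by argo
  moreover have "pos (v @ u) = P * pos v + pos u"
    using assms by (simp add: pos_append wrds_def P_def)
  ultimately show ?thesis unfolding P_def[symmetric] by (auto simp: algebra_simps)
qed

lemma shadow_length_0: "shadow_length 0 = 2"
  by (simp add: shadow_length_def shadow_def)

lemma shadow_length_antimono:
  assumes "n \<le> m"
  shows "shadow_length m \<le> shadow_length n"
proof -
  define k where "k = m - n"
  have m: "m = n + k" using assms by (simp add: k_def)
  have P: "real M ^ k > 0" using M_pos by simp
  have "shadow m \<subseteq> (\<lambda>x. real M ^ k * x) ` shadow n"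
  proof
    fix x assume "x \<in> shadow m"
    then obtain w where w: "w \<in> wrds (n + k)" "x \<in> {pos w - 1..pos w + 1}" by (auto simp: shadow_def m)
    from w(1) obtain v u where vu: "v \<in> wrds n" "u \<in> wrds k" "w = v @ u"
      by (rule wrds_appendE)
    then have "x \<in> {real M ^ k * (pos v - 1)..real M ^ k * (pos v + 1)}"
      using w(2) pos_append_interval[of u k v] by blast
    then have "x / real M ^ k \<in> {pos v - 1..pos v + 1}"
      using P by (auto simp: field_simps)
    then have "x / real M ^ k \<in> shadow n" using vu by (auto simp: shadow_def)
    then show "x \<in> (\<lambda>x. real M ^ k * x) ` shadow n"
      using P by (intro image_eqI[of _ _ "x / real M ^ k"]) auto
  qed
  then have "measure lebesgue (shadow m) \<le> measure lebesgue ((\<lambda>x. real M ^ k * x) ` shadow n)"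
    using lmeasurable_shadow[of m] compact_shadow[of n]
    by (intro measure_mono_fmeasurable lmeasurable_compact compact_continuous_image)
       (auto intro!: continuous_intros)
  then have "measure lebesgue (shadow m) \<le> real M ^ k * measure lebesgue (shadow n)"
    by (simp add: measure_scale_lebesgue)
  then show ?thesis using M_pos unfolding shadow_length_def m by (simp add: power_add field_simps)
qed

lemma shadow_length_le_2: "shadow_length n \<le> 2"
  using shadow_length_antimono[of 0 n] shadow_length_0 by simp

text \<open>Split words by their first \<open>N\<close> letters. Dense prefixes fall into few cells,
  each costing length 3 because intervals stick out by 1 on either side. Every other prefix costs
  one translate of the whole shadow of depth \<open>n\<close>.\<close>

lemma shadow_length_contract:
  fixes N n
  assumes "K > 0"
  defines "p \<equiv> real (card (dense_words N K)) / real M ^ N"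
  shows "shadow_length (N + n) \<le> 3 * p / K + (1 - p) * shadow_length n"
proof -
  define B where "B = stop_set M (dense N K) N"
  define H where "H = dense_words N K"
  define P where "P = real M ^ n"
  have P: "P > 0" using M_pos by (simp add: P_def)
  have finB: "finite B" unfolding B_def by (rule finite_stop_set_dense[OF assms(1)])
  have H: "H \<subseteq> wrds N" "finite H" unfolding H_def dense_words_def by auto
  define U1 where "U1 = (\<Union>b\<in>B. {P * (real_of_int b - 1)..P * (real_of_int b + 2)})"
  define U2 where "U2 = (\<Union>w\<in>wrds N - H. (\<lambda>x. P * pos w + x) ` shadow n)"
  have sub: "shadow (N + n) \<subseteq> U1 \<union> U2"
  proof
    fix x assume "x \<in> shadow (N + n)"
    then obtain w where w: "w \<in> wrds (N + n)" "x \<in> {pos w - 1..pos w + 1}" by (auto simp: shadow_def)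
    from w(1) obtain v u where vu: "v \<in> wrds N" "u \<in> wrds n" "w = v @ u"
      by (rule wrds_appendE)
    show "x \<in> U1 \<union> U2"
    proof (cases "v \<in> H")
      case True
      then have b: "\<lfloor>pos v\<rfloor> \<in> B" by (auto simp: H_def B_def dense_words_def)
      have "x \<in> {P * (pos v - 1)..P * (pos v + 1)}"
        using w(2) vu pos_append_interval[of u n v] by (auto simp: P_def)
      moreover have "P * (real_of_int \<lfloor>pos v\<rfloor> - 1) \<le> P * (pos v - 1)"
        "P * (pos v + 1) \<le> P * (real_of_int \<lfloor>pos v\<rfloor> + 2)"
        using P by (auto intro!: mult_left_mono) linarith
      ultimately have "x \<in> {P * (real_of_int \<lfloor>pos v\<rfloor> - 1)..P * (real_of_int \<lfloor>pos v\<rfloor> + 2)}" by auto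
      then show ?thesis using b unfolding U1_def by blast
    next
      case False
      have "pos w = P * pos v + pos u" using vu by (simp add: pos_append wrds_def P_def)
      then have "x - P * pos v \<in> shadow n" using vu w(2) by (force simp: shadow_def)
      then have "x \<in> (\<lambda>x. P * pos v + x) ` shadow n" by (intro image_eqI[of _ _ "x - P * pos v"]) auto
      then show ?thesis using vu False unfolding U2_def by blast
    qed
  qed
  have lm2: "(\<lambda>x. P * pos w + x) ` shadow n \<in> lmeasurable" for w
    using measurable_translation[OF lmeasurable_shadow] by simp
  have lU1: "U1 \<in> lmeasurable" unfolding U1_def using finB by (intro lmeasurable_compact compact_UN) auto
  have lU2: "U2 \<in> lmeasurable" unfolding U2_def
    by (intro lmeasurable_compact compact_UN compact_continuous_image compact_shadow)
       (auto intro!: continuous_intros)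
  have "measure lebesgue (shadow (N + n)) \<le> measure lebesgue (U1 \<union> U2)"
    using sub lU1 lU2 lmeasurable_shadow by (intro measure_mono_fmeasurable) auto
  also have "\<dots> \<le> measure lebesgue U1 + measure lebesgue U2"
    using lU1 lU2 by (intro measure_Un_le) auto
  also have "measure lebesgue U1 \<le> (\<Sum>b\<in>B. measure lebesgue {P * (real_of_int b - 1)..P * (real_of_int b + 2)})"
    unfolding U1_def using finB by (intro measure_UNION_le) auto
  also have "\<dots> = (\<Sum>b\<in>B. 3 * P)" using P by (intro sum.cong) (auto simp: algebra_simps)
  also have "\<dots> = 3 * P * real (card B)" by simp
  also have "measure lebesgue U2 \<le> (\<Sum>w\<in>wrds N - H. measure lebesgue ((\<lambda>x. P * pos w + x) ` shadow n))"
    unfolding U2_def using lm2 by (intro measure_UNION_le) auto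
  also have "\<dots> = real (card (wrds N - H)) * measure lebesgue (shadow n)"
    by (simp add: measure_translate_lebesgue)
  also have "real (card (wrds N - H)) = real M ^ N - real (card H)"
    using H by (simp add: card_Diff_subset card_wrds of_nat_diff card_mono flip: card_wrds)
  finally have "measure lebesgue (shadow (N + n))
      \<le> 3 * P * real (card B) + (real M ^ N - real (card H)) * measure lebesgue (shadow n)" by simp
  moreover have "real (card B) \<le> real (card H) / K"
    using dense_words_ge[OF assms(1), of N] assms(1) by (simp add: B_def H_def field_simps)
  ultimately have "measure lebesgue (shadow (N + n))
      \<le> 3 * P * (real (card H) / K) + (real M ^ N - real (card H)) * measure lebesgue (shadow n)"
    using P by (smt (verit) mult_left_mono)
  then have "measure lebesgue (shadow (N + n)) / (real M ^ N * P)
      \<le> (3 * P * (real (card H) / K) + (real M ^ N - real (card H)) * measure lebesgue (shadow n)) / (real M ^ N * P)"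
    using P M_pos by (intro divide_right_mono) auto
  also have "\<dots> = 3 * p / K + (1 - p) * shadow_length n"
    using P M_pos assms(1) unfolding p_def shadow_length_def H_def[symmetric] P_def[symmetric]
    by (simp add: add_divide_distrib diff_divide_distrib left_diff_distrib)
  finally show ?thesis by (simp add: shadow_length_def power_add P_def)
qed

text \<open>The contraction is an affine map with fixed point \<open>15 / t\<close> and slope
  \<open>1 - p\<close>, iterated from the value 2. Largeness of the heavy set forces
  \<open>p >= 1 / (200 * M^2 * t)\<close> through the comparison with dense cells at
  \<open>K = t / 5\<close>.\<close>

lemma shadow_length_decay:
  assumes t: "t > 1"
    and large: "8 * (real M)\<^sup>2 * t\<^sup>2 * real (card (stop_set M (heavy t) N)) > real M ^ N"
    and n: "n \<ge> k * N"
  shows "shadow_length n \<le> 15 / t + 2 * (1 - 1 / (200 * (real M)\<^sup>2 * t)) ^ k"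
proof -
  define K where "K = t / 5"
  define p where "p = real (card (dense_words N K)) / real M ^ N"
  define p0 where "p0 = 1 / (200 * (real M)\<^sup>2 * t)"
  have K: "K > 0" using t by (simp add: K_def)
  have M2: "(real M)\<^sup>2 > 0" using M_pos by simp
  have MN: "real M ^ N > 0" using M_pos by simp
  have "real (card (stop_set M (heavy t) N)) \<le> 5 * real (card (stop_set M (dense N K) N))"
    using card_heavy_le_dense[of t N] t unfolding K_def
    by (metis dual_order.strict_trans of_nat_le_iff of_nat_mult of_nat_numeral zero_less_one)
  also have "\<dots> \<le> 5 * (real (card (dense_words N K)) / K)"
    using dense_words_ge[OF K, of N] K by (simp add: field_simps)
  also have "\<dots> = 25 * real (card (dense_words N K)) / t" by (simp add: K_def)
  finally have "8 * (real M)\<^sup>2 * t\<^sup>2 * real (card (stop_set M (heavy t) N))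
      \<le> 8 * (real M)\<^sup>2 * t\<^sup>2 * (25 * real (card (dense_words N K)) / t)"
    using t by (intro mult_left_mono) auto
  also have "\<dots> = 200 * (real M)\<^sup>2 * t * real (card (dense_words N K))"
    using t by (simp add: power2_eq_square)
  finally have "real M ^ N \<le> 200 * (real M)\<^sup>2 * t * real (card (dense_words N K))"
    using large by linarith
  then have "p0 \<le> p" using M2 MN t unfolding p_def p0_def by (simp add: field_simps)
  have "card (dense_words N K) \<le> M ^ N"
    unfolding card_wrds[symmetric] by (intro card_mono) (auto simp: dense_words_def)
  then have "p \<le> 1" using MN unfolding p_def
    by (simp add: divide_le_eq flip: of_nat_power)
  have "0 < p0" using M2 t by (simp add: p0_def)
  have step: "shadow_length (N + n) \<le> p * (15 / t) + (1 - p) * shadow_length n" for n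
    using shadow_length_contract[OF K, of N n] t unfolding p_def[symmetric] by (simp add: K_def mult.commute)
  have "shadow_length (k * N) \<le> 15 / t + 2 * (1 - p) ^ k"
  proof (induction k)
    case 0
    then show ?case using shadow_length_0 t by simp
  next
    case (Suc k)
    have "shadow_length (Suc k * N) \<le> p * (15 / t) + (1 - p) * shadow_length (k * N)"
      using step[of "k * N"] by simp
    also have "\<dots> \<le> p * (15 / t) + (1 - p) * (15 / t + 2 * (1 - p) ^ k)"
      using Suc \<open>p \<le> 1\<close> by (intro add_left_mono mult_left_mono) auto
    also have "\<dots> = 15 / t + 2 * (1 - p) ^ Suc k" by (simp add: algebra_simps diff_divide_distrib)
    finally show ?case .
  qed
  moreover have "(1 - p) ^ k \<le> (1 - p0) ^ k"
    using \<open>p0 \<le> p\<close> \<open>p \<le> 1\<close> by (intro power_mono) auto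
  ultimately show ?thesis
    using shadow_length_antimono[OF n] unfolding p0_def by linarith
qed

end

section \<open>Mean values of exponential sums\<close>

text \<open>The cosine transform of the weight \<open>1 - x\<close> on the unit interval, with its
  limit 1/2 at 0. Its nonnegativity is what allows cross terms to be dropped from below.\<close>

definition fejer :: "real \<Rightarrow> real" where
  "fejer t = (if t = 0 then 1 / 2 else (1 - cos t) / t\<^sup>2)"

lemma has_integral_fejer: "((\<lambda>x. (1 - x) * cos (x * t)) has_integral fejer t) {0..1}"
proof (cases "t = 0")
  case True
  have "((\<lambda>x::real. 1 - x) has_integral ((1 - 1\<^sup>2 / 2) - (0 - 0\<^sup>2 / 2))) {0..1}"
    by (rule fundamental_theorem_of_calculus)
       (auto intro!: derivative_eq_intros simp: has_real_derivative_iff_has_vector_derivative[symmetric])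
  then show ?thesis by (simp add: True fejer_def)
next
  case False
  have "((\<lambda>x. (1 - x) * cos (x * t)) has_integral
      (((1 - 1) * sin (1 * t) / t - cos (1 * t) / t\<^sup>2) - ((1 - 0) * sin (0 * t) / t - cos (0 * t) / t\<^sup>2))) {0..1}"
    by (rule fundamental_theorem_of_calculus)
       (use False in \<open>auto intro!: derivative_eq_intros
          simp: has_real_derivative_iff_has_vector_derivative[symmetric] field_simps power2_eq_square\<close>)
  then show ?thesis using False by (simp add: fejer_def diff_divide_distrib)
qed

lemma fejer_nonneg: "fejer t \<ge> 0"
  by (simp add: fejer_def)

lemma fejer_le_half: "fejer t \<le> 1 / 2"
proof -
  have "((\<lambda>x. (1 - x) * cos (x * 0)) has_integral fejer 0) {0..1}" by (rule has_integral_fejer)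
  moreover have "(1 - x) * cos (x * t) \<le> (1 - x) * cos (x * 0)" if "x \<in> {0..1}" for x
    using that by (simp add: mult_left_le)
  ultimately have "fejer t \<le> fejer 0" using has_integral_le[OF has_integral_fejer[of t]] by blast
  then show ?thesis by (simp add: fejer_def)
qed

lemma fejer_le: "t \<noteq> 0 \<Longrightarrow> fejer t \<le> 2 / t\<^sup>2"
  using cos_ge_minus_one[of t] by (simp add: fejer_def divide_right_mono)

text \<open>A majorant of the kernel that sees only floors: numbers whose floors differ by
  \<open>d\<close> are at least \<open>\<bar>d\<bar> - 1\<close> apart.\<close>

definition fejer_cell :: "int \<Rightarrow> real" where
  "fejer_cell d = (if \<bar>d\<bar> \<le> 1 then 1 / 2 else 2 / (real_of_int \<bar>d\<bar> - 1)\<^sup>2)"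

lemma fejer_le_cell: "fejer (x - y) \<le> fejer_cell (\<lfloor>x\<rfloor> - \<lfloor>y\<rfloor>)"
proof (cases "\<bar>\<lfloor>x\<rfloor> - \<lfloor>y\<rfloor>\<bar> \<le> 1")
  case True
  then show ?thesis using fejer_le_half by (simp add: fejer_cell_def)
next
  case False
  define d where "d = real_of_int \<bar>\<lfloor>x\<rfloor> - \<lfloor>y\<rfloor>\<bar>"
  have d: "d \<ge> 2" using False unfolding d_def by linarith
  have le: "d - 1 \<le> \<bar>x - y\<bar>" unfolding d_def by linarith
  then have "(d - 1)\<^sup>2 \<le> (x - y)\<^sup>2" using d by (metis abs_le_square_iff abs_of_nonneg diff_ge_0_iff_ge one_le_numeral order_trans)
  moreover have "x - y \<noteq> 0" using le d by auto
  ultimately have "fejer (x - y) \<le> 2 / (d - 1)\<^sup>2"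
    using fejer_le[of "x - y"] d by (smt (verit) frac_le zero_less_power)
  then show ?thesis using False by (simp add: fejer_cell_def d_def)
qed

lemma fejer_cell_nonneg: "fejer_cell d \<ge> 0" by (simp add: fejer_cell_def)

lemma fejer_cell_minus: "fejer_cell (- d) = fejer_cell d" by (simp add: fejer_cell_def)

text \<open>The five central terms give \<open>11 / 2\<close>; the others telescope by
  \<open>1 / (m + 2)^2 <= 1 / (m + 1) - 1 / (m + 2)\<close>.\<close>

lemma sum_fejer_cell_interval: "(\<Sum>d\<in>{- int m - 2..int m + 2}. fejer_cell d) \<le> 19 / 2 - 4 / (real m + 1)"
proof (induction m)
  case 0
  have "{- 2..2::int} = {-2, -1, 0, 1, 2}" by auto
  then show ?case by (simp add: fejer_cell_def)
next
  case (Suc m)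
  have "{- int (Suc m) - 2..int (Suc m) + 2} = insert (- int m - 3) (insert (int m + 3) {- int m - 2..int m + 2})"
    by auto
  then have "(\<Sum>d\<in>{- int (Suc m) - 2..int (Suc m) + 2}. fejer_cell d)
      = 4 / (real m + 2)\<^sup>2 + (\<Sum>d\<in>{- int m - 2..int m + 2}. fejer_cell d)"
    by (simp add: fejer_cell_def add.commute)
  moreover have "4 / (real m + 2)\<^sup>2 \<le> 4 / ((real m + 1) * (real m + 2))"
    unfolding power2_eq_square by (intro divide_left_mono mult_right_mono) auto
  moreover have "4 / ((real m + 1) * (real m + 2)) = 4 / (real m + 1) - 4 / (real m + 2)"
    by (simp add: field_simps)
  ultimately show ?case using Suc by (simp add: add.commute)
qed

lemma sum_fejer_cell_le:
  assumes "finite D"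
  shows "(\<Sum>d\<in>D. fejer_cell d) \<le> 10"
proof -
  define m where "m = Max (insert 0 ((\<lambda>d. nat \<bar>d\<bar>) ` D))"
  have m: "nat \<bar>d\<bar> \<le> m" if "d \<in> D" for d unfolding m_def using that assms by (intro Max_ge) auto
  have "D \<subseteq> {- int m - 2..int m + 2}"
  proof
    fix d assume "d \<in> D"
    with m[of d] have "\<bar>d\<bar> \<le> int m" by (simp add: nat_le_iff)
    then show "d \<in> {- int m - 2..int m + 2}" by auto
  qed
  then have "(\<Sum>d\<in>D. fejer_cell d) \<le> (\<Sum>d\<in>{- int m - 2..int m + 2}. fejer_cell d)"
    using fejer_cell_nonneg by (intro sum_mono2) auto
  also have "\<dots> \<le> 19 / 2 - 4 / (real m + 1)" by (rule sum_fejer_cell_interval)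
  also have "\<dots> \<le> 10"
  proof -
    have "4 / (real m + 1) \<ge> 0" by simp
    then show ?thesis by linarith
  qed
  finally show ?thesis .
qed

lemma norm_sum_cis_squared:
  "(cmod (\<Sum>w\<in>W. cis (x * Y w)))\<^sup>2 = (\<Sum>v\<in>W. \<Sum>w\<in>W. cos (x * (Y v - Y w)))"
proof -
  have "(cmod (\<Sum>w\<in>W. cis (x * Y w)))\<^sup>2 = (\<Sum>w\<in>W. cos (x * Y w))\<^sup>2 + (\<Sum>w\<in>W. sin (x * Y w))\<^sup>2"
    by (simp add: cmod_power2)
  then show ?thesis
    by (simp add: power2_eq_square sum_product right_diff_distrib cos_diff sum.distrib)
qed

text \<open>Inserting the weight \<open>1 - x\<close> only lowers the integral and turns cross terms
  into nonnegative kernel values; each diagonal term is 1/2.\<close>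

lemma integral_exp_sum_ge:
  assumes "finite W"
  shows "integral {0..1} (\<lambda>x. (cmod (\<Sum>w\<in>W. cis (x * Y w)))\<^sup>2) \<ge> real (card W) / 2"
proof -
  let ?f = "\<lambda>x. (cmod (\<Sum>w\<in>W. cis (x * Y w)))\<^sup>2"
  have "((\<lambda>x. \<Sum>v\<in>W. \<Sum>w\<in>W. (1 - x) * cos (x * (Y v - Y w))) has_integral
      (\<Sum>v\<in>W. \<Sum>w\<in>W. fejer (Y v - Y w))) {0..1}"
    by (intro has_integral_sum assms has_integral_fejer)
  then have 1: "((\<lambda>x. (1 - x) * ?f x) has_integral (\<Sum>v\<in>W. \<Sum>w\<in>W. fejer (Y v - Y w))) {0..1}"
    by (simp add: norm_sum_cis_squared sum_distrib_left)
  have "?f integrable_on {0..1}" by (intro integrable_continuous_interval continuous_intros)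
  then have 2: "(?f has_integral integral {0..1} ?f) {0..1}" by (simp add: has_integral_integral)
  have "(\<Sum>v\<in>W. \<Sum>w\<in>W. fejer (Y v - Y w)) \<le> integral {0..1} ?f"
    by (rule has_integral_le[OF 1 2]) (auto intro: mult_left_le_one_le)
  moreover have "(\<Sum>v\<in>W. 1 / 2) \<le> (\<Sum>v\<in>W. \<Sum>w\<in>W. fejer (Y v - Y w))"
  proof (rule sum_mono)
    fix v assume "v \<in> W"
    then have "fejer (Y v - Y v) \<le> (\<Sum>w\<in>W. fejer (Y v - Y w))"
      using assms fejer_nonneg by (intro member_le_sum) auto
    then show "1 / 2 \<le> (\<Sum>w\<in>W. fejer (Y v - Y w))" by (simp add: fejer_def)
  qed
  ultimately show ?thesis by simp
qed

text \<open>Grouping by floors gives a quadratic form in the group sizes, bounded through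
  \<open>2 * a * b <= a^2 + b^2\<close> and row sums of at most 10.\<close>

lemma sum_fejer_le_energy:
  assumes "finite W"
  shows "(\<Sum>v\<in>W. \<Sum>w\<in>W. fejer (Y v - Y w))
    \<le> 10 * (\<Sum>i\<in>(\<lambda>w. \<lfloor>Y w\<rfloor>) ` W. (real (card {w \<in> W. \<lfloor>Y w\<rfloor> = i}))\<^sup>2)"
proof -
  define I where "I = (\<lambda>w. \<lfloor>Y w\<rfloor>) ` W"
  define c where "c i = real (card {w \<in> W. \<lfloor>Y w\<rfloor> = i})" for i
  have finI: "finite I" using assms by (simp add: I_def)
  have grp: "(\<Sum>w\<in>W. g \<lfloor>Y w\<rfloor>) = (\<Sum>i\<in>I. c i * g i)" for g :: "int \<Rightarrow> real"
    unfolding I_def c_def by (subst sum.image_gen[OF assms, where g = "\<lambda>w. \<lfloor>Y w\<rfloor>"]) (auto intro!: sum.cong)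
  have row: "(\<Sum>j\<in>I. fejer_cell (i - j)) \<le> 10" for i
  proof -
    have "(\<Sum>j\<in>I. fejer_cell (i - j)) = (\<Sum>d\<in>(\<lambda>j. i - j) ` I. fejer_cell d)"
      by (subst sum.reindex) (auto simp: inj_on_def)
    then show ?thesis using sum_fejer_cell_le[of "(\<lambda>j. i - j) ` I"] finI by simp
  qed
  have "(\<Sum>v\<in>W. \<Sum>w\<in>W. fejer (Y v - Y w)) \<le> (\<Sum>v\<in>W. \<Sum>w\<in>W. fejer_cell (\<lfloor>Y v\<rfloor> - \<lfloor>Y w\<rfloor>))"
    by (intro sum_mono fejer_le_cell)
  also have "\<dots> = (\<Sum>v\<in>W. \<Sum>j\<in>I. c j * fejer_cell (\<lfloor>Y v\<rfloor> - j))"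
    by (intro sum.cong refl grp)
  also have "\<dots> = (\<Sum>i\<in>I. c i * (\<Sum>j\<in>I. c j * fejer_cell (i - j)))"
    by (rule grp)
  also have "\<dots> = (\<Sum>i\<in>I. \<Sum>j\<in>I. (c i * c j) * fejer_cell (i - j))"
    by (simp add: sum_distrib_left mult.assoc)
  also have "\<dots> \<le> (\<Sum>i\<in>I. \<Sum>j\<in>I. ((c i)\<^sup>2 / 2 + (c j)\<^sup>2 / 2) * fejer_cell (i - j))"
  proof (intro sum_mono mult_right_mono fejer_cell_nonneg)
    show "c i * c j \<le> (c i)\<^sup>2 / 2 + (c j)\<^sup>2 / 2" for i j
      using sum_squares_bound[of "c i" "c j"] by simp
  qed
  also have "\<dots> = (\<Sum>i\<in>I. \<Sum>j\<in>I. (c i)\<^sup>2 / 2 * fejer_cell (i - j)) + (\<Sum>i\<in>I. \<Sum>j\<in>I. (c j)\<^sup>2 / 2 * fejer_cell (i - j))"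
    by (simp add: distrib_right sum.distrib)
  also have "(\<Sum>i\<in>I. \<Sum>j\<in>I. (c j)\<^sup>2 / 2 * fejer_cell (i - j)) = (\<Sum>i\<in>I. \<Sum>j\<in>I. (c i)\<^sup>2 / 2 * fejer_cell (i - j))"
    by (subst sum.swap) (use fejer_cell_minus in \<open>metis (no_types, lifting) minus_diff_eq sum.cong\<close>)
  also have "(\<Sum>i\<in>I. \<Sum>j\<in>I. (c i)\<^sup>2 / 2 * fejer_cell (i - j)) \<le> (\<Sum>i\<in>I. (c i)\<^sup>2 / 2 * 10)"
    unfolding sum_distrib_left[symmetric] by (intro sum_mono mult_left_mono row) auto
  finally show ?thesis unfolding I_def c_def by (simp add: sum_distrib_left)
qed

text \<open>Reflect about the midpoint \<open>c\<close>. On the half interval the weight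
  \<open>2 * (1 - x)\<close> is at least 1; with it in place the integral extends to length 1, where
  it is evaluated by the kernel. The phases coming from \<open>c\<close> only reduce the
  sum.\<close>

lemma integral_exp_sum_le:
  assumes "finite W"
  shows "integral {u..u + 1} (\<lambda>x. (cmod (\<Sum>w\<in>W. cis (x * Y w)))\<^sup>2)
    \<le> 40 * (\<Sum>i\<in>(\<lambda>w. \<lfloor>Y w\<rfloor>) ` W. (real (card {w \<in> W. \<lfloor>Y w\<rfloor> = i}))\<^sup>2)"
proof -
  define f where "f x = (cmod (\<Sum>w\<in>W. cis (x * Y w)))\<^sup>2" for x
  define c where "c = u + 1 / 2"
  have cont: "continuous_on S f" for S unfolding f_def by (intro continuous_intros)
  have int: "f integrable_on {a..b}" for a b by (intro integrable_continuous_interval cont)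
  have fnn: "f x \<ge> 0" for x by (simp add: f_def)
  have cont2: "continuous_on S (\<lambda>x. f (c + x) + f (c - x))" for S
    unfolding f_def by (intro continuous_intros)
  have right: "((\<lambda>x. f (c + x)) has_integral integral {c..u + 1} f) {0..1/2}"
  proof -
    have "(f has_integral integral {c..u + 1} f) (cbox c (u + 1))" using int by (simp add: has_integral_integral)
    from has_integral_affinity[OF this, of 1 c]
    show ?thesis by (simp add: c_def algebra_simps)
  qed
  have left: "((\<lambda>x. f (c - x)) has_integral integral {u..c} f) {0..1/2}"
  proof -
    have "(f has_integral integral {u..c} f) (cbox u c)" using int by (simp add: has_integral_integral)
    from has_integral_affinity[OF this, of "-1" c]
    show ?thesis by (simp add: c_def algebra_simps)
  qed
  have "integral {u..u + 1} f = integral {u..c} f + integral {c..u + 1} f"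
    using int by (subst Henstock_Kurzweil_Integration.integral_combine) (auto simp: c_def)
  also have "\<dots> = integral {0..1/2} (\<lambda>x. f (c + x) + f (c - x))"
    using has_integral_add[OF right left] by (simp add: integral_unique add.commute)
  also have "\<dots> \<le> integral {0..1/2} (\<lambda>x. 2 * ((1 - x) * (f (c + x) + f (c - x))))"
  proof (rule integral_le)
    fix x :: real assume "x \<in> {0..1/2}"
    then have "1 * (f (c + x) + f (c - x)) \<le> (2 * (1 - x)) * (f (c + x) + f (c - x))"
      by (intro mult_right_mono add_nonneg_nonneg fnn) auto
    then show "f (c + x) + f (c - x) \<le> 2 * ((1 - x) * (f (c + x) + f (c - x)))"
      by (simp only: mult.assoc mult_1)
  qed (intro integrable_continuous_interval continuous_intros cont2)+
  also have "\<dots> \<le> integral {0..1} (\<lambda>x. 2 * ((1 - x) * (f (c + x) + f (c - x))))"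
    by (rule integral_subset_le) (auto intro!: integrable_continuous_interval continuous_intros cont2 mult_nonneg_nonneg add_nonneg_nonneg fnn)
  also have "\<dots> = (\<Sum>v\<in>W. \<Sum>w\<in>W. 4 * cos (c * (Y v - Y w)) * fejer (Y v - Y w))"
  proof (rule integral_unique)
    have "((\<lambda>x. \<Sum>v\<in>W. \<Sum>w\<in>W. 4 * cos (c * (Y v - Y w)) * ((1 - x) * cos (x * (Y v - Y w)))) has_integral
        (\<Sum>v\<in>W. \<Sum>w\<in>W. 4 * cos (c * (Y v - Y w)) * fejer (Y v - Y w))) {0..1}"
      by (intro has_integral_sum assms has_integral_mult_right has_integral_fejer)
    moreover have "(\<Sum>v\<in>W. \<Sum>w\<in>W. 4 * cos (c * (Y v - Y w)) * ((1 - x) * cos (x * (Y v - Y w))))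
        = 2 * ((1 - x) * (f (c + x) + f (c - x)))" for x
    proof -
      have "f (c + x) + f (c - x) = (\<Sum>v\<in>W. \<Sum>w\<in>W. 2 * cos (c * (Y v - Y w)) * cos (x * (Y v - Y w)))"
        unfolding f_def norm_sum_cis_squared sum.distrib[symmetric]
        by (intro sum.cong refl) (simp add: distrib_right left_diff_distrib cos_add cos_diff)
      then show ?thesis by (simp add: sum_distrib_left mult_ac)
    qed
    ultimately show "((\<lambda>x. 2 * ((1 - x) * (f (c + x) + f (c - x)))) has_integral
        (\<Sum>v\<in>W. \<Sum>w\<in>W. 4 * cos (c * (Y v - Y w)) * fejer (Y v - Y w))) {0..1}"
      by simp
  qed
  also have "\<dots> \<le> (\<Sum>v\<in>W. \<Sum>w\<in>W. 4 * fejer (Y v - Y w))"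
    by (intro sum_mono mult_right_mono fejer_nonneg) auto
  also have "\<dots> = 4 * (\<Sum>v\<in>W. \<Sum>w\<in>W. fejer (Y v - Y w))" by (simp add: sum_distrib_left)
  also have "\<dots> \<le> 4 * (10 * (\<Sum>i\<in>(\<lambda>w. \<lfloor>Y w\<rfloor>) ` W. (real (card {w \<in> W. \<lfloor>Y w\<rfloor> = i}))\<^sup>2))"
    by (intro mult_left_mono sum_fejer_le_energy assms) auto
  finally show ?thesis by (simp add: f_def[abs_def])
qed

context digit_system
begin

section \<open>Riesz products and their mean squares\<close>

definition phi :: "real \<Rightarrow> complex" where
  "phi u = (\<Sum>j<M. cis (u * lam j)) / of_nat M"

definition riesz :: "nat \<Rightarrow> nat \<Rightarrow> real \<Rightarrow> complex" where
  "riesz a b x = (\<Prod>k\<in>{a..<b}. phi (real M ^ k * x))"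

abbreviation riesz_sq :: "nat \<Rightarrow> nat \<Rightarrow> real \<Rightarrow> real" where
  "riesz_sq a b \<equiv> (\<lambda>x. (cmod (riesz a b x))\<^sup>2)"

lemma norm_phi_le_1: "cmod (phi u) \<le> 1"
proof -
  have "cmod (\<Sum>j<M. cis (u * lam j)) \<le> (\<Sum>j<M. 1)" by (rule sum_norm_le) simp
  then show ?thesis using M_pos by (simp add: phi_def norm_divide)
qed

lemma riesz_split: "a \<le> b \<Longrightarrow> b \<le> c \<Longrightarrow> riesz a c x = riesz a b x * riesz b c x"
  unfolding riesz_def by (simp add: prod.atLeastLessThan_concat)

lemma riesz_shift: "riesz (a + k) (b + k) x = riesz a b (real M ^ k * x)"
  unfolding riesz_def prod.shift_bounds_nat_ivl by (simp add: power_add mult_ac)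

lemma wrds_Suc_0: "wrds (Suc 0) = (\<lambda>j. [j]) ` {..<M}"
  unfolding wrds_def by (auto simp: length_Suc_conv)

text \<open>Expanding the product yields one exponential per word, the first letter belonging to the
  factor of highest frequency. This is the Fourier transform of the uniform distribution on
  positions.\<close>

lemma riesz_eq_sum: "riesz 0 n x = (\<Sum>w\<in>wrds n. cis (x * pos w)) / of_nat M ^ n"
proof (induction n)
  case (Suc n)
  have "(\<Sum>w\<in>wrds (1 + n). cis (x * pos w))
      = (\<Sum>j<M. \<Sum>u\<in>wrds n. cis (x * pos (j # u)))"
    unfolding sum_wrds_append by (simp add: wrds_Suc_0 sum.reindex inj_on_def)
  also have "\<dots> = (\<Sum>j<M. \<Sum>u\<in>wrds n. cis (real M ^ n * x * lam j) * cis (x * pos u))"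
    by (intro sum.cong refl) (simp add: length_wrds cis_mult algebra_simps)
  also have "\<dots> = (\<Sum>j<M. cis (real M ^ n * x * lam j)) * (\<Sum>u\<in>wrds n. cis (x * pos u))"
    by (simp add: sum_product)
  finally have "(\<Sum>w\<in>wrds (Suc n). cis (x * pos w)) / of_nat M ^ Suc n = phi (real M ^ n * x) * riesz 0 n x"
    by (simp add: Suc phi_def)
  then show ?case by (simp add: riesz_def mult.commute)
qed (simp add: riesz_def)

lemma continuous_on_riesz: "continuous_on S (riesz a b)"
  unfolding riesz_def phi_def by (intro continuous_intros) (use M_pos in auto)

lemma continuous_on_riesz_sq: "continuous_on S (riesz_sq a b)"
  by (intro continuous_intros continuous_on_riesz)

lemma riesz_sq_integrable: "(riesz_sq a b) integrable_on {c..d}"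
  by (intro integrable_continuous_interval continuous_on_riesz_sq)

lemma riesz_sq_eq: "(cmod (riesz 0 n x))\<^sup>2 = (cmod (\<Sum>w\<in>wrds n. cis (x * pos w)))\<^sup>2 / (real M ^ n)\<^sup>2"
  by (simp add: riesz_eq_sum norm_divide norm_power power_divide)

text \<open>The absence of concentration in its \<open>L^2\<close> form: an energy of order
  \<open>G * M ^ n\<close> in the counts corresponds to mean squares of order
  \<open>G / M ^ n\<close>.\<close>

definition flat :: "real \<Rightarrow> nat \<Rightarrow> bool" where
  "flat G N \<longleftrightarrow> (\<forall>n\<le>N. \<forall>u. integral {u..u + 1} (riesz_sq 0 n) \<le> G / real M ^ n)"

text \<open>\<open>240 = 40 * 6\<close>, from the mean value estimate and the energy bound.\<close>

lemma flat_if_light: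
  assumes t: "t > 1"
    and small: "8 * (real M)\<^sup>2 * t\<^sup>2 * real (card (stop_set M (heavy t) N)) \<le> real M ^ N"
  shows "flat (240 * t) N"
  unfolding flat_def
proof (intro allI impI)
  fix n u assume n: "n \<le> N"
  define I where "I = (\<lambda>w. \<lfloor>pos w\<rfloor>) ` wrds n"
  have "integral {u..u + 1} (\<lambda>x. (cmod (\<Sum>w\<in>wrds n. cis (x * pos w)))\<^sup>2)
      \<le> 40 * (\<Sum>i\<in>I. (real (card {w \<in> wrds n. \<lfloor>pos w\<rfloor> = i}))\<^sup>2)"
    unfolding I_def by (rule integral_exp_sum_le) simp
  also have "\<dots> \<le> 40 * (\<Sum>i\<in>I. (real (hitcount n i))\<^sup>2)"
    unfolding hitcount_def
    by (intro mult_left_mono sum_mono power_mono of_nat_mono card_mono) (auto simp: hits_def)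
  also have "\<dots> \<le> 40 * (6 * t * real M ^ n)"
    using energy_bound[OF t small n, of I] by (intro mult_left_mono) (auto simp: I_def)
  finally have *: "integral {u..u + 1} (\<lambda>x. (cmod (\<Sum>w\<in>wrds n. cis (x * pos w)))\<^sup>2) \<le> 240 * t * real M ^ n"
    by simp
  have "integral {u..u + 1} (riesz_sq 0 n)
      = integral {u..u + 1} (\<lambda>x. (cmod (\<Sum>w\<in>wrds n. cis (x * pos w)))\<^sup>2) / (real M ^ n)\<^sup>2"
    unfolding riesz_sq_eq by simp
  also have "\<dots> \<le> 240 * t * real M ^ n / (real M ^ n)\<^sup>2"
    using * by (intro divide_right_mono) auto
  also have "\<dots> = 240 * t / real M ^ n" using M_pos by (simp add: power2_eq_square)
  finally show "integral {u..u + 1} (riesz_sq 0 n) \<le> 240 * t / real M ^ n" .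
qed

lemma flat_nonneg: "flat G N \<Longrightarrow> G \<ge> 0"
  using integral_nonneg[OF riesz_sq_integrable[of 0 0 0 1]]
  unfolding flat_def by (auto dest!: spec[of _ 0])

lemma flat_interval:
  assumes "flat G N" "n \<le> N" "c \<le> d"
  shows "integral {c..d} (riesz_sq 0 n) \<le> (d - c + 1) * G / real M ^ n"
proof -
  let ?f = "riesz_sq 0 n"
  have unit: "integral {c..c + real k} ?f \<le> real k * (G / real M ^ n)" for k
  proof (induction k)
    case (Suc k)
    have "integral {c..c + real (Suc k)} ?f = integral {c..c + real k} ?f + integral {c + real k..c + real k + 1} ?f"
      by (subst Henstock_Kurzweil_Integration.integral_combine) (auto simp: riesz_sq_integrable add_ac)
    also have "integral {c + real k..c + real k + 1} ?f \<le> G / real M ^ n"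
      using assms unfolding flat_def by blast
    finally show ?case using Suc by (simp add: distrib_right add_divide_distrib)
  qed simp
  define k where "k = nat \<lceil>d - c\<rceil>"
  have k: "d - c \<le> real k" "real k \<le> d - c + 1" unfolding k_def using assms(3) by linarith+
  have "integral {c..d} ?f \<le> integral {c..c + real k} ?f"
    using k by (intro integral_subset_le riesz_sq_integrable) auto
  also have "\<dots> \<le> real k * (G / real M ^ n)" by (rule unit)
  also have "\<dots> \<le> (d - c + 1) * (G / real M ^ n)"
    using k flat_nonneg[OF assms(1)] by (intro mult_right_mono) auto
  finally show ?thesis by simp
qed

lemma integral_riesz_scale:
  assumes "a \<le> b" "c \<le> d"
  shows "integral {c..d} (riesz_sq a b)
    = integral {real M ^ a * c..real M ^ a * d} (riesz_sq 0 (b - a)) / real M ^ a"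
proof -
  have P: "real M ^ a > 0" using M_pos by simp
  have eq: "riesz a b x = riesz 0 (b - a) (real M ^ a * x)" for x
    using riesz_shift[of 0 a "b - a" x] assms(1) by simp
  have "((riesz_sq 0 (b - a)) has_integral
      integral {real M ^ a * c..real M ^ a * d} (riesz_sq 0 (b - a))) (cbox (real M ^ a * c) (real M ^ a * d))"
    using riesz_sq_integrable by (simp add: has_integral_integral)
  moreover have "(\<lambda>x. x / real M ^ a) ` {real M ^ a * c..real M ^ a * d} = {c..d}"
    using P by (auto simp: image_iff field_simps intro!: bexI[of _ "real M ^ a * _"])
  ultimately have "((\<lambda>x. (cmod (riesz 0 (b - a) (real M ^ a * x)))\<^sup>2) has_integral
      integral {real M ^ a * c..real M ^ a * d} (riesz_sq 0 (b - a)) / real M ^ a) {c..d}"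
    using has_integral_affinity[of "riesz_sq 0 (b - a)" _ "real M ^ a * c" "real M ^ a * d" "real M ^ a" 0] P
    by simp
  then show ?thesis by (simp add: eq integral_unique)
qed

text \<open>Rescaling by \<open>M ^ a\<close> turns the block into an initial product on a longer
  interval; the \<open>+ 1\<close> pays for the incomplete last unit interval.\<close>

lemma flat_riesz_interval:
  assumes "flat G N" "a \<le> b" "b - a \<le> N" "c \<le> d"
  shows "integral {c..d} (riesz_sq a b) \<le> (real M ^ a * (d - c) + 1) * G / real M ^ b"
proof -
  have P: "real M ^ a > 0" using M_pos by simp
  have b: "real M ^ b = real M ^ (b - a) * real M ^ a" using assms(2) by (simp add: power_add[symmetric])
  have "integral {c..d} (riesz_sq a b)
    \<le> ((real M ^ a * d - real M ^ a * c + 1) * G / real M ^ (b - a)) / real M ^ a"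
    unfolding integral_riesz_scale[OF assms(2,4)]
    using P assms by (intro divide_right_mono flat_interval) auto
  then show ?thesis by (simp add: b right_diff_distrib)
qed

lemma integral_riesz_ge:
  assumes "a \<le> b"
  shows "integral {0..1} (riesz_sq a b) \<ge> real M ^ a / (2 * real M ^ b)"
proof -
  define n where "n = b - a"
  have b: "real M ^ b = real M ^ n * real M ^ a" using assms by (simp add: n_def power_add[symmetric])
  have "riesz a b x = (\<Sum>w\<in>wrds n. cis (x * (real M ^ a * pos w))) / of_nat M ^ n" for x
    using riesz_shift[of 0 a n x] assms by (simp add: n_def riesz_eq_sum mult_ac)
  then have "(cmod (riesz a b x))\<^sup>2 = (cmod (\<Sum>w\<in>wrds n. cis (x * (real M ^ a * pos w))))\<^sup>2 / (real M ^ n)\<^sup>2" for x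
    by (simp add: norm_divide norm_power power_divide)
  then have "integral {0..1} (riesz_sq a b)
      = integral {0..1} (\<lambda>x. (cmod (\<Sum>w\<in>wrds n. cis (x * (real M ^ a * pos w))))\<^sup>2) / (real M ^ n)\<^sup>2"
    by simp
  also have "\<dots> \<ge> (real (card (wrds n)) / 2) / (real M ^ n)\<^sup>2"
    by (intro divide_right_mono integral_exp_sum_ge) auto
  finally show ?thesis using M_pos by (simp add: card_wrds b power2_eq_square)
qed

end

section \<open>Mass at low frequencies\<close>

lemma integral_indicator_interval:
  fixes f :: "real \<Rightarrow> real"
  assumes "f integrable_on {a..b}"
  shows "((\<lambda>x. if x \<in> {a..b} then f x else 0) has_integral integral {a..b} f) UNIV"
  using assms by (subst has_integral_restrict_UNIV) (simp add: has_integral_integral)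

context digit_system
begin

lemma flat_small_intervals:
  assumes G: "flat G N" and n: "m + l \<le> n" "n \<le> N"
    and P: "finite P" and H: "H \<ge> 0"
  shows "((\<lambda>x. \<Sum>p\<in>P. if x \<in> {p - H..p + H} then (cmod (riesz (m + l) n x))\<^sup>2 else 0) has_integral
      (\<Sum>p\<in>P. integral {p - H..p + H} (riesz_sq (m + l) n))) UNIV"
    and "(\<Sum>p\<in>P. integral {p - H..p + H} (riesz_sq (m + l) n))
      \<le> real (card P) * (2 * H * real M ^ (m + l) + 1) * G / real M ^ n"
proof -
  show "((\<lambda>x. \<Sum>p\<in>P. if x \<in> {p - H..p + H} then (cmod (riesz (m + l) n x))\<^sup>2 else 0) has_integral
      (\<Sum>p\<in>P. integral {p - H..p + H} (riesz_sq (m + l) n))) UNIV"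
    by (intro has_integral_sum P integral_indicator_interval riesz_sq_integrable)
  have "(\<Sum>p\<in>P. integral {p - H..p + H} (riesz_sq (m + l) n))
      \<le> (\<Sum>p\<in>P. (real M ^ (m + l) * (p + H - (p - H)) + 1) * G / real M ^ n)"
    using n H by (intro sum_mono flat_riesz_interval[OF G]) auto
  then show "(\<Sum>p\<in>P. integral {p - H..p + H} (riesz_sq (m + l) n))
      \<le> real (card P) * (2 * H * real M ^ (m + l) + 1) * G / real M ^ n"
    by (simp add: mult_ac)
qed

text \<open>The factors of index at least \<open>m\<close> carry mass at least
  \<open>M ^ m / (2 * M ^ n)\<close> on the unit interval. Flatness puts at most a quarter of this
  on \<open>[0, d]\<close>. Where the first \<open>m\<close> factors are below \<open>psi\<close>
  the middle block gains \<open>tau^2\<close>, so that set also takes at most a quarter. On the rest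
  the first \<open>m\<close> factors cost no more than \<open>psi^2\<close>.\<close>

lemma riesz_mass_lower:
  assumes G: "flat G N" and n: "m + l \<le> n" "n \<le> N"
    and d: "0 < d" "d \<le> 1" "(d * real M ^ m + 1) * G \<le> real M ^ m / 8"
    and PL: "\<And>x. x \<in> {d..1} \<Longrightarrow> cmod (riesz m (m + l) x) \<le> tau"
    and PS: "finite PS" "HS \<ge> 0"
      "\<And>x. x \<in> {0..1} \<Longrightarrow> cmod (riesz 0 m x) < psi \<Longrightarrow> \<exists>p\<in>PS. \<bar>x - p\<bar> \<le> HS"
      "tau\<^sup>2 * (real (card PS) * (2 * HS * real M ^ (m + l) + 1) * G) \<le> real M ^ m / 8"
    and psi: "psi > 0"
  shows "integral {d..1} (riesz_sq 0 n) \<ge> psi\<^sup>2 * real M ^ m / (8 * real M ^ n)"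
proof -
  define f where "f x = (cmod (riesz m n x))\<^sup>2" for x
  define g where "g x = (cmod (riesz (m + l) n x))\<^sup>2" for x
  define h where "h x = (cmod (riesz 0 n x))\<^sup>2" for x
  define R where "R = (\<lambda>(S :: real set) (u :: real \<Rightarrow> real) x. if x \<in> S then u x else 0)"
  define S where "S x = (\<Sum>p\<in>PS. R {p - HS..p + HS} g x)" for x
  have fR: "(R {0..1} f has_integral integral {0..1} f) UNIV"
    and dR: "(R {0..d} f has_integral integral {0..d} f) UNIV"
    and hR: "(R {d..1} h has_integral integral {d..1} h) UNIV"
    unfolding R_def f_def h_def by (intro integral_indicator_interval riesz_sq_integrable)+
  obtain IS where IS: "(S has_integral IS) UNIV"
      "IS \<le> real (card PS) * (2 * HS * real M ^ (m + l) + 1) * G / real M ^ n"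
    using flat_small_intervals[OF G n PS(1,2)] unfolding S_def R_def g_def by blast
  have nonneg: "f x \<ge> 0" "g x \<ge> 0" "h x \<ge> 0" for x by (auto simp: f_def g_def h_def)
  have Rnn: "R A f x \<ge> 0" "R A g x \<ge> 0" "R A h x \<ge> 0" for A x using nonneg by (auto simp: R_def)
  have Snn: "S x \<ge> 0" for x unfolding S_def by (auto intro!: sum_nonneg Rnn)
  have fg: "f x = (cmod (riesz m (m + l) x))\<^sup>2 * g x" for x
    using riesz_split[of m "m + l" n x] n by (simp add: f_def g_def norm_mult power_mult_distrib)
  have hf: "h x = (cmod (riesz 0 m x))\<^sup>2 * f x" for x
    using riesz_split[of 0 m n x] n by (simp add: f_def h_def norm_mult power_mult_distrib)
  \<comment> \<open>Pointwise domination by the three parts, so that a single comparison of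
    integrals over the line suffices.\<close>
  have main: "R {0..1} f x \<le> R {0..d} f x + tau\<^sup>2 * S x + h' / psi\<^sup>2"
    if "h' = R {d..1} h x" for x h'
  proof (cases "x \<in> {d..1}")
    case False
    then show ?thesis
      using Rnn[of _ x] Snn[of x] nonneg[of x] that by (auto simp: R_def intro!: add_nonneg_nonneg)
  next
    case x: True
    then have Rf: "R {0..1} f x = f x" and h': "h' = h x" using d that by (auto simp: R_def)
    consider "cmod (riesz 0 m x) < psi" | "cmod (riesz 0 m x) \<ge> psi" by linarith
    then show ?thesis
    proof cases
      case 1
      then obtain p where p: "p \<in> PS" "\<bar>x - p\<bar> \<le> HS" using PS(3)[of x] x d by auto
      have "f x \<le> tau\<^sup>2 * g x"
        unfolding fg using PL[OF x] nonneg by (intro mult_right_mono power_mono) auto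
      also have "g x = R {p - HS..p + HS} g x" using p by (auto simp: R_def)
      also have "\<dots> \<le> S x" unfolding S_def using p PS(1) Rnn by (intro member_le_sum) auto
      finally have "f x \<le> tau\<^sup>2 * S x" by (simp add: mult_left_mono)
      then show ?thesis using Rf Rnn[of _ x] Snn[of x] h' nonneg[of x] psi
        by (simp add: add_increasing add_increasing2)
    next
      case 2
      have "psi\<^sup>2 * f x \<le> h x"
        unfolding hf using 2 psi nonneg by (intro mult_right_mono power_mono) auto
      then have "f x \<le> h x / psi\<^sup>2" using psi by (simp add: field_simps)
      then show ?thesis using Rf Rnn[of _ x] Snn[of x] h' nonneg[of x] psi
        by (simp add: add_increasing add_increasing2)
    qed
  qed
  have "integral {0..1} f \<le> integral {0..d} f + tau\<^sup>2 * IS + integral {d..1} h / psi\<^sup>2"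
  proof (rule has_integral_le[OF fR])
    show "((\<lambda>x. R {0..d} f x + tau\<^sup>2 * S x + R {d..1} h x / psi\<^sup>2) has_integral
        integral {0..d} f + tau\<^sup>2 * IS + integral {d..1} h / psi\<^sup>2) UNIV"
      by (intro has_integral_add has_integral_mult_right has_integral_divide dR IS(1) hR)
  qed (rule main[OF refl])
  moreover have "integral {0..1} f \<ge> real M ^ m / (2 * real M ^ n)"
    unfolding f_def using n by (intro integral_riesz_ge) auto
  moreover have "integral {0..d} f \<le> real M ^ m / (8 * real M ^ n)"
  proof -
    have "integral {0..d} f \<le> (real M ^ m * (d - 0) + 1) * G / real M ^ n"
      unfolding f_def using n d by (intro flat_riesz_interval[OF G]) auto
    also have "\<dots> \<le> (real M ^ m / 8) / real M ^ n"
      using d(3) by (intro divide_right_mono) (auto simp: mult.commute)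
    finally show ?thesis by simp
  qed
  moreover have "tau\<^sup>2 * IS \<le> real M ^ m / (8 * real M ^ n)"
  proof -
    have "tau\<^sup>2 * IS \<le> tau\<^sup>2 * (real (card PS) * (2 * HS * real M ^ (m + l) + 1) * G / real M ^ n)"
      using IS(2) by (intro mult_left_mono) auto
    also have "\<dots> \<le> (real M ^ m / 8) / real M ^ n"
      using divide_right_mono[OF PS(4), of "real M ^ n"] by simp
    finally show ?thesis by simp
  qed
  moreover have "real M ^ m / (2 * real M ^ n) = 4 * (real M ^ m / (8 * real M ^ n))"
    by simp
  moreover have "real M ^ m / (8 * real M ^ n) \<ge> 0" by simp
  ultimately have "real M ^ m / (8 * real M ^ n) \<le> integral {d..1} h / psi\<^sup>2" by linarith
  then have "real M ^ m / (8 * real M ^ n) * psi\<^sup>2 \<le> integral {d..1} h"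
    using psi by (simp add: pos_le_divide_eq)
  then show ?thesis by (simp add: h_def[abs_def] mult.commute)
qed

text \<open>The real part alone suffices, as every phase is at most
  \<open>\<bar>u\<bar> / 4\<close>.\<close>

lemma norm_phi_ge:
  assumes "\<bar>u\<bar> \<le> 1"
  shows "cmod (phi u) \<ge> 1 - u\<^sup>2 / 32"
proof -
  have "1 - u\<^sup>2 / 32 \<le> cos (u * lam j)" if "j < M" for j
  proof -
    have "\<bar>u * lam j\<bar> \<le> \<bar>u\<bar> * (1 / 4)" unfolding abs_mult using lam[OF that] by (intro mult_left_mono) auto
    then have "(u * lam j)\<^sup>2 \<le> (\<bar>u\<bar> / 4)\<^sup>2" by (metis abs_le_square_iff abs_of_nonneg abs_ge_zero divide_nonneg_pos mult_1_right times_divide_eq_right zero_less_numeral)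
    moreover have "1 - (u * lam j)\<^sup>2 / 2 \<le> cos (u * lam j)"
    proof -
      have "cos (u * lam j) = 1 - 2 * (sin (u * lam j / 2))\<^sup>2"
        using cos_double_sin[of "u * lam j / 2"] by simp
      moreover have "(sin (u * lam j / 2))\<^sup>2 \<le> (u * lam j / 2)\<^sup>2"
        using abs_sin_x_le_abs_x[of "u * lam j / 2"] by (simp only: abs_le_square_iff)
      ultimately show ?thesis by (simp add: power_divide)
    qed
    ultimately show ?thesis by (simp add: power_divide)
  qed
  then have "(\<Sum>j<M. 1 - u\<^sup>2 / 32) \<le> (\<Sum>j<M. cos (u * lam j))" by (intro sum_mono) auto
  then have "1 - u\<^sup>2 / 32 \<le> (\<Sum>j<M. cos (u * lam j)) / real M"
    using M_pos by (simp add: pos_le_divide_eq mult.commute)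
  also have "\<dots> = Re (phi u)" by (simp add: phi_def)
  also have "\<dots> \<le> cmod (phi u)" by (rule complex_Re_le_cmod)
  finally show ?thesis .
qed

text \<open>With \<open>a\<close> the squared argument one scale below, old product and new factor
  lose at most \<open>a / 32\<close> each, while the allowed loss is multiplied by
  \<open>M^2 >= 9\<close>.\<close>

lemma norm_riesz_low_freq_ge:
  "\<bar>real M ^ k * y\<bar> \<le> 1 \<Longrightarrow> cmod (riesz 0 k y) \<ge> 1 - (real M ^ k * y)\<^sup>2 / 32"
proof (induction k)
  case (Suc k)
  define a where "a = (real M ^ k * y)\<^sup>2"
  have M9: "(real M)\<^sup>2 \<ge> 9" using M3 power_mono[of 3 "real M" 2] by simp
  have e: "(real M ^ Suc k * y)\<^sup>2 = (real M)\<^sup>2 * a" by (simp add: a_def power_mult_distrib mult.assoc)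
  have a0: "a \<ge> 0" by (simp add: a_def)
  have le1: "(real M)\<^sup>2 * a \<le> 1" using Suc.prems unfolding e[symmetric] by (simp add: abs_square_le_1)
  have 9: "9 * a \<le> (real M)\<^sup>2 * a" using M9 a0 by (intro mult_right_mono) auto
  then have a1: "a \<le> 1" using le1 a0 by linarith
  then have "\<bar>real M ^ k * y\<bar> \<le> 1" unfolding a_def by (simp add: abs_square_le_1)
  then have "cmod (riesz 0 k y) \<ge> 1 - a / 32" "cmod (phi (real M ^ k * y)) \<ge> 1 - a / 32"
    using Suc.IH norm_phi_ge by (auto simp: a_def)
  then have "(1 - a / 32) * (1 - a / 32) \<le> cmod (riesz 0 k y) * cmod (phi (real M ^ k * y))"
    using a1 by (intro mult_mono) auto
  also have "\<dots> = cmod (riesz 0 (Suc k) y)" by (simp add: riesz_def norm_mult)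
  finally have "(1 - a / 32) * (1 - a / 32) \<le> cmod (riesz 0 (Suc k) y)" .
  moreover have "1 - (real M)\<^sup>2 * a / 32 \<le> (1 - a / 32) * (1 - a / 32)"
  proof -
    have "(a / 32)\<^sup>2 \<ge> 0" by simp
    then have "1 - (real M)\<^sup>2 * a / 32 \<le> 1 - a / 16 + (a / 32)\<^sup>2" using 9 a0 by linarith
    also have "\<dots> = (1 - a / 32) * (1 - a / 32)" by (simp add: power2_eq_square algebra_simps)
    finally show ?thesis .
  qed
  ultimately show ?case unfolding e by linarith
qed (simp add: riesz_def)

text \<open>On frequencies up to \<open>1 / M ^ k\<close> the first \<open>k\<close> factors have
  product at least 1/2; the others are a rescaled product of length \<open>N - k\<close>.\<close>

lemma integral_block_ge:
  assumes "0 < d" "d \<le> 1" "k \<le> N"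
  shows "integral {d / real M ^ k..1 / real M ^ k} (riesz_sq 0 N)
    \<ge> integral {d..1} (riesz_sq 0 (N - k)) / (4 * real M ^ k)"
proof -
  have P: "real M ^ k > 0" using M_pos by simp
  let ?I = "{d / real M ^ k..1 / real M ^ k}"
  have "integral {d..1} (riesz_sq 0 (N - k)) / real M ^ k
      = integral ?I (riesz_sq k N)"
    using P assms by (subst integral_riesz_scale) (auto simp: divide_right_mono)
  then have "integral {d..1} (riesz_sq 0 (N - k)) / (4 * real M ^ k)
      = integral ?I (\<lambda>x. (cmod (riesz k N x))\<^sup>2 / 4)" by simp
  also have "\<dots> \<le> integral ?I (riesz_sq 0 N)"
  proof (rule integral_le)
    show "(\<lambda>x. (cmod (riesz k N x))\<^sup>2 / 4) integrable_on ?I"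
      by (intro integrable_continuous_interval continuous_intros continuous_on_riesz) auto
    show "(riesz_sq 0 N) integrable_on ?I" by (rule riesz_sq_integrable)
    fix x assume x: "x \<in> ?I"
    have le: "\<bar>real M ^ k * x\<bar> \<le> 1"
    proof -
      have "0 \<le> d / real M ^ k" using P assms by simp
      then have "0 \<le> x" using x by auto
      moreover have "real M ^ k * x \<le> 1" using x P by (auto simp: field_simps)
      ultimately show ?thesis using P by simp
    qed
    then have "(real M ^ k * x)\<^sup>2 \<le> 1" by (simp add: abs_square_le_1)
    then have "1 / 2 \<le> cmod (riesz 0 k x)" using norm_riesz_low_freq_ge[OF le] by linarith
    then have "(1 / 2)\<^sup>2 \<le> (cmod (riesz 0 k x))\<^sup>2" by (intro power_mono) auto
    then have "(1 / 4) * (cmod (riesz k N x))\<^sup>2 \<le> (cmod (riesz 0 k x))\<^sup>2 * (cmod (riesz k N x))\<^sup>2"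
      by (intro mult_right_mono) (auto simp: power_divide)
    also have "\<dots> = (cmod (riesz 0 N x))\<^sup>2"
      using riesz_split[of 0 k N x] assms by (simp add: norm_mult power_mult_distrib)
    finally show "(cmod (riesz k N x))\<^sup>2 / 4 \<le> (cmod (riesz 0 N x))\<^sup>2" by simp
  qed
  finally show ?thesis .
qed

text \<open>The blocks do not overlap: block \<open>j + 1\<close> ends at
  \<open>1 / M ^ ((j + 1) * s)\<close>, no later than where block \<open>j\<close> starts.\<close>

lemma sum_blocks_le:
  assumes "0 < d" "d \<le> 1" "1 / real M ^ s \<le> d"
  shows "(\<Sum>j<q. integral {d / real M ^ (j * s)..1 / real M ^ (j * s)} (riesz_sq 0 N))
    \<le> integral {1 / real M ^ (q * s)..1} (riesz_sq 0 N)"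
proof (induction q)
  case (Suc q)
  let ?f = "riesz_sq 0 N"
  have P: "real M ^ k > 0" for k using M_pos by simp
  have le: "1 / real M ^ (Suc q * s) \<le> d / real M ^ (q * s)"
    using divide_right_mono[OF assms(3), of "real M ^ (q * s)"] P by (simp add: power_add)
  have le1: "1 / real M ^ (q * s) \<le> 1" using M_pos by simp
  have le2: "1 / real M ^ (Suc q * s) \<le> 1 / real M ^ (q * s)"
    using M_pos by (intro divide_left_mono power_increasing) auto
  have "integral {d / real M ^ (q * s)..1 / real M ^ (q * s)} ?f
      \<le> integral {1 / real M ^ (Suc q * s)..1 / real M ^ (q * s)} ?f"
    using le by (intro integral_subset_le riesz_sq_integrable) auto
  then show ?case
    using Suc Henstock_Kurzweil_Integration.integral_combine[OF le2 le1 riesz_sq_integrable, of 0 N] by simp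
qed simp

text \<open>Each of the \<open>q\<close> blocks carries mass at least
  \<open>psi^2 * M ^ m / (32 * M ^ N)\<close>, yet flatness allows them only
  \<open>G / M ^ N\<close> together.\<close>

lemma blocks_contradiction:
  assumes G: "flat G N" and N: "q * s + m + l \<le> N"
    and s: "1 / real M ^ s \<le> d"
    and d: "0 < d" "d \<le> 1" "(d * real M ^ m + 1) * G \<le> real M ^ m / 8"
    and PL: "\<And>x. x \<in> {d..1} \<Longrightarrow> cmod (riesz m (m + l) x) \<le> tau"
    and PS: "finite PS" "HS \<ge> 0"
      "\<And>x. x \<in> {0..1} \<Longrightarrow> cmod (riesz 0 m x) < psi \<Longrightarrow> \<exists>p\<in>PS. \<bar>x - p\<bar> \<le> HS"
      "tau\<^sup>2 * (real (card PS) * (2 * HS * real M ^ (m + l) + 1) * G) \<le> real M ^ m / 8"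
    and psi: "psi > 0"
  shows "real q * psi\<^sup>2 * real M ^ m \<le> 32 * G"
proof -
  let ?f = "riesz_sq 0 N"
  have P: "real M ^ k > 0" for k using M_pos by simp
  have block: "psi\<^sup>2 * real M ^ m / (32 * real M ^ N)
      \<le> integral {d / real M ^ (j * s)..1 / real M ^ (j * s)} ?f" if "j < q" for j
  proof -
    have "j * s \<le> q * s" using that by simp
    then have js: "m + l \<le> N - j * s" "j * s \<le> N" using N by linarith+
    have e: "real M ^ N = real M ^ (N - j * s) * real M ^ (j * s)" using js by (simp add: power_add[symmetric])
    have "psi\<^sup>2 * real M ^ m / (8 * real M ^ (N - j * s)) \<le> integral {d..1} (riesz_sq 0 (N - j * s))"
      by (rule riesz_mass_lower[OF G js(1) _ d PL PS psi]) auto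
    then have "psi\<^sup>2 * real M ^ m / (8 * real M ^ (N - j * s)) / (4 * real M ^ (j * s))
        \<le> integral {d..1} (riesz_sq 0 (N - j * s)) / (4 * real M ^ (j * s))"
      using P by (intro divide_right_mono) auto
    also have "\<dots> \<le> integral {d / real M ^ (j * s)..1 / real M ^ (j * s)} ?f"
      by (rule integral_block_ge[OF d(1,2) js(2)])
    finally show ?thesis by (simp add: e)
  qed
  have "real q * (psi\<^sup>2 * real M ^ m / (32 * real M ^ N))
      = (\<Sum>j<q. psi\<^sup>2 * real M ^ m / (32 * real M ^ N))" by simp
  also have "\<dots> \<le> (\<Sum>j<q. integral {d / real M ^ (j * s)..1 / real M ^ (j * s)} ?f)"
    using block by (intro sum_mono) auto
  also have "\<dots> \<le> integral {1 / real M ^ (q * s)..1} ?f" by (rule sum_blocks_le[OF d(1,2) s])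
  also have "\<dots> \<le> integral {0..0 + 1} ?f" by (intro integral_subset_le riesz_sq_integrable) auto
  also have "\<dots> \<le> G / real M ^ N" using G unfolding flat_def by blast
  finally have "real q * psi\<^sup>2 * real M ^ m / 32 / real M ^ N \<le> G / real M ^ N" by simp
  then have "real q * psi\<^sup>2 * real M ^ m / 32 \<le> G" using P by (simp only: divide_le_cancel)
  then show ?thesis by simp
qed

end

section \<open>Small values of the low-frequency product\<close>

text \<open>Induction on \<open>d\<close>. Pairing neighbouring points, the mean value theorem gives
  half as many points where the derivative is below \<open>kap * (h / 2) ^ (d - 1)\<close>; the gaps
  between pairs keep the new points \<open>h\<close> apart.\<close>

lemma separated_small_values_rolle:
  fixes F :: "nat \<Rightarrow> real \<Rightarrow> real" and x :: "nat \<Rightarrow> real"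
  assumes "h > 0"
    and "\<And>k x. k < d \<Longrightarrow> (F k has_real_derivative F (Suc k) x) (at x)"
    and "\<And>x. x \<in> {a..b} \<Longrightarrow> \<bar>F d x\<bar> \<ge> kap"
    and "\<And>i. i < 2 ^ d \<Longrightarrow> x i \<in> {a..b} \<and> \<bar>F 0 (x i)\<bar> < kap * (h / 2) ^ d"
    and "\<And>i. Suc i < 2 ^ d \<Longrightarrow> x i + h \<le> x (Suc i)"
  shows False
  using assms(2-)
proof (induction d arbitrary: F x)
  case 0
  have "x 0 \<in> {a..b}" "\<bar>F 0 (x 0)\<bar> < kap" using 0(3)[of 0] by auto
  then show ?case using 0(2)[of "x 0"] by simp
next
  case (Suc d)
  have "\<exists>y. x (2 * i) < y \<and> y < x (2 * i + 1) \<and> \<bar>F (Suc 0) y\<bar> < kap * (h / 2) ^ d" if "i < 2 ^ d" for i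
  proof -
    have i: "Suc (2 * i) < 2 ^ Suc d" using that by simp
    have gap: "x (2 * i) + h \<le> x (2 * i + 1)" using Suc.prems(4)[OF i] by simp
    then have "x (2 * i) < x (2 * i + 1)" using assms(1) by linarith
    then obtain y where y: "x (2 * i) < y" "y < x (2 * i + 1)"
        "F 0 (x (2 * i + 1)) - F 0 (x (2 * i)) = (x (2 * i + 1) - x (2 * i)) * F (Suc 0) y"
      using MVT2[of "x (2 * i)" "x (2 * i + 1)" "F 0" "F (Suc 0)"] Suc.prems(1)[of 0] by auto
    have small: "\<bar>F 0 (x (2 * i))\<bar> < kap * (h / 2) ^ Suc d" "\<bar>F 0 (x (2 * i + 1))\<bar> < kap * (h / 2) ^ Suc d"
      using Suc.prems(3)[of "2 * i"] Suc.prems(3)[of "2 * i + 1"] i by auto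
    have "h * \<bar>F (Suc 0) y\<bar> \<le> (x (2 * i + 1) - x (2 * i)) * \<bar>F (Suc 0) y\<bar>"
      using gap by (intro mult_right_mono) auto
    also have "\<dots> = \<bar>F 0 (x (2 * i + 1)) - F 0 (x (2 * i))\<bar>"
      using gap assms(1) unfolding y(3) abs_mult by simp
    also have "\<dots> < 2 * (kap * (h / 2) ^ Suc d)" using small by linarith
    also have "\<dots> = h * (kap * (h / 2) ^ d)" by simp
    finally have "\<bar>F (Suc 0) y\<bar> < kap * (h / 2) ^ d" using assms(1) by (simp only: mult_less_cancel_left_pos)
    then show ?thesis using y by blast
  qed
  then obtain y where y: "\<And>i. i < 2 ^ d \<Longrightarrow> x (2 * i) < y i \<and> y i < x (2 * i + 1) \<and> \<bar>F (Suc 0) (y i)\<bar> < kap * (h / 2) ^ d"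
    by metis
  show False
  proof (rule Suc.IH[of "\<lambda>k. F (Suc k)" y])
    show "(F (Suc k) has_real_derivative F (Suc (Suc k)) z) (at z)" if "k < d" for k z
      using Suc.prems(1)[of "Suc k"] that by simp
    show "kap \<le> \<bar>F (Suc d) z\<bar>" if "z \<in> {a..b}" for z using Suc.prems(2) that by simp
    show "y i \<in> {a..b} \<and> \<bar>F (Suc 0) (y i)\<bar> < kap * (h / 2) ^ d" if "i < 2 ^ d" for i
    proof -
      have "x (2 * i) \<in> {a..b}" "x (2 * i + 1) \<in> {a..b}"
        using Suc.prems(3)[of "2 * i"] Suc.prems(3)[of "2 * i + 1"] that by auto
      then show ?thesis using y[OF that] by auto
    qed
    show "y i + h \<le> y (Suc i)" if "Suc i < 2 ^ d" for i
    proof -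
      have "x (2 * i + 1) + h \<le> x (Suc (2 * i + 1))" using Suc.prems(4)[of "2 * i + 1"] that by simp
      then show ?thesis using y[of i] y[of "Suc i"] that by simp
    qed
  qed
qed

text \<open>A separated subset of maximal size is a net.\<close>

lemma cover_if_separated_bounded:
  fixes Z :: "real set"
  assumes "\<And>S. finite S \<Longrightarrow> S \<subseteq> Z \<Longrightarrow> (\<And>x y. x \<in> S \<Longrightarrow> y \<in> S \<Longrightarrow> x < y \<Longrightarrow> x + h \<le> y) \<Longrightarrow> card S \<le> n"
    and "h \<ge> 0"
  obtains P where "finite P" "card P \<le> n" "\<And>z. z \<in> Z \<Longrightarrow> \<exists>p\<in>P. \<bar>z - p\<bar> \<le> h"
proof -
  define Q where "Q S \<longleftrightarrow> finite S \<and> S \<subseteq> Z \<and> (\<forall>x\<in>S. \<forall>y\<in>S. x < y \<longrightarrow> x + h \<le> y)" for S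
  have bound: "card S \<le> n" if "Q S" for S using that assms(1) unfolding Q_def by blast
  have "Q {}" by (simp add: Q_def)
  then obtain S where S: "Q S" "\<And>T. Q T \<Longrightarrow> card T \<le> card S"
    using ex_has_greatest_nat[of Q "{}" card "Suc n"] bound by (metis less_Suc_eq_le)
  have "\<exists>p\<in>S. \<bar>z - p\<bar> \<le> h" if "z \<in> Z" for z
  proof (rule ccontr)
    assume no: "\<not> (\<exists>p\<in>S. \<bar>z - p\<bar> \<le> h)"
    then have "z \<notin> S" using assms(2) by force
    moreover have "Q (insert z S)" unfolding Q_def
    proof (intro conjI ballI impI)
      fix x y assume xy: "x \<in> insert z S" "y \<in> insert z S" "x < y"
      have far: "\<bar>z - p\<bar> > h" if "p \<in> S" for p using no that by force
      consider "x \<in> S" "y \<in> S" | "x = z" "y \<in> S" | "x \<in> S" "y = z" using xy by blast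
      then show "x + h \<le> y"
      proof cases
        case 1
        then show ?thesis using S(1) xy(3) by (simp add: Q_def)
      qed (use far[of x] far[of y] xy(3) in linarith)+
    qed (use S(1) that in \<open>auto simp: Q_def\<close>)
    moreover have "finite S" using S(1) by (simp add: Q_def)
    ultimately have "card (insert z S) = Suc (card S)" by simp
    then show False using S(2)[OF \<open>Q (insert z S)\<close>] by simp
  qed
  then show ?thesis using that[of S] S(1) bound by (auto simp: Q_def)
qed

lemma card_separated_small_values:
  fixes F :: "nat \<Rightarrow> real \<Rightarrow> real"
  assumes "h > 0"
    and F: "\<And>k x. k < d \<Longrightarrow> (F k has_real_derivative F (Suc k) x) (at x)"
    and big: "\<And>x. x \<in> {a..b} \<Longrightarrow> \<bar>F d x\<bar> \<ge> kap"
    and S: "finite S" "\<And>x. x \<in> S \<Longrightarrow> x \<in> {a..b} \<and> \<bar>F 0 x\<bar> < kap * (h / 2) ^ d"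
      "\<And>x y. x \<in> S \<Longrightarrow> y \<in> S \<Longrightarrow> x < y \<Longrightarrow> x + h \<le> y"
  shows "card S < 2 ^ d"
proof (rule ccontr)
  assume "\<not> card S < 2 ^ d"
  define xs where "xs = sorted_list_of_set S"
  have len: "length xs = card S" by (simp add: xs_def)
  have mem: "xs ! i \<in> S" if "i < 2 ^ d" for i
  proof -
    have "i < length xs" using that \<open>\<not> card S < 2 ^ d\<close> len by linarith
    then show ?thesis using S(1) nth_mem[of i xs] by (simp add: xs_def)
  qed
  have ord: "xs ! i < xs ! Suc i" if "Suc i < 2 ^ d" for i
  proof -
    have "Suc i < length xs" using that \<open>\<not> card S < 2 ^ d\<close> len by linarith
    then show ?thesis using strict_sorted_list_of_set[of S] unfolding xs_def
      by (simp add: sorted_wrt_iff_nth_less)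
  qed
  show False
    by (rule separated_small_values_rolle[OF assms(1) F big, where x = "\<lambda>i. xs ! i"])
       (use mem ord S in auto)
qed

context digit_system
begin

section \<open>Derivatives of \<open>phi\<close> and a cover of its small values\<close>

definition separated :: "real \<Rightarrow> bool" where
  "separated sig \<longleftrightarrow> (\<forall>i<M. \<forall>j<M. i \<noteq> j \<longrightarrow> \<bar>lam i - lam j\<bar> \<ge> sig)"

text \<open>The \<open>k\<close>-th derivative of \<open>phi\<close>.\<close>

definition dphi :: "nat \<Rightarrow> real \<Rightarrow> complex" where
  "dphi k u = (\<Sum>j<M. (\<i> * of_real (lam j)) ^ k * cis (u * lam j)) / of_nat M"

lemma dphi_0: "dphi 0 = phi" by (simp add: dphi_def phi_def fun_eq_iff)

lemma norm_dphi_le_1: "cmod (dphi k u) \<le> 1"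
proof -
  have "cmod (\<Sum>j<M. (\<i> * of_real (lam j)) ^ k * cis (u * lam j)) \<le> (\<Sum>j<M. 1)"
  proof (rule sum_norm_le)
    fix j assume "j \<in> {..<M}"
    then have "\<bar>lam j\<bar> \<le> 1" using lam[of j] by simp
    then show "cmod ((\<i> * of_real (lam j)) ^ k * cis (u * lam j)) \<le> 1"
      by (simp add: norm_mult norm_power power_le_one)
  qed
  then show ?thesis using M_pos by (simp add: dphi_def norm_divide)
qed

lemma has_vector_derivative_dphi: "(dphi k has_vector_derivative dphi (Suc k) u) (at u)"
proof -
  have c: "((\<lambda>u. cis (u * lam j)) has_vector_derivative (\<i> * of_real (lam j)) * cis (u * lam j)) (at u)" for j
  proof -
    have "((\<lambda>u. exp (u *\<^sub>R (\<i> * of_real (lam j)))) has_vector_derivative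
        exp (u *\<^sub>R (\<i> * of_real (lam j))) * (\<i> * of_real (lam j))) (at u)"
      by (rule exp_scaleR_has_vector_derivative_right)
    then show ?thesis by (simp add: cis_conv_exp scaleR_conv_of_real mult_ac)
  qed
  have "((\<lambda>u. \<Sum>j<M. (\<i> * of_real (lam j)) ^ k * cis (u * lam j)) has_vector_derivative
      (\<Sum>j<M. (\<i> * of_real (lam j)) ^ k * ((\<i> * of_real (lam j)) * cis (u * lam j)))) (at u)"
    by (intro has_vector_derivative_sum has_vector_derivative_mult_right c)
  then have "((\<lambda>u. (\<Sum>j<M. (\<i> * of_real (lam j)) ^ k * cis (u * lam j)) / of_nat M) has_vector_derivative
      (\<Sum>j<M. (\<i> * of_real (lam j)) ^ k * ((\<i> * of_real (lam j)) * cis (u * lam j))) / of_nat M) (at u)"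
    by (rule has_vector_derivative_divide)
  then show ?thesis by (simp add: dphi_def[abs_def] mult_ac)
qed

lemma has_real_derivative_rotated_dphi:
  "((\<lambda>u. Re (z * dphi k u)) has_real_derivative Re (z * dphi (Suc k) u)) (at u)"
  unfolding has_real_derivative_iff_has_vector_derivative
  by (intro bounded_linear.has_vector_derivative[OF bounded_linear_Re]
      has_vector_derivative_mult_right has_vector_derivative_dphi)

(* The operators D - i lam s, applied for s = 1, ..., M - 1, annihilate every exponential except the first. *)
lemma exists_large_dphi:
  assumes sep: "separated sig" and "sig > 0"
  obtains d where "d < M" "cmod (dphi d u) \<ge> (sig / 2) ^ (M - 1) / real M"
proof -
  define eps where "eps = (sig / 2) ^ (M - 1) / real M"
  define T where "T r k = (\<Sum>j<M. (\<Prod>s\<in>{1..r}. \<i> * of_real (lam j) - \<i> * of_real (lam s))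
      * ((\<i> * of_real (lam j)) ^ k * cis (u * lam j))) / of_nat M" for r k
  have T0: "T 0 k = dphi k u" for k by (simp add: T_def dphi_def)
  have T_Suc: "T (Suc r) k = T r (Suc k) - \<i> * of_real (lam (Suc r)) * T r k" for r k
    unfolding T_def diff_divide_distrib[symmetric] times_divide_eq_right sum_distrib_left sum_subtractf[symmetric]
    by (intro arg_cong2[where f = "(/)"] sum.cong refl) (simp add: algebra_simps)
  have "\<exists>d<M. cmod (dphi d u) \<ge> eps"
  proof (rule ccontr)
    assume "\<not> (\<exists>d<M. cmod (dphi d u) \<ge> eps)"
    then have small: "cmod (dphi d u) < eps" if "d < M" for d using that by force
    have "cmod (T r k) < 2 ^ r * eps" if "r + k < M" for r k
      using that
    proof (induction r arbitrary: k)
      case 0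
      then show ?case using small by (simp add: T0)
    next
      case (Suc r)
      have "\<bar>lam (Suc r)\<bar> \<le> 1" using lam[of "Suc r"] Suc.prems by simp
      then have "cmod (\<i> * of_real (lam (Suc r)) * T r k) \<le> 1 * cmod (T r k)"
        unfolding norm_mult by (intro mult_right_mono) auto
      moreover have "cmod (T r (Suc k)) < 2 ^ r * eps" "cmod (T r k) < 2 ^ r * eps"
        using Suc by auto
      moreover have "cmod (T (Suc r) k) \<le> cmod (T r (Suc k)) + cmod (\<i> * of_real (lam (Suc r)) * T r k)"
        unfolding T_Suc by (rule norm_triangle_ineq4)
      ultimately show ?case by simp
    qed
    from this[of "M - 1" 0] have lt: "cmod (T (M - 1) 0) < 2 ^ (M - 1) * eps" using M3 by simp
    have "(\<Prod>s\<in>{1..M - 1}. \<i> * of_real (lam j) - \<i> * of_real (lam s)) = 0" if "j \<in> {..<M} - {0}" for j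
      using that by (intro prod_zero bexI[of _ j]) auto
    then have "T (M - 1) 0 = (\<Sum>j\<in>{0}. (\<Prod>s\<in>{1..M - 1}. \<i> * of_real (lam j) - \<i> * of_real (lam s))
      * ((\<i> * of_real (lam j)) ^ 0 * cis (u * lam j))) / of_nat M"
      unfolding T_def using M_pos by (intro arg_cong2[where f = "(/)"] sum.mono_neutral_right) auto
    then have "cmod (T (M - 1) 0) = (\<Prod>s\<in>{1..M - 1}. cmod (\<i> * of_real (lam 0) - \<i> * of_real (lam s))) / real M"
      by (simp add: norm_divide norm_mult prod_norm)
    also have "(\<Prod>s\<in>{1..M - 1}. cmod (\<i> * of_real (lam 0) - \<i> * of_real (lam s))) = (\<Prod>s\<in>{1..M - 1}. \<bar>lam 0 - lam s\<bar>)"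
      by (intro prod.cong refl) (simp add: norm_mult flip: right_diff_distrib of_real_diff)
    also have "(\<Prod>s\<in>{1..M - 1}. sig) / real M \<le> (\<Prod>s\<in>{1..M - 1}. \<bar>lam 0 - lam s\<bar>) / real M"
      using assms M_pos by (intro divide_right_mono prod_mono) (auto simp: separated_def)
    finally show False using lt by (simp add: eps_def power_divide)
  qed
  then show ?thesis using that unfolding eps_def by blast
qed

text \<open>Some derivative of order below \<open>M\<close> has modulus at least \<open>kap\<close>
  at \<open>u0\<close>. A unimodular factor makes it real there, and as the next derivative is
  bounded by 1 it stays above \<open>kap / 2\<close> within distance \<open>kap / 2\<close>.
  Separated small values are then few.\<close>

lemma small_values_local_cover:
  assumes sep: "separated sig" and "sig > 0"
    and h: "0 < h" "h \<le> 1"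
  defines "kap \<equiv> (sig / 2) ^ (M - 1) / real M"
  obtains P where "finite P" "card P \<le> 2 ^ M"
    "\<And>u. \<bar>u - u0\<bar> \<le> kap / 2 \<Longrightarrow> cmod (phi u) < kap / 2 * (h / 2) ^ (M - 1) \<Longrightarrow> \<exists>p\<in>P. \<bar>u - p\<bar> \<le> h"
proof -
  have kap: "kap > 0" using assms(2) M_pos by (simp add: kap_def)
  obtain d where d: "d < M" "cmod (dphi d u0) \<ge> kap"
    using exists_large_dphi[OF sep assms(2)] unfolding kap_def by blast
  define z where "z = cnj (sgn (dphi d u0))"
  define F where "F k u = Re (z * dphi k u)" for k u
  have nz: "dphi d u0 \<noteq> 0" using d kap by auto
  have normz: "cmod z = 1" using nz by (simp add: z_def norm_sgn)
  have F': "(F k has_real_derivative F (Suc k) x) (at x)" for k x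
    unfolding F_def[abs_def] by (rule has_real_derivative_rotated_dphi)
  have Fle: "\<bar>F k u\<bar> \<le> cmod (dphi k u)" for k u
    using abs_Re_le_cmod[of "z * dphi k u"] by (simp add: F_def norm_mult normz)
  have "z * dphi d u0 = of_real (cmod (dphi d u0))"
    using nz by (simp add: z_def sgn_eq complex_norm_square[symmetric] mult.commute[of "cnj _"] power2_eq_square)
  then have F0: "F d u0 \<ge> kap" using d by (simp add: F_def)
  have big: "\<bar>F d u\<bar> \<ge> kap / 2" if "u \<in> {u0 - kap / 2..u0 + kap / 2}" for u
  proof -
    have "\<bar>F d u - F d u0\<bar> \<le> 1 * \<bar>u - u0\<bar>"
      using field_differentiable_bound[of UNIV "F d" "F (Suc d)" 1 u u0] F'[of d] Fle[of "Suc d"]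
        norm_dphi_le_1[of "Suc d"] order_trans[OF Fle norm_dphi_le_1, of "Suc d"] by simp
    moreover have "\<bar>u - u0\<bar> \<le> kap / 2" using that unfolding atLeastAtMost_iff by linarith
    moreover have "F d u0 - F d u \<le> \<bar>F d u - F d u0\<bar>" by simp
    ultimately have "kap / 2 \<le> F d u" using F0 by argo
    then show ?thesis by (rule order_trans) simp
  qed
  define Z where "Z = {u. \<bar>u - u0\<bar> \<le> kap / 2 \<and> cmod (phi u) < kap / 2 * (h / 2) ^ (M - 1)}"
  have bounded_S: "card S \<le> 2 ^ M" if S: "finite S" "S \<subseteq> Z" "\<And>x y. x \<in> S \<Longrightarrow> y \<in> S \<Longrightarrow> x < y \<Longrightarrow> x + h \<le> y" for S
  proof -
    have "card S < 2 ^ d"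
    proof (rule card_separated_small_values[OF h(1) F' big S(1) _ S(3)])
      fix x assume "x \<in> S"
      then have x: "\<bar>x - u0\<bar> \<le> kap / 2" "cmod (phi x) < kap / 2 * (h / 2) ^ (M - 1)" using S(2) by (auto simp: Z_def)
      have "\<bar>F 0 x\<bar> \<le> cmod (phi x)" using Fle[of 0 x] by (simp add: dphi_0)
      also note x(2)
      \<comment> \<open>The order \<open>d\<close> varies with \<open>u0\<close>; the exponent
        \<open>M - 1\<close> serves all orders because \<open>h / 2 < 1\<close>.\<close>
      also have "kap / 2 * (h / 2) ^ (M - 1) \<le> kap / 2 * (h / 2) ^ d"
        using d h kap by (intro mult_left_mono power_decreasing) auto
      finally have "\<bar>F 0 x\<bar> < kap / 2 * (h / 2) ^ d" .
      moreover have "x \<in> {u0 - kap / 2..u0 + kap / 2}"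
        using abs_le_D1[OF x(1)] abs_le_D2[OF x(1)] unfolding atLeastAtMost_iff by argo
      ultimately show "x \<in> {u0 - kap / 2..u0 + kap / 2} \<and> \<bar>F 0 x\<bar> < kap / 2 * (h / 2) ^ d" by blast
    qed
    also have "(2::nat) ^ d \<le> 2 ^ M" using d by (intro power_increasing) auto
    finally show ?thesis by simp
  qed
  obtain P where "finite P" "card P \<le> 2 ^ M" "\<And>z. z \<in> Z \<Longrightarrow> \<exists>p\<in>P. \<bar>z - p\<bar> \<le> h"
    by (rule cover_if_separated_bounded[of Z h "2 ^ M", OF bounded_S]) (use h in auto)
  then show ?thesis using that[of P] by (simp add: Z_def)
qed

text \<open>A product of \<open>m\<close> factors below the \<open>m\<close>-th power of a threshold
  has a factor below the threshold. Its argument \<open>M ^ k * x\<close> runs over an interval of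
  length \<open>M ^ k\<close>, cut into pieces of length \<open>kap\<close> for the local cover; the
  sum over \<open>k\<close> is geometric.\<close>

lemma small_values_cover:
  assumes sep: "separated sig" and sig: "sig > 0"
    and h: "0 < h" "h \<le> 1"
  defines "kap \<equiv> (sig / 2) ^ (M - 1) / real M"
  obtains P where "finite P" "real (card P) \<le> 3 * 2 ^ M * real M ^ m / kap"
    "\<And>x. x \<in> {0..1} \<Longrightarrow> cmod (riesz 0 m x) < (kap / 2 * (h / 2) ^ (M - 1)) ^ m \<Longrightarrow> \<exists>p\<in>P. \<bar>x - p\<bar> \<le> h"
proof -
  define eps where "eps = kap / 2 * (h / 2) ^ (M - 1)"
  have kap: "kap > 0" using sig M_pos by (simp add: kap_def)
  have eps: "eps > 0" using kap h by (simp add: eps_def)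
  have "sig \<le> 1"
    using sep[unfolded separated_def, rule_format, of 0 1] lam[of 0] lam[of 1] M3 by (simp add: abs_le_iff abs_if split: if_splits)
  then have "(sig / 2) ^ (M - 1) \<le> 1" using sig by (intro power_le_one) auto
  then have kap1: "kap \<le> 1" using M3 unfolding kap_def by (simp add: divide_le_eq)
  have "\<exists>Q. finite Q \<and> card Q \<le> 2 ^ M \<and>
      (\<forall>u. \<bar>u - u0\<bar> \<le> kap / 2 \<and> cmod (phi u) < eps \<longrightarrow> (\<exists>p\<in>Q. \<bar>u - p\<bar> \<le> h))" for u0
    using small_values_local_cover[OF sep sig h, of u0] unfolding kap_def[symmetric] eps_def by metis
  then obtain Q where Q: "\<And>u0. finite (Q u0)" "\<And>u0. card (Q u0) \<le> 2 ^ M"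
    "\<And>u u0. \<bar>u - u0\<bar> \<le> kap / 2 \<Longrightarrow> cmod (phi u) < eps \<Longrightarrow> \<exists>p\<in>Q u0. \<bar>u - p\<bar> \<le> h"
    by metis
  define n where "n k = nat \<lceil>real M ^ k / kap\<rceil>" for k
  define P where "P = (\<Union>k\<in>{..<m}. \<Union>i\<in>{..n k}. (\<lambda>p. p / real M ^ k) ` Q (real i * kap))"
  have n_le: "real (Suc (n k)) \<le> 3 * (real M ^ k / kap)" for k
  proof -
    have "1 \<le> real M ^ k / kap" using kap kap1 M3 by (simp add: le_divide_eq order_trans[OF _ one_le_power])
    then show ?thesis unfolding n_def by linarith
  qed
  have "card P \<le> (\<Sum>k<m. card (\<Union>i\<in>{..n k}. (\<lambda>p. p / real M ^ k) ` Q (real i * kap)))"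
    unfolding P_def by (rule card_UN_le) simp
  also have "\<dots> \<le> (\<Sum>k<m. \<Sum>i\<in>{..n k}. card ((\<lambda>p. p / real M ^ k) ` Q (real i * kap)))"
    by (intro sum_mono card_UN_le) simp
  also have "\<dots> \<le> (\<Sum>k<m. \<Sum>i\<in>{..n k}. 2 ^ M)"
    by (intro sum_mono order.trans[OF card_image_le Q(2)] Q(1))
  also have "\<dots> = (\<Sum>k<m. Suc (n k) * 2 ^ M)" by simp
  finally have "real (card P) \<le> real (\<Sum>k<m. Suc (n k) * 2 ^ M)" by (rule of_nat_mono)
  also have "\<dots> = (\<Sum>k<m. real (Suc (n k)) * 2 ^ M)"
    unfolding of_nat_sum of_nat_mult by simp
  also have "\<dots> \<le> (\<Sum>k<m. 3 * (real M ^ k / kap) * 2 ^ M)"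
    by (intro sum_mono mult_right_mono n_le) auto
  also have "\<dots> = 3 * 2 ^ M / kap * (\<Sum>k<m. real M ^ k)"
    by (simp add: sum_distrib_left sum_divide_distrib mult_ac)
  also have "\<dots> \<le> 3 * 2 ^ M / kap * real M ^ m"
  proof (intro mult_left_mono)
    show "(\<Sum>k<m. real M ^ k) \<le> real M ^ m"
    proof (induction m)
      case (Suc m)
      have "2 * real M ^ m \<le> real M * real M ^ m" using M3 by (intro mult_right_mono) auto
      then show ?case using Suc by simp
    qed simp
  qed (use kap in simp)
  finally have card: "real (card P) \<le> 3 * 2 ^ M * real M ^ m / kap" by simp
  show ?thesis
  proof (rule that[of P])
    show "finite P" using Q(1) by (auto simp: P_def)
    show "real (card P) \<le> 3 * 2 ^ M * real M ^ m / kap" by (rule card)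
    fix x assume x: "x \<in> {0..1}" and "cmod (riesz 0 m x) < (kap / 2 * (h / 2) ^ (M - 1)) ^ m"
    then have lt: "cmod (riesz 0 m x) < eps ^ m" by (simp add: eps_def)
    have "\<exists>k<m. cmod (phi (real M ^ k * x)) < eps"
    proof (rule ccontr)
      assume "\<not> (\<exists>k<m. cmod (phi (real M ^ k * x)) < eps)"
      then have "(\<Prod>k\<in>{0..<m}. eps) \<le> (\<Prod>k\<in>{0..<m}. cmod (phi (real M ^ k * x)))"
        using eps by (intro prod_mono conjI) (auto intro: leI)
      then show False using lt by (simp add: riesz_def prod_norm)
    qed
    then obtain k where k: "k < m" "cmod (phi (real M ^ k * x)) < eps" by blast
    define u where "u = real M ^ k * x"
    have Pk: "real M ^ k \<ge> 1" using M3 by simp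
    \<comment> \<open>Rounding to the nearest integer puts \<open>u\<close> within
      \<open>kap / 2\<close> of the grid point \<open>i * kap\<close>.\<close>
    define i where "i = nat \<lfloor>u / kap + 1 / 2\<rfloor>"
    have u: "0 \<le> u" "u \<le> real M ^ k" using x Pk by (auto simp: u_def mult_left_le)
    have q0: "0 \<le> u / kap" using u kap by simp
    have "u / kap \<le> real M ^ k / kap" using u kap by (intro divide_right_mono) auto
    then have "i \<le> n k" unfolding i_def n_def using q0 by linarith
    have "\<bar>u / kap - real i\<bar> \<le> 1 / 2" unfolding i_def using q0 by linarith
    then have "kap * \<bar>u / kap - real i\<bar> \<le> kap * (1 / 2)" using kap by (intro mult_left_mono) auto
    moreover have "kap * \<bar>u / kap - real i\<bar> = \<bar>u - real i * kap\<bar>"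
    proof -
      have "kap * \<bar>u / kap - real i\<bar> = \<bar>kap * (u / kap - real i)\<bar>" using kap by (simp add: abs_mult)
      also have "kap * (u / kap - real i) = u - real i * kap" using kap by (simp add: right_diff_distrib)
      finally show ?thesis .
    qed
    ultimately have "\<bar>u - real i * kap\<bar> \<le> kap / 2" by simp
    then obtain p where p: "p \<in> Q (real i * kap)" "\<bar>u - p\<bar> \<le> h" using Q(3) k(2) by (auto simp: u_def)
    have "\<bar>x - p / real M ^ k\<bar> = \<bar>u - p\<bar> / real M ^ k"
    proof -
      have "real M ^ k \<noteq> 0" using M_pos by simp
      then have "x = u / real M ^ k" unfolding u_def by (rule nonzero_mult_div_cancel_left[symmetric])
      then have "x - p / real M ^ k = (u - p) / real M ^ k" by (simp only: diff_divide_distrib)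
      then show ?thesis by (simp add: abs_divide)
    qed
    also have "\<dots> \<le> \<bar>u - p\<bar> / 1" using Pk M_pos by (intro divide_left_mono) auto
    finally have "\<bar>x - p / real M ^ k\<bar> \<le> h" using p(2) by simp
    then show "\<exists>p\<in>P. \<bar>x - p\<bar> \<le> h"
      using p(1) k(1) \<open>i \<le> n k\<close> unfolding P_def by blast
  qed
qed

end

section \<open>Large values of the middle block\<close>

text \<open>The possible roundings of a pair of real orbits under multiplication by
  \<open>M\<close>: an ordinary step is exact, and at most \<open>b\<close> of the \<open>k\<close>
  steps may add an error of size up to \<open>M\<close> in each coordinate.\<close>

primrec branches :: "nat \<Rightarrow> (int \<times> int) set \<Rightarrow> nat \<Rightarrow> nat \<Rightarrow> (int \<times> int) set" where
  "branches M S 0 b = S"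
| "branches M S (Suc k) b = (\<lambda>(p, q). (int M * p, int M * q)) ` branches M S k b \<union>
    (case b of 0 \<Rightarrow> {} | Suc c \<Rightarrow>
      (\<lambda>((p, q), (r, s)). (int M * p + r, int M * q + s)) `
        (branches M S k c \<times> ({- int M..int M} \<times> {- int M..int M})))"

lemma finite_branches: "finite S \<Longrightarrow> finite (branches M S k b)"
  by (induction k arbitrary: b) (auto split: nat.splits)

text \<open>The power of 2 bounds the choices of exceptional steps, each of which offers
  \<open>(2 * M + 1)^2\<close> errors.\<close>

lemma card_branches_le:
  assumes "finite S"
  shows "card (branches M S k b) \<le> card S * ((2 * M + 1)\<^sup>2) ^ b * 2 ^ k"
proof (induction k arbitrary: b)
  case 0
  have "1 \<le> ((2 * M + 1)\<^sup>2) ^ b" by (intro one_le_power) auto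
  then show ?case by simp
next
  case (Suc k)
  define V where "V = (2 * M + 1)\<^sup>2"
  have 1: "card ((\<lambda>(p, q). (int M * p, int M * q)) ` branches M S k b) \<le> card S * V ^ b * 2 ^ k"
    using card_image_le[OF finite_branches[OF assms]] Suc[of b] unfolding V_def by (rule order_trans)
  show ?case
  proof (cases b)
    case 0
    then show ?thesis using 1 by (simp add: V_def)
  next
    case (Suc c)
    let ?D = "{- int M..int M} \<times> {- int M..int M}"
    have "card {- int M..int M} = 2 * M + 1" by simp
    then have D: "card ?D = V" by (simp only: card_cartesian_product V_def power2_eq_square)
    have "card ((\<lambda>((p, q), (r, s)). (int M * p + r, int M * q + s)) ` (branches M S k c \<times> ?D))
        \<le> card (branches M S k c \<times> ?D)"
      by (intro card_image_le finite_cartesian_product finite_branches assms) auto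
    also have "\<dots> = card (branches M S k c) * V" by (simp only: card_cartesian_product[of _ ?D] D)
    also have "\<dots> \<le> card S * V ^ c * 2 ^ k * V"
      using Suc.IH[of c] by (intro mult_right_mono) (auto simp: V_def)
    also have "\<dots> = card S * V ^ b * 2 ^ k" by (simp add: Suc)
    finally have 2: "card ((\<lambda>((p, q), (r, s)). (int M * p + r, int M * q + s)) ` (branches M S k c \<times> ?D))
        \<le> card S * V ^ b * 2 ^ k" .
    have "card (branches M S (Suc k) b) \<le> card S * V ^ b * 2 ^ k + card S * V ^ b * 2 ^ k"
      unfolding branches.simps Suc nat.case
      by (rule order_trans[OF card_Un_le add_mono[OF 1[unfolded Suc] 2[unfolded Suc]]])
    then show ?thesis by (simp add: V_def)
  qed
qed

section \<open>Directions in which a vector has a short projection\<close>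

lemma half_le_sin:
  fixes x :: real
  assumes "0 \<le> x" "x \<le> pi / 2"
  shows "x / 2 \<le> sin x"
proof (cases "x \<le> pi / 3")
  case True
  have "(\<lambda>x. sin x - x / 2) 0 \<le> (\<lambda>x. sin x - x / 2) x"
  proof (rule DERIV_nonneg_imp_nondecreasing[OF assms(1)])
    fix y assume y: "0 \<le> y" "y \<le> x"
    have "((\<lambda>x. sin x - x / 2) has_real_derivative cos y - 1 / 2) (at y)"
      by (auto intro!: derivative_eq_intros)
    moreover have "cos (pi / 3) \<le> cos y" using y True by (intro cos_monotone_0_pi_le) auto
    ultimately show "\<exists>d. ((\<lambda>x. sin x - x / 2) has_real_derivative d) (at y) \<and> 0 \<le> d"
      by (intro exI[of _ "cos y - 1 / 2"]) (auto simp: cos_60)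
  qed
  then show ?thesis by simp
next
  case False
  \<comment> \<open>Beyond \<open>pi / 3\<close> the derivative of the difference is negative; there
    \<open>sqrt 3 / 2\<close> exceeds \<open>pi / 4\<close>, the largest value of
    \<open>x / 2\<close>.\<close>
  have "sin (pi / 3) \<le> sin x" using False assms pi_gt_zero by (intro sin_monotone_2pi_le) linarith+
  moreover have "sin (pi / 3) = sqrt 3 / 2" by (simp add: sin_60)
  moreover have "sqrt 3 \<ge> 17 / 10" by (rule real_le_rsqrt) (simp add: power2_eq_square)
  moreover have "pi < 34 / 10" using pi_less_4 pi_approx by simp
  ultimately show ?thesis using assms by linarith
qed

lemma abs_sin_ge_dist:
  fixes y :: real
  assumes "k = round (y / pi)"
  shows "\<bar>y - real_of_int k * pi\<bar> \<le> 2 * \<bar>sin y\<bar>"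
proof -
  define x where "x = y - real_of_int k * pi"
  have "\<bar>real_of_int k - y / pi\<bar> \<le> 1 / 2" unfolding assms by (rule of_int_round_abs_le)
  then have "pi * \<bar>real_of_int k - y / pi\<bar> \<le> pi * (1 / 2)" by (intro mult_left_mono) auto
  moreover have "pi * \<bar>real_of_int k - y / pi\<bar> = \<bar>pi * (real_of_int k - y / pi)\<bar>" by (simp add: abs_mult)
  moreover have "pi * (real_of_int k - y / pi) = - x" by (simp add: x_def algebra_simps)
  ultimately have "\<bar>x\<bar> \<le> pi / 2" by simp
  then have "\<bar>x\<bar> / 2 \<le> sin \<bar>x\<bar>" by (intro half_le_sin) auto
  also have "sin \<bar>x\<bar> = \<bar>sin x\<bar>" using \<open>\<bar>x\<bar> \<le> pi / 2\<close>
  proof (cases "x \<ge> 0")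
    case True
    then show ?thesis using \<open>\<bar>x\<bar> \<le> pi / 2\<close> sin_ge_zero[of x] by simp
  next
    case False
    then show ?thesis using \<open>\<bar>x\<bar> \<le> pi / 2\<close> sin_ge_zero[of "- x"] by simp
  qed
  also have "\<bar>sin x\<bar> = \<bar>sin y\<bar>"
  proof -
    have sin0: "sin (real_of_int k * pi) = 0" unfolding sin_zero_iff_int2 by blast
    have "sin x = sin y * cos (real_of_int k * pi)"
      by (simp add: x_def sin_diff sin0)
    moreover have "\<bar>cos (real_of_int k * pi)\<bar> = 1" using sin0 by (rule sin_zero_abs_cos_one)
    ultimately show ?thesis by (simp add: abs_mult)
  qed
  finally show ?thesis by (simp add: x_def)
qed

text \<open>The projection is \<open>cmod D\<close> times the sine of the angle to a perpendicular
  of \<open>D\<close>, so a good direction is within \<open>2 * t / cmod D\<close> of one of five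
  candidates for that perpendicular.\<close>

lemma measure_small_projection:
  fixes D :: complex
  assumes "D \<noteq> 0" "t \<ge> 0"
  shows "measure lborel ({0..<pi} \<inter> {\<theta>. \<bar>Re (D * cis (- \<theta>))\<bar> \<le> t}) \<le> 20 * t / cmod D"
proof -
  define s where "s = t / cmod D"
  define w where "w = Arg D"
  have s: "s \<ge> 0" using assms by (simp add: s_def)
  have w: "- pi < w" "w \<le> pi" using Arg_bounded[of D] by (auto simp: w_def)
  have sub: "{0..<pi} \<inter> {\<theta>. \<bar>Re (D * cis (- \<theta>))\<bar> \<le> t}
      \<subseteq> (\<Union>k\<in>{-2..2::int}. {w + pi / 2 + k * pi - 2 * s..w + pi / 2 + k * pi + 2 * s})"
  proof
    fix \<theta> assume "\<theta> \<in> {0..<pi} \<inter> {\<theta>. \<bar>Re (D * cis (- \<theta>))\<bar> \<le> t}"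
    then have th: "0 \<le> \<theta>" "\<theta> < pi" "\<bar>Re (D * cis (- \<theta>))\<bar> \<le> t" by auto
    define y where "y = \<theta> - w - pi / 2"
    define k where "k = round (y / pi)"
    have "D * cis (- \<theta>) = of_real (cmod D) * cis (w - \<theta>)"
      using rcis_cmod_Arg[of D] by (simp add: rcis_def w_def cis_mult mult.assoc flip: diff_conv_add_uminus)
         (metis cis_mult diff_conv_add_uminus mult.assoc)
    then have "Re (D * cis (- \<theta>)) = cmod D * cos (w - \<theta>)" by simp
    moreover have "cos (w - \<theta>) = - sin y"
      by (simp add: y_def sin_diff cos_diff sin_add cos_add)
    ultimately have "cmod D * \<bar>sin y\<bar> \<le> t" using th(3) by (simp add: abs_mult)
    then have "\<bar>sin y\<bar> \<le> s" using assms by (simp add: s_def field_simps)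
    then have le: "\<bar>y - k * pi\<bar> \<le> 2 * s" using abs_sin_ge_dist[OF k_def] by linarith
    have "y < 3 / 2 * pi" "y \<ge> - (3 / 2) * pi" using th w unfolding y_def by (auto simp: algebra_simps)
    then have "y / pi < 3 / 2" "y / pi \<ge> - 3 / 2" by (auto simp: field_simps)
    then have "k \<in> {-2..2}" unfolding k_def
      using of_int_round_le[of "y / pi"] of_int_round_ge[of "y / pi"] unfolding atLeastAtMost_iff
      by linarith
    moreover have "\<theta> \<in> {w + pi / 2 + k * pi - 2 * s..w + pi / 2 + k * pi + 2 * s}"
      using le unfolding y_def abs_le_iff by auto
    ultimately show "\<theta> \<in> (\<Union>k\<in>{-2..2::int}. {w + pi / 2 + k * pi - 2 * s..w + pi / 2 + k * pi + 2 * s})"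
      by blast
  qed
  have "measure lborel ({0..<pi} \<inter> {\<theta>. \<bar>Re (D * cis (- \<theta>))\<bar> \<le> t})
      \<le> measure lborel (\<Union>k\<in>{-2..2::int}. {w + pi / 2 + k * pi - 2 * s..w + pi / 2 + k * pi + 2 * s})"
    by (intro measure_mono_fmeasurable sub fmeasurable_compact compact_UN) auto
  also have "\<dots> \<le> (\<Sum>k\<in>{-2..2::int}. measure lborel {w + pi / 2 + k * pi - 2 * s..w + pi / 2 + k * pi + 2 * s})"
    by (intro measure_UNION_le) auto
  also have "\<dots> = 20 * s" using s by simp
  finally show ?thesis by (simp add: s_def)
qed

context digit_system
begin

text \<open>The bound on \<open>phi\<close> forced by a single phase difference farther than
  \<open>1 / (4 * M)\<close>, in full turns, from the integers. It depends on \<open>M\<close> alone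
  and not on \<open>lam\<close>.\<close>

definition contraction :: real where
  "contraction = sqrt (1 - 2 / (real M)\<^sup>2 * (1 - cos (pi / (2 * real M))))"

lemma contraction_bounds: "0 < contraction" "contraction < 1"
proof -
  have "pi / (2 * real M) < pi / 2" "0 < pi / (2 * real M)" using M3 by (auto simp: field_simps)
  then have "0 < cos (pi / (2 * real M))" by (intro cos_gt_zero) auto
  moreover have "cos (pi / (2 * real M)) < 1"
    using cos_monotone_0_pi[of 0 "pi / (2 * real M)"] M3 by (auto simp: field_simps)
  moreover have "0 < 2 / (real M)\<^sup>2" "2 / (real M)\<^sup>2 < 1"
    using M3 power_mono[of 3 "real M" 2] by (auto simp: field_simps)
  ultimately have "0 < 2 / (real M)\<^sup>2 * (1 - cos (pi / (2 * real M)))"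
    "2 / (real M)\<^sup>2 * (1 - cos (pi / (2 * real M))) < 1 * 1"
    by (auto intro!: mult_strict_mono mult_pos_pos)
  then show "0 < contraction" "contraction < 1" unfolding contraction_def by auto
qed

text \<open>\<open>M^2 * (1 - (cmod (phi u))^2)\<close> is a sum of nonnegative terms
  \<open>1 - cos\<close> over pairs of digits, and the pairs \<open>(i, j)\<close> and
  \<open>(j, i)\<close> already give the loss.\<close>

lemma norm_phi_le_contraction:
  assumes "i < M" "j < M" "i \<noteq> j"
    and far: "\<bar>real_of_int (round y) - y\<bar> > 1 / (4 * real M)"
    and y: "y = u * (lam i - lam j) / (2 * pi)"
  shows "cmod (phi u) \<le> contraction"
proof -
  define z where "z = \<bar>2 * pi * (real_of_int (round y) - y)\<bar>"
  have le: "\<bar>real_of_int (round y) - y\<bar> \<le> 1 / 2" by (rule of_int_round_abs_le)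
  have z: "z = 2 * pi * \<bar>real_of_int (round y) - y\<bar>" by (simp add: z_def abs_mult)
  have z1: "pi / (2 * real M) \<le> z"
    using mult_left_mono[OF less_imp_le[OF far], of "2 * pi"] by (simp add: z)
  have z2: "z \<le> pi" using mult_left_mono[OF le, of "2 * pi"] by (simp add: z)
  have "cos z \<le> cos (pi / (2 * real M))" using z1 z2 by (intro cos_monotone_0_pi_le) auto
  also have "cos z = cos (u * (lam i - lam j))"
  proof -
    have "cos z = cos (2 * pi * y - 2 * pi * real_of_int (round y))"
      by (simp add: z_def abs_if algebra_simps) (metis cos_minus minus_diff_eq)
    also have "\<dots> = cos (2 * pi * y)" by (simp add: cos_diff)
    finally show ?thesis by (simp add: y)
  qed
  finally have c: "cos (u * (lam i - lam j)) \<le> cos (pi / (2 * real M))" .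
  then have c': "cos (u * (lam j - lam i)) \<le> cos (pi / (2 * real M))"
    by (metis cos_minus minus_diff_eq mult_minus_right)
  define g where "g p = (case p of (v, w) \<Rightarrow> 1 - cos (u * (lam v - lam w)))" for p :: "nat \<times> nat"
  have "2 * (1 - cos (pi / (2 * real M))) \<le> (\<Sum>p\<in>{(i, j), (j, i)}. g p)"
    using assms(3) c c' by (simp add: g_def)
  also have "\<dots> \<le> (\<Sum>p\<in>{..<M} \<times> {..<M}. g p)"
    using assms(1,2) by (intro sum_mono2) (auto simp: g_def)
  also have "\<dots> = (real M)\<^sup>2 - (\<Sum>v<M. \<Sum>w<M. cos (u * (lam v - lam w)))"
    by (simp add: g_def sum.cartesian_product[symmetric] sum_subtractf power2_eq_square case_prod_beta')
       (simp add: sum.cartesian_product case_prod_beta')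
  also have "(\<Sum>v<M. \<Sum>w<M. cos (u * (lam v - lam w))) = (real M)\<^sup>2 * (cmod (phi u))\<^sup>2"
    using M_pos by (simp add: norm_sum_cis_squared[symmetric] phi_def norm_divide power_divide)
  finally have "(real M)\<^sup>2 * (cmod (phi u))\<^sup>2 \<le> (real M)\<^sup>2 - 2 * (1 - cos (pi / (2 * real M)))" by simp
  then have "(cmod (phi u))\<^sup>2 \<le> 1 - 2 / (real M)\<^sup>2 * (1 - cos (pi / (2 * real M)))"
    using M_pos by (simp add: field_simps)
  then show ?thesis unfolding contraction_def by (rule real_le_rsqrt)
qed

end

context digit_system
begin

section \<open>Rounded orbits and the directions admitting large values\<close>

definition far_from_int :: "real \<Rightarrow> bool" where
  "far_from_int y \<longleftrightarrow> \<bar>real_of_int (round y) - y\<bar> > 1 / (4 * real M)"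

text \<open>The threshold \<open>1 / (4 * M)\<close> is chosen for this: multiplication by
  \<open>M\<close> raises the error to at most 1/4, so it commutes with rounding.\<close>

lemma round_mult_M:
  assumes "\<not> far_from_int y"
  shows "round (real M * y) = int M * round y"
proof (rule round_unique')
  have "real M * \<bar>real_of_int (round y) - y\<bar> \<le> real M * (1 / (4 * real M))"
    using assms by (intro mult_left_mono) (auto simp: far_from_int_def)
  also have "\<dots> = 1 / 4" using M_pos by simp
  also have "real M * \<bar>real_of_int (round y) - y\<bar> = \<bar>real M * y - real M * real_of_int (round y)\<bar>"
    by (simp add: abs_mult[of "real M", simplified, symmetric] right_diff_distrib abs_minus_commute)
  finally show "\<bar>real M * y - real_of_int (int M * round y)\<bar> < 1 / 2" by simp
qed

text \<open>The old rounding contributes at most \<open>M / 2\<close> and the new one at most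
  1/2.\<close>

lemma round_mult_M_diff: "round (real M * y) - int M * round y \<in> {- int M..int M}"
proof -
  have "real M * \<bar>real_of_int (round y) - y\<bar> \<le> real M * (1 / 2)"
    by (intro mult_left_mono of_int_round_abs_le) auto
  moreover have "real M * \<bar>real_of_int (round y) - y\<bar> = \<bar>real M * real_of_int (round y) - real M * y\<bar>"
    by (simp add: abs_mult[of "real M", simplified, symmetric] right_diff_distrib)
  moreover have "\<bar>real_of_int (round (real M * y)) - real M * y\<bar> \<le> 1 / 2" by (rule of_int_round_abs_le)
  moreover have "real M \<ge> 3" using M3 by simp
  ultimately have "\<bar>real_of_int (round (real M * y)) - real M * real_of_int (round y)\<bar> \<le> real M" by argo
  then have "\<bar>real_of_int (round (real M * y) - int M * round y)\<bar> \<le> real_of_int (int M)" by simp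
  then show ?thesis unfolding atLeastAtMost_iff by linarith
qed

lemma rounded_orbit_in_branches:
  fixes y z :: "nat \<Rightarrow> real"
  assumes y: "\<And>i. y (Suc i) = real M * y i" and z: "\<And>i. z (Suc i) = real M * z i"
    and S: "(round (y 0), round (z 0)) \<in> S"
  shows "card {i. i < k \<and> (far_from_int (y i) \<or> far_from_int (z i))} \<le> b
    \<Longrightarrow> (round (y k), round (z k)) \<in> branches M S k b"
proof (induction k arbitrary: b)
  case 0
  then show ?case using S by simp
next
  case (Suc k)
  let ?bad = "\<lambda>i. far_from_int (y i) \<or> far_from_int (z i)"
  show ?case
  proof (cases "?bad k")
    case False
    then have "{i. i < Suc k \<and> ?bad i} = {i. i < k \<and> ?bad i}" by (auto simp: less_Suc_eq)
    then have "(round (y k), round (z k)) \<in> branches M S k b" using Suc by simp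
    then have "(int M * round (y k), int M * round (z k)) \<in> branches M S (Suc k) b" by force
    then show ?thesis using False by (simp add: y z round_mult_M)
  next
    case True
    then have "{i. i < Suc k \<and> ?bad i} = insert k {i. i < k \<and> ?bad i}" by (auto simp: less_Suc_eq)
    then have "Suc (card {i. i < k \<and> ?bad i}) \<le> b" using Suc.prems by simp
    then obtain c where c: "b = Suc c" "card {i. i < k \<and> ?bad i} \<le> c" by (cases b) auto
    define r s where "r = round (y (Suc k)) - int M * round (y k)" and "s = round (z (Suc k)) - int M * round (z k)"
    have rs: "(r, s) \<in> {- int M..int M} \<times> {- int M..int M}"
      using round_mult_M_diff[of "y k"] round_mult_M_diff[of "z k"] by (simp add: r_def s_def y z)
    have "((round (y k), round (z k)), (r, s)) \<in> branches M S k c \<times> ({- int M..int M} \<times> {- int M..int M})"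
      using Suc.IH[OF c(2)] rs by simp
    from rev_image_eqI[OF this, of _ "\<lambda>((p, q), (r, s)). (int M * p + r, int M * q + s)"]
    have "(int M * round (y k) + r, int M * round (z k) + s) \<in> branches M S (Suc k) b"
      unfolding c(1) branches.simps nat.case by (intro UnI2) simp
    then show ?thesis by (simp add: r_def s_def)
  qed
qed

text \<open>Each index where one of the two phase differences is far from the integers costs a
  factor \<open>contraction\<close>; the other factors are at most 1.\<close>

lemma norm_riesz_le_contraction_power:
  fixes m l :: nat and x :: real
  assumes j: "j0 < M" "j1 < M" "j2 < M" "j1 \<noteq> j0" "j2 \<noteq> j0"
  defines "y \<equiv> \<lambda>i. real M ^ (m + i) * x * (lam j1 - lam j0) / (2 * pi)"
    and "z \<equiv> \<lambda>i. real M ^ (m + i) * x * (lam j2 - lam j0) / (2 * pi)"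
  shows "cmod (riesz m (m + l) x)
    \<le> contraction ^ card {i. i < l \<and> (far_from_int (y i) \<or> far_from_int (z i))}"
proof -
  let ?bad = "\<lambda>i. far_from_int (y i) \<or> far_from_int (z i)"
  have "riesz m (m + l) x = (\<Prod>i<l. phi (real M ^ (m + i) * x))"
    using riesz_shift[of 0 m l x]
    by (simp add: riesz_def add.commute atLeast0LessThan power_add mult_ac)
  then have "cmod (riesz m (m + l) x) = (\<Prod>i<l. cmod (phi (real M ^ (m + i) * x)))"
    by (simp add: prod_norm)
  also have "\<dots> \<le> (\<Prod>i<l. if ?bad i then contraction else 1)"
  proof (intro prod_mono conjI norm_ge_zero)
    fix i
    show "cmod (phi (real M ^ (m + i) * x)) \<le> (if ?bad i then contraction else 1)"
    proof (cases "?bad i")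
      case True
      then consider "far_from_int (y i)" | "far_from_int (z i)" by blast
      then have "cmod (phi (real M ^ (m + i) * x)) \<le> contraction"
      proof cases
        case 1
        then show ?thesis unfolding far_from_int_def y_def by (intro norm_phi_le_contraction[OF j(2,1,4)]) auto
      next
        case 2
        then show ?thesis unfolding far_from_int_def z_def by (intro norm_phi_le_contraction[OF j(3,1,5)]) auto
      qed
      then show ?thesis using True by simp
    qed (simp add: norm_phi_le_1)
  qed
  also have "\<dots> = contraction ^ card {i. i < l \<and> ?bad i}"
    by (simp add: prod.If_cases Int_def)
  finally show ?thesis .
qed

text \<open>A large block has at most \<open>b\<close> far indices, so the rounded phase differences
  \<open>(p, q)\<close> lie in the branch set. Before rounding the pair is proportional to
  \<open>(al, be)\<close>, hence \<open>p * d2 - q * d1\<close> has projection at most 1/2, while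
  independence of \<open>d1\<close> and \<open>d2\<close> makes it long. The direction is thus
  nearly orthogonal to one of few long vectors.\<close>

lemma large_value_hit:
  fixes C :: "nat \<Rightarrow> complex" and e :: complex and m l b :: nat and d tau x :: real
  assumes C: "\<And>j. j < M \<Longrightarrow> lam j = Re (C j * e)" "\<And>j. j < M \<Longrightarrow> cmod (C j) \<le> 1 / 4" and e: "cmod e = 1"
    and j: "j0 < M" "j1 < M" "j2 < M"
  defines "d1 \<equiv> C j1 - C j0" and "d2 \<equiv> C j2 - C j0"
  defines "Del \<equiv> \<bar>Im (cnj d1 * d2)\<bar>"
  assumes Del: "Del > 0" and tau: "contraction ^ b \<le> tau"
    and d: "0 < d" "4 * pi \<le> real M ^ (m + l) * d * Del"
  defines "Dif \<equiv> \<lambda>(p, q). of_int p * d2 - of_int q * d1"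
    and "S \<equiv> {- (int M ^ m)..int M ^ m} \<times> {- (int M ^ m)..int M ^ m}"
  assumes x: "x \<in> {d..1}" "cmod (riesz m (m + l) x) > tau"
  shows "\<exists>c\<in>branches M S l b.
    Del\<^sup>2 * real M ^ (m + l) * d / (4 * pi) \<le> cmod (Dif c) \<and> \<bar>Re (Dif c * e)\<bar> \<le> 1 / 2"
proof -
  define L where "L = real M ^ (m + l)"
  have L: "L > 0" using M_pos by (simp add: L_def)
  define al be where "al = lam j1 - lam j0" and "be = lam j2 - lam j0"
  have al: "al = Re (d1 * e)" and be: "be = Re (d2 * e)"
    using C(1) j by (simp_all add: al_def be_def d1_def d2_def left_diff_distrib)
  have al_le: "\<bar>al\<bar> \<le> 1 / 2" and be_le: "\<bar>be\<bar> \<le> 1 / 2"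
    using lam[OF j(1)] lam[OF j(2)] lam[OF j(3)] unfolding al_def be_def by linarith+
  have nd: "cmod d1 \<le> 1 / 2" "cmod d2 \<le> 1 / 2"
    using norm_triangle_ineq4[of "C j1" "C j0"] norm_triangle_ineq4[of "C j2" "C j0"] C(2)[OF j(1)] C(2)[OF j(2)] C(2)[OF j(3)]
    unfolding d1_def d2_def by linarith+
  have j12: "j1 \<noteq> j0" "j2 \<noteq> j0" using Del by (auto simp: Del_def d1_def d2_def)
  \<comment> \<open>By independence, \<open>d1\<close> and \<open>d2\<close> cannot both be nearly
    orthogonal to the direction.\<close>
  have albe: "\<bar>al\<bar> + \<bar>be\<bar> \<ge> Del"
  proof -
    have "of_real al * d2 - of_real be * d1 = \<i> * of_real (Im (cnj d1 * d2)) * cnj e"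
    proof -
      have e2: "(Re e)\<^sup>2 + (Im e)\<^sup>2 = 1" using e by (simp add: cmod_def)
      show ?thesis unfolding al be by (auto simp: complex_eq_iff algebra_simps)
    qed
    then have "Del = cmod (of_real al * d2 - of_real be * d1)"
      by (simp only: norm_mult Del_def norm_of_real norm_ii complex_mod_cnj e mult_1 mult_1_right)
    also have "\<dots> \<le> cmod (of_real al * d2) + cmod (of_real be * d1)" by (rule norm_triangle_ineq4)
    also have "\<dots> \<le> \<bar>al\<bar> * 1 + \<bar>be\<bar> * 1"
      unfolding norm_mult norm_of_real using nd by (intro add_mono mult_left_mono) auto
    finally show ?thesis by simp
  qed
  \<comment> \<open>Pairing with \<open>d1\<close> isolates \<open>p\<close>, pairing with
    \<open>d2\<close> isolates \<open>q\<close>.\<close>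
  have Dif_ge: "cmod (Dif (p, q)) \<ge> Del * (\<bar>real_of_int p\<bar> + \<bar>real_of_int q\<bar>)" for p q
  proof -
    have "real_of_int p * Im (cnj d1 * d2) = Im (cnj d1 * Dif (p, q))"
      by (simp add: Dif_def algebra_simps)
    then have "\<bar>real_of_int p\<bar> * Del = \<bar>Im (cnj d1 * Dif (p, q))\<bar>" unfolding Del_def by (metis abs_mult)
    also have "\<dots> \<le> cmod (cnj d1 * Dif (p, q))" by (rule abs_Im_le_cmod)
    also have "\<dots> \<le> 1 / 2 * cmod (Dif (p, q))" unfolding norm_mult complex_mod_cnj using nd by (intro mult_right_mono) auto
    finally have 1: "\<bar>real_of_int p\<bar> * Del \<le> 1 / 2 * cmod (Dif (p, q))" .
    have "real_of_int q * Im (cnj d1 * d2) = Im (cnj d2 * Dif (p, q))"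
      by (simp add: Dif_def algebra_simps)
    then have "\<bar>real_of_int q\<bar> * Del = \<bar>Im (cnj d2 * Dif (p, q))\<bar>" unfolding Del_def by (metis abs_mult)
    also have "\<dots> \<le> cmod (cnj d2 * Dif (p, q))" by (rule abs_Im_le_cmod)
    also have "\<dots> \<le> 1 / 2 * cmod (Dif (p, q))" unfolding norm_mult complex_mod_cnj using nd by (intro mult_right_mono) auto
    finally show ?thesis using 1 by (simp add: algebra_simps)
  qed
  define lab where "lab = (round (L * x * al / (2 * pi)), round (L * x * be / (2 * pi)))"
  have x01: "d \<le> x" "x \<le> 1" "tau < cmod (riesz m (m + l) x)" using x by auto
  define y z where "y i = real M ^ (m + i) * x * al / (2 * pi)" and "z i = real M ^ (m + i) * x * be / (2 * pi)" for i
  have le: "\<bar>real M ^ m * x * r / (2 * pi)\<bar> \<le> real M ^ m / 2" if "\<bar>r\<bar> \<le> 1 / 2" for r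
  proof -
    have "\<bar>real M ^ m * x * r / (2 * pi)\<bar> = real M ^ m * (x * (\<bar>r\<bar> / (2 * pi)))"
      using x01 d by (simp add: abs_mult)
    also have "\<bar>r\<bar> / (2 * pi) \<le> (1 / 2) / 1"
      using that pi_gt3 by (intro frac_le) auto
    then have "x * (\<bar>r\<bar> / (2 * pi)) \<le> 1 * (1 / 2)" using x01 d by (intro mult_mono) auto
    then have "real M ^ m * (x * (\<bar>r\<bar> / (2 * pi))) \<le> real M ^ m * (1 * (1 / 2))" by (intro mult_left_mono) auto
    finally show ?thesis by simp
  qed
  have rnd: "round (real M ^ m * x * r / (2 * pi)) \<in> {- (int M ^ m)..int M ^ m}" if "\<bar>r\<bar> \<le> 1 / 2" for r
  proof -
    have "\<bar>real_of_int (round (real M ^ m * x * r / (2 * pi))) - real M ^ m * x * r / (2 * pi)\<bar> \<le> 1 / 2"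
      by (rule of_int_round_abs_le)
    moreover have "real M ^ m \<ge> 1" using M3 by simp
    ultimately have "\<bar>real_of_int (round (real M ^ m * x * r / (2 * pi)))\<bar> \<le> real M ^ m"
      using le[OF that] by linarith
    then have "\<bar>real_of_int (round (real M ^ m * x * r / (2 * pi)))\<bar> \<le> real_of_int (int M ^ m)" by simp
    then show ?thesis unfolding atLeastAtMost_iff by linarith
  qed
  have in_S: "(round (y 0), round (z 0)) \<in> S"
    using rnd al_le be_le by (simp add: y_def z_def S_def)
  have "card {i. i < l \<and> (far_from_int (y i) \<or> far_from_int (z i))} \<le> b"
  proof (rule ccontr)
    assume "\<not> card {i. i < l \<and> (far_from_int (y i) \<or> far_from_int (z i))} \<le> b"
    then have "contraction ^ card {i. i < l \<and> (far_from_int (y i) \<or> far_from_int (z i))} \<le> contraction ^ b"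
      using contraction_bounds by (intro power_decreasing) auto
    then have "cmod (riesz m (m + l) x) \<le> tau"
      using norm_riesz_le_contraction_power[OF j j12, of m l x] tau
      unfolding y_def z_def al_def be_def by linarith
    then show False using x01 by simp
  qed
  from rounded_orbit_in_branches[of y z S, OF _ _ in_S this]
  have br: "lab \<in> branches M S l b"
    by (simp add: y_def z_def lab_def L_def mult_ac)
  obtain p q where pq: "lab = (p, q)" by (cases "lab")
  define u v where "u = L * x * al / (2 * pi)" and "v = L * x * be / (2 * pi)"
  have pu: "\<bar>real_of_int p - u\<bar> \<le> 1 / 2" and qv: "\<bar>real_of_int q - v\<bar> \<le> 1 / 2"
    using pq of_int_round_abs_le[of u] of_int_round_abs_le[of v] by (auto simp: lab_def u_def v_def)
  have "L * d * Del / (2 * pi) \<le> \<bar>u\<bar> + \<bar>v\<bar>"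
  proof -
    have "L * d * Del \<le> L * x * (\<bar>al\<bar> + \<bar>be\<bar>)"
      using x01 d L albe Del by (intro mult_mono) auto
    then have "L * d * Del / (2 * pi) \<le> L * x * (\<bar>al\<bar> + \<bar>be\<bar>) / (2 * pi)" by (intro divide_right_mono) auto
    also have "\<dots> = \<bar>u\<bar> + \<bar>v\<bar>"
      using L x01 d by (simp add: u_def v_def abs_mult distrib_left add_divide_distrib)
    finally show ?thesis .
  qed
  moreover have "\<bar>u\<bar> + \<bar>v\<bar> \<le> \<bar>real_of_int p\<bar> + \<bar>real_of_int q\<bar> + 1" using pu qv by linarith
  \<comment> \<open>Half of the lower bound absorbs the rounding error 1.\<close>
  moreover have "1 \<le> L * d * Del / (4 * pi)" using d by (simp add: L_def)
  moreover have "L * d * Del / (2 * pi) = 2 * (L * d * Del / (4 * pi))" by simp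
  ultimately have "L * d * Del / (4 * pi) \<le> \<bar>real_of_int p\<bar> + \<bar>real_of_int q\<bar>" by linarith
  then have "Del * (L * d * Del / (4 * pi)) \<le> Del * (\<bar>real_of_int p\<bar> + \<bar>real_of_int q\<bar>)"
    using Del by (intro mult_left_mono) auto
  also have "\<dots> \<le> cmod (Dif (p, q))" by (rule Dif_ge)
  finally have big: "Del\<^sup>2 * L * d / (4 * pi) \<le> cmod (Dif (p, q))" by (simp add: power2_eq_square mult_ac)
  have "Re (Dif (p, q) * e) = real_of_int p * be - real_of_int q * al"
    by (simp add: Dif_def al be left_diff_distrib mult.assoc algebra_simps)
  \<comment> \<open>The main terms cancel, as \<open>u * be = v * al\<close>.\<close>
  also have "\<dots> = (real_of_int p - u) * be - (real_of_int q - v) * al"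
    by (simp add: u_def v_def algebra_simps)
  finally have "\<bar>Re (Dif (p, q) * e)\<bar> \<le> \<bar>real_of_int p - u\<bar> * \<bar>be\<bar> + \<bar>real_of_int q - v\<bar> * \<bar>al\<bar>"
    by (metis abs_mult abs_triangle_ineq4)
  also have "\<dots> \<le> 1 / 2 * (1 / 2) + 1 / 2 * (1 / 2)"
    using pu qv al_le be_le by (intro add_mono mult_mono) auto
  finally have "\<bar>Re (Dif (p, q) * e)\<bar> \<le> 1 / 2" by simp
  then show ?thesis using br big unfolding pq L_def by blast
qed

end

section \<open>Choice of parameters\<close>

context digit_system
begin

lemma inverse_power_M_mono: "a \<le> b \<Longrightarrow> 1 / real M ^ b \<le> 1 / real M ^ a"
  using M3 by (intro divide_left_mono power_increasing) auto

lemma half_inverse_power_M: "1 / real M ^ Suc a \<le> (1 / real M ^ a) / 2"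
  using M3 by (simp add: field_simps)

text \<open>Each of the \<open>m\<close> factors is a power of \<open>1 / M\<close> with exponent
  linear in \<open>m\<close>, so the exponent of the product is quadratic. This is the origin of the
  square root of \<open>ln n\<close> in the final rate.\<close>

lemma small_value_threshold_ge:
  assumes "m \<ge> 1"
  defines "kap \<equiv> ((1 / real M ^ m) / 2) ^ (M - 1) / real M"
  shows "(kap / 2 * ((1 / real M ^ (m + l0 * m)) / 2) ^ (M - 1)) ^ m \<ge> 1 / real M ^ ((l0 + 5) * M * m\<^sup>2)"
proof -
  have "1 / real M ^ (2 * m * M) \<le> 1 / real M ^ ((m + 1) * (M - 1) + 1)"
  proof (rule inverse_power_M_mono)
    have "(m + 1) * (M - 1) \<le> (2 * m) * (M - 1)" using assms(1) by (intro mult_right_mono) auto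
    moreover have "(2 * m) * (M - 1) + 2 * m = 2 * m * M" using M3 by (cases M) auto
    ultimately show "(m + 1) * (M - 1) + 1 \<le> 2 * m * M" using assms(1) by linarith
  qed
  also have "\<dots> = (1 / real M ^ (m + 1)) ^ (M - 1) / real M"
    by (simp add: power_one_over power_mult power_add power_mult_distrib)
  also have "\<dots> \<le> kap"
    unfolding kap_def using half_inverse_power_M[of m] by (intro divide_right_mono power_mono) auto
  finally have "(1 / real M ^ (2 * m * M)) / 2 \<le> kap / 2" by simp
  then have kap: "1 / real M ^ (2 * m * M + 1) \<le> kap / 2"
    using half_inverse_power_M[of "2 * m * M"] by simp
  have h: "1 / real M ^ ((m + l0 * m + 1) * (M - 1)) \<le> ((1 / real M ^ (m + l0 * m)) / 2) ^ (M - 1)"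
    unfolding power_mult power_one_over[symmetric]
    using power_mono[OF half_inverse_power_M[of "m + l0 * m"], of "M - 1"] by (simp add: power_one_over)
  have "1 / real M ^ ((l0 + 5) * M * m) \<le> 1 / real M ^ ((2 * m * M + 1) + (m + l0 * m + 1) * (M - 1))"
  proof (rule inverse_power_M_mono)
    have "(m + l0 * m + 1) * (M - 1) \<le> ((2 + l0) * m) * M"
      using assms(1) by (intro mult_mono) (auto simp: algebra_simps)
    moreover have "1 \<le> m * M" using assms(1) M3 by simp
    ultimately have "(2 * m * M + 1) + (m + l0 * m + 1) * (M - 1) \<le> 2 * m * M + m * M + ((2 + l0) * m) * M"
      by linarith
    also have "\<dots> = (l0 + 5) * M * m" by (simp add: algebra_simps)
    finally show "(2 * m * M + 1) + (m + l0 * m + 1) * (M - 1) \<le> (l0 + 5) * M * m" .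
  qed
  also have "\<dots> = 1 / real M ^ (2 * m * M + 1) * (1 / real M ^ ((m + l0 * m + 1) * (M - 1)))"
    by (simp only: power_add times_divide_times_eq mult_1)
  also have "\<dots> \<le> kap / 2 * ((1 / real M ^ (m + l0 * m)) / 2) ^ (M - 1)"
    using kap h by (intro mult_mono) (auto simp: kap_def)
  finally have "(1 / real M ^ ((l0 + 5) * M * m)) ^ m \<le> (kap / 2 * ((1 / real M ^ (m + l0 * m)) / 2) ^ (M - 1)) ^ m"
    by (intro power_mono) auto
  then show ?thesis by (simp add: power_one_over power_mult[symmetric] power2_eq_square mult.assoc)
qed

text \<open>With \<open>psi >= M ^ (- F)\<close> and \<open>q = M ^ (2 * F + 1)\<close> blocks,
  \<open>q * psi^2\<close> is at least \<open>M\<close>, while flatness would bound it by 2. The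
  other choices are \<open>d = 1 / M ^ m\<close>, \<open>tau = M ^ (- m * M)\<close> and the cover
  radius \<open>M ^ (- m - l)\<close>.\<close>

lemma not_flat:
  assumes m: "m \<ge> 1" and big: "real M ^ m \<ge> 9 * 4 ^ M * real M"
    and sep: "separated (1 / real M ^ m)"
    and LV: "\<And>x. x \<in> {1 / real M ^ m..1} \<Longrightarrow> cmod (riesz m (m + l0 * m) x) \<le> 1 / real M ^ (m * M)"
  shows "\<not> flat (real M ^ m / 16) (M ^ (2 * ((l0 + 5) * M * m\<^sup>2) + 1) * m + m + l0 * m)"
proof
  define X where "X = real M ^ m"
  define l where "l = l0 * m"
  define h where "h = 1 / real M ^ (m + l)"
  define kap where "kap = ((1 / real M ^ m) / 2) ^ (M - 1) / real M"
  define psi where "psi = (kap / 2 * (h / 2) ^ (M - 1)) ^ m"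
  define F where "F = (l0 + 5) * M * m\<^sup>2"
  define q where "q = M ^ (2 * F + 1)"
  assume "flat (real M ^ m / 16) (M ^ (2 * ((l0 + 5) * M * m\<^sup>2) + 1) * m + m + l0 * m)"
  then have G: "flat (X / 16) (q * m + m + l)" by (simp only: X_def q_def F_def l_def)
  have X: "X > 0" "X \<ge> 1" using M3 by (auto simp: X_def)
  have h: "0 < h" "h \<le> 1" using M3 by (auto simp: h_def divide_le_eq)
  have kap: "kap > 0" using M_pos by (simp add: kap_def)
  have psi: "psi > 0" using kap h by (simp add: psi_def)
  obtain P where P: "finite P" "real (card P) \<le> 3 * 2 ^ M * real M ^ m / kap"
    "\<And>x. x \<in> {0..1} \<Longrightarrow> cmod (riesz 0 m x) < psi \<Longrightarrow> \<exists>p\<in>P. \<bar>x - p\<bar> \<le> h"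
    using small_values_cover[OF sep _ h, of m] M_pos unfolding kap_def psi_def by (metis divide_pos_pos of_nat_0_less_iff zero_less_one zero_less_power)
  have ikap: "1 / kap = real M * 2 ^ (M - 1) * X ^ (M - 1)"
    by (simp add: kap_def X_def power_divide power_mult_distrib field_simps)
  have XM: "X * X ^ (M - 1) = X ^ M" using M3 by (cases M) auto
  \<comment> \<open>The gain \<open>X ^ (2 * M)\<close> from \<open>tau\<close> beats the cover,
    whose size is of order \<open>X ^ M\<close>; the constants are absorbed by the assumed size of
    \<open>X\<close>.\<close>
  have PS: "(1 / X ^ M)\<^sup>2 * (real (card P) * (2 * h * real M ^ (m + l) + 1) * (X / 16)) \<le> X / 8"
  proof -
    have "2 * h * real M ^ (m + l) + 1 = 3" using M_pos by (simp add: h_def)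
    then have "(1 / X ^ M)\<^sup>2 * (real (card P) * (2 * h * real M ^ (m + l) + 1) * (X / 16))
        = (1 / X ^ M)\<^sup>2 * (real (card P) * (3 * (X / 16)))" by simp
    also have "\<dots> \<le> (1 / X ^ M)\<^sup>2 * ((3 * 2 ^ M * X / kap) * (3 * (X / 16)))"
      using P(2) X unfolding X_def by (intro mult_left_mono mult_right_mono) auto
    also have "3 * 2 ^ M * X / kap = 3 * 2 ^ M * X * (1 / kap)" by simp
    also have "\<dots> = 3 * 2 ^ M * real M * 2 ^ (M - 1) * X ^ M" unfolding ikap XM[symmetric] by (simp add: mult_ac)
    also have "(1 / X ^ M)\<^sup>2 * ((3 * 2 ^ M * real M * 2 ^ (M - 1) * X ^ M) * (3 * (X / 16)))
        = (9 * 2 ^ M * 2 ^ (M - 1) * real M / 2) / X ^ M * (X / 8)"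
      using X by (simp add: power2_eq_square field_simps)
    also have "\<dots> \<le> 1 * (X / 8)"
    proof (rule mult_right_mono)
      have "9 * 2 ^ M * 2 ^ (M - 1) * real M / 2 \<le> 9 * 2 ^ M * 2 ^ M * real M"
      proof -
        have "(2::real) ^ (M - 1) \<le> 2 ^ M" by (intro power_increasing) auto
        then have "9 * 2 ^ M * 2 ^ (M - 1) * real M \<le> 9 * 2 ^ M * 2 ^ M * real M"
          by (intro mult_right_mono mult_left_mono) auto
        moreover have "9 * 2 ^ M * 2 ^ (M - 1) * real M \<ge> 0" by simp
        ultimately show ?thesis by linarith
      qed
      also have "\<dots> = 9 * 4 ^ M * real M" by (simp add: power_mult_distrib[symmetric])
      also have "\<dots> \<le> X" using big by (simp add: X_def)
      also have "\<dots> \<le> X ^ M" using X M3 power_increasing[of 1 M X] by simp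
      finally show "(9 * 2 ^ M * 2 ^ (M - 1) * real M / 2) / X ^ M \<le> 1" using X by simp
    qed (use X in simp)
    finally show ?thesis by simp
  qed
  have tau: "1 / X ^ M = 1 / real M ^ (m * M)" by (simp add: X_def power_mult)
  have "real q * psi\<^sup>2 * real M ^ m \<le> 32 * (X / 16)"
  proof (rule blocks_contradiction[OF G, of q m m l "1 / X" "1 / X ^ M" P h psi])
    show "(1 / X * real M ^ m + 1) * (X / 16) \<le> real M ^ m / 8" using X by (simp add: X_def[symmetric])
    show "cmod (riesz m (m + l) x) \<le> 1 / X ^ M" if "x \<in> {1 / X..1}" for x
      using LV[of x] that unfolding tau by (simp add: X_def l_def)
    show "(1 / X ^ M)\<^sup>2 * (real (card P) * (2 * h * real M ^ (m + l) + 1) * (X / 16)) \<le> real M ^ m / 8"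
      using PS by (simp add: X_def)
  qed (use X h P psi in \<open>auto simp: X_def\<close>)
  then have "real q * psi\<^sup>2 * X \<le> 2 * X" by (simp add: X_def)
  then have "real q * psi\<^sup>2 \<le> 2" using X by (simp only: mult_le_cancel_right_pos)
  moreover have "real M \<le> real q * psi\<^sup>2"
  proof -
    have "psi \<ge> 1 / real M ^ F"
      using small_value_threshold_ge[OF m, of l0] unfolding psi_def kap_def h_def l_def F_def .
    then have "(1 / real M ^ F)\<^sup>2 \<le> psi\<^sup>2" by (intro power_mono) auto
    then have "real q * (1 / real M ^ F)\<^sup>2 \<le> real q * psi\<^sup>2" by (intro mult_left_mono) auto
    moreover have "real q * (1 / real M ^ F)\<^sup>2 = real M"
      using M_pos by (simp add: q_def power_one_over power_mult[symmetric] power_add mult.commute)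
    ultimately show ?thesis by simp
  qed
  ultimately show False using M3 by simp
qed

text \<open>Since \<open>240 * t = X / 16\<close>, the failure of flatness yields the large
  alternative at level \<open>N\<close>. The decay then runs for \<open>k = M ^ (2 * m + 2)\<close>
  rounds, enough to bring the geometric term below \<open>2 / X\<close>; the assumed exponent for
  \<open>n\<close> accounts for \<open>k * N\<close>.\<close>

lemma shadow_length_small:
  assumes m: "m \<ge> 1" and big: "real M ^ m \<ge> 9 * 4 ^ M * real M" "real M ^ m > 3840"
    and sep: "separated (1 / real M ^ m)"
    and LV: "\<And>x. x \<in> {1 / real M ^ m..1} \<Longrightarrow> cmod (riesz m (m + l0 * m) x) \<le> 1 / real M ^ (m * M)"
    and n: "n \<ge> M ^ ((2 * ((l0 + 5) * M) + l0 + 8) * m\<^sup>2)"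
  shows "shadow_length n \<le> 57602 / real M ^ m"
proof -
  define X where "X = real M ^ m"
  define t where "t = X / 3840"
  define F where "F = (l0 + 5) * M * m\<^sup>2"
  define N where "N = M ^ (2 * F + 1) * m + m + l0 * m"
  define k where "k = M ^ (2 * m + 2)"
  have X: "X > 3840" using big by (simp add: X_def)
  have t: "t > 1" using X by (simp add: t_def)
  have "\<not> flat (240 * t) N" using not_flat[OF m big(1) sep LV] by (simp add: t_def X_def N_def F_def)
  then have large: "8 * (real M)\<^sup>2 * t\<^sup>2 * real (card (stop_set M (heavy t) N)) > real M ^ N"
    using flat_if_light[OF t, of N] by linarith
  have "k * N \<le> n"
  proof -
    have pow: "r \<le> M ^ r" for r
    proof (induction r)
      case (Suc r)
      have "1 \<le> M ^ r" using M_pos by simp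
      then have "Suc r \<le> M ^ r + M ^ r" using Suc by linarith
      also have "\<dots> = 2 * M ^ r" by simp
      also have "\<dots> \<le> M * M ^ r" using M3 by (intro mult_right_mono) auto
      finally show ?case by simp
    qed simp
    have "N \<le> M ^ (2 * F + 1) * m + M ^ (2 * F + 1) * (m + l0 * m)"
      unfolding N_def using M_pos by simp
    also have "\<dots> = M ^ (2 * F + 1) * ((l0 + 2) * m)" by (simp add: algebra_simps)
    also have "\<dots> \<le> M ^ (2 * F + 1) * (M ^ (l0 + 2) * M ^ m)"
      using pow[of "l0 + 2"] pow[of m] by (intro mult_left_mono mult_mono) auto
    finally have "k * N \<le> M ^ (2 * m + 2) * (M ^ (2 * F + 1) * (M ^ (l0 + 2) * M ^ m))"
      unfolding k_def by (intro mult_left_mono) auto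
    also have "\<dots> = M ^ (2 * m + 2 + (2 * F + 1 + (l0 + 2 + m)))" by (simp only: power_add)
    also have "\<dots> \<le> M ^ ((2 * ((l0 + 5) * M) + l0 + 8) * m\<^sup>2)"
    proof (rule power_increasing)
      have m2: "m \<le> m\<^sup>2" "1 \<le> m\<^sup>2" using m by (auto simp: power2_eq_square)
      define B w where "B = (l0 + 5) * m\<^sup>2" and "w = m\<^sup>2"
      have "(l0 + 5) * 1 \<le> B" unfolding B_def using m2 by (intro mult_left_mono) auto
      moreover have "m \<le> w" using m2 by (simp add: w_def)
      ultimately have "2 * m + 2 + (2 * F + 1 + (l0 + 2 + m)) \<le> 2 * F + B + 3 * w"
        by simp
      also have "\<dots> = (2 * ((l0 + 5) * M) + l0 + 8) * m\<^sup>2" by (simp add: F_def B_def w_def algebra_simps)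
      finally show "2 * m + 2 + (2 * F + 1 + (l0 + 2 + m)) \<le> (2 * ((l0 + 5) * M) + l0 + 8) * m\<^sup>2" .
    qed (use M3 in simp)
    finally show ?thesis using n by linarith
  qed
  then have "shadow_length n \<le> 15 / t + 2 * (1 - 1 / (200 * (real M)\<^sup>2 * t)) ^ k"
    by (rule shadow_length_decay[OF t large])
  moreover have "(1 - 1 / (200 * (real M)\<^sup>2 * t)) ^ k \<le> 1 / X"
  proof -
    define p0 where "p0 = 1 / (200 * (real M)\<^sup>2 * t)"
    have M2: "(real M)\<^sup>2 \<ge> 1" using M3 by simp
    have "1 * 1 \<le> (200 * (real M)\<^sup>2) * t" using M2 t by (intro mult_mono) auto
    then have "1 \<le> 200 * (real M)\<^sup>2 * t" by simp
    have inv_le_1: "1 / D \<le> 1" if "1 \<le> D" for D :: real using that by simp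
    have p0: "0 \<le> p0" "p0 \<le> 1" unfolding p0_def using \<open>1 \<le> 200 * (real M)\<^sup>2 * t\<close> t
      by (simp, intro inv_le_1)
    have kX: "real k = (real M)\<^sup>2 * X\<^sup>2"
      unfolding k_def X_def power_mult[symmetric] power_add of_nat_mult of_nat_power
      by (simp only: mult.commute)
    have "real k * p0 = X * (3840 / 200)"
      using M_pos X unfolding kX p0_def t_def by (simp add: power2_eq_square field_simps)
    then have kp: "X \<le> real k * p0" using X by simp
    have "X \<le> exp X" using exp_ge_add_one_self[of X] by linarith
    have "(1 - p0) ^ k \<le> exp (- p0) ^ k"
      using p0 exp_ge_add_one_self[of "- p0"] by (intro power_mono) auto
    also have "\<dots> = exp (- (real k * p0))" by (simp add: exp_of_nat_mult[symmetric])
    also have "\<dots> \<le> exp (- X)" using kp by simp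
    also have "\<dots> = 1 / exp X" by (simp add: exp_minus divide_inverse)
    also have "\<dots> \<le> 1 / X" using \<open>X \<le> exp X\<close> X by (intro divide_left_mono) auto
    finally show ?thesis by (simp add: p0_def)
  qed
  moreover have "15 / t = 57600 / X" using X by (simp add: t_def)
  ultimately have "shadow_length n \<le> 57600 / X + 2 * (1 / X)" by linarith
  also have "\<dots> = 57602 / X" by (simp add: add_divide_distrib[symmetric])
  finally show ?thesis by (simp add: X_def)
qed

end

section \<open>Averaging over directions\<close>

definition thin :: "complex \<Rightarrow> real \<Rightarrow> real set" where
  "thin D t = {0..<pi} \<inter> {\<theta>. \<bar>Re (D * cis (- \<theta>))\<bar> \<le> t}"

lemma thin_sets: "thin D t \<in> sets borel"
proof -
  have "closed {\<theta>. \<bar>Re (D * cis (- \<theta>))\<bar> \<le> t}"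
    by (intro closed_Collect_le continuous_intros)
  then show ?thesis unfolding thin_def by (intro sets.Int) (auto intro: borel_closed)
qed

lemma integrable_thin: "integrable lborel (indicator (thin D t) :: real \<Rightarrow> real)"
proof -
  have "emeasure lborel (thin D t) \<le> emeasure lborel {0..pi}"
    using thin_sets by (intro emeasure_mono) (auto simp: thin_def)
  then have "emeasure lborel (thin D t) < \<infinity>" using pi_ge_zero by (auto intro: order.strict_trans1)
  then show ?thesis using thin_sets by (intro integrable_real_indicator) auto
qed

lemma integral_thin_le: "D \<noteq> 0 \<Longrightarrow> t \<ge> 0 \<Longrightarrow> integral\<^sup>L lborel (indicator (thin D t)) \<le> 20 * t / cmod D"
  using measure_small_projection[of D t] by (simp add: thin_def)

definition digits_at :: "(nat \<Rightarrow> complex) \<Rightarrow> real \<Rightarrow> nat \<Rightarrow> real" where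
  "digits_at C \<theta> j = Re (C j * cis (- \<theta>))"

lemma digit_system_digits_at:
  assumes "M \<ge> 3" "\<And>j. j < M \<Longrightarrow> cmod (C j) \<le> 1 / 4"
  shows "digit_system M (digits_at C \<theta>)"
proof
  fix j assume "j < M"
  have "\<bar>Re (C j * cis (- \<theta>))\<bar> \<le> cmod (C j * cis (- \<theta>))" by (rule abs_Re_le_cmod)
  then show "\<bar>digits_at C \<theta> j\<bar> \<le> 1 / 4"
    using assms(2)[OF \<open>j < M\<close>] by (simp add: digits_at_def norm_mult)
qed (rule assms(1))

text \<open>Avoiding the thin sets of digit differences separates the projected digits; avoiding
  those of the long branch vectors rules out large values of the middle block.\<close>

lemma shadow_length_outside_thin:
  fixes C :: "nat \<Rightarrow> complex" and M m l0 b :: nat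
  assumes M: "M \<ge> 3" and C: "\<And>j. j < M \<Longrightarrow> cmod (C j) \<le> 1 / 4"
    and j: "j0 < M" "j1 < M" "j2 < M"
  defines "d1 \<equiv> C j1 - C j0" and "d2 \<equiv> C j2 - C j0"
  defines "Del \<equiv> \<bar>Im (cnj d1 * d2)\<bar>"
  assumes Del: "Del > 0" and b: "digit_system.contraction M ^ b \<le> 1 / real M ^ (m * M)"
    and m: "m \<ge> 1" and big: "real M ^ m \<ge> 9 * 4 ^ M * real M" "real M ^ m > 3840"
      "4 * pi \<le> real M ^ (l0 * m) * Del"
  defines "Dif \<equiv> \<lambda>(p, q). of_int p * d2 - of_int q * d1"
    and "S \<equiv> {- (int M ^ m)..int M ^ m} \<times> {- (int M ^ m)..int M ^ m}"
  defines "R \<equiv> {c \<in> branches M S (l0 * m) b. Del\<^sup>2 * real M ^ (l0 * m) / (4 * pi) \<le> cmod (Dif c)}"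
  assumes th: "\<theta> \<in> {0..<pi}"
    and out1: "\<And>c. c \<in> R \<Longrightarrow> \<theta> \<notin> thin (Dif c) (1 / 2)"
    and out2: "\<And>i j. i < M \<Longrightarrow> j < M \<Longrightarrow> i \<noteq> j \<Longrightarrow> \<theta> \<notin> thin (C i - C j) (1 / real M ^ m)"
    and n: "n \<ge> M ^ ((2 * ((l0 + 5) * M) + l0 + 8) * m\<^sup>2)"
  shows "digit_system.shadow_length M (digits_at C \<theta>) n \<le> 57602 / real M ^ m"
proof -
  interpret digit_system M "digits_at C \<theta>" using M C by (rule digit_system_digits_at)
  show ?thesis
  proof (rule shadow_length_small[OF m big(1,2) _ _ n])
    show "separated (1 / real M ^ m)"
      unfolding separated_def
    proof (intro allI impI)
      fix i j assume "i < M" "j < M" "i \<noteq> j"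
      then have "\<theta> \<notin> thin (C i - C j) (1 / real M ^ m)" by (rule out2)
      then show "1 / real M ^ m \<le> \<bar>digits_at C \<theta> i - digits_at C \<theta> j\<bar>"
        using th by (simp add: thin_def digits_at_def left_diff_distrib)
    qed
    fix x assume x: "x \<in> {1 / real M ^ m..1}"
    show "cmod (riesz m (m + l0 * m) x) \<le> 1 / real M ^ (m * M)"
    proof (rule ccontr)
      assume "\<not> cmod (riesz m (m + l0 * m) x) \<le> 1 / real M ^ (m * M)"
      then have gt: "cmod (riesz m (m + l0 * m) x) > 1 / real M ^ (m * M)" by simp
      have e: "real M ^ (m + l0 * m) * (1 / real M ^ m) = real M ^ (l0 * m)"
        using M_pos by (simp add: power_add)
      have "\<exists>c\<in>branches M S (l0 * m) b.
          Del\<^sup>2 * real M ^ (m + l0 * m) * (1 / real M ^ m) / (4 * pi) \<le> cmod (Dif c) \<and> \<bar>Re (Dif c * cis (- \<theta>))\<bar> \<le> 1 / 2"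
        unfolding Dif_def S_def Del_def d1_def d2_def
      proof (rule large_value_hit[OF _ C _ j _ b _ _ x gt])
        show "digits_at C \<theta> j = Re (C j * cis (- \<theta>))" for j by (simp add: digits_at_def)
        show "0 < \<bar>Im (cnj (C j1 - C j0) * (C j2 - C j0))\<bar>"
          using Del by (simp add: Del_def d1_def d2_def)
        show "4 * pi \<le> real M ^ (m + l0 * m) * (1 / real M ^ m) * \<bar>Im (cnj (C j1 - C j0) * (C j2 - C j0))\<bar>"
          using big(3) unfolding e by (simp add: Del_def d1_def d2_def)
      qed (use M_pos in auto)
      then obtain c where c: "c \<in> branches M S (l0 * m) b"
          "Del\<^sup>2 * real M ^ (m + l0 * m) * (1 / real M ^ m) / (4 * pi) \<le> cmod (Dif c)"
          "\<bar>Re (Dif c * cis (- \<theta>))\<bar> \<le> 1 / 2" by blast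
      have "c \<in> R" unfolding R_def using c(1) c(2)[unfolded mult.assoc[of "Del\<^sup>2"] e] by blast
      moreover have "\<theta> \<in> thin (Dif c) (1 / 2)" using th c(3) by (simp add: thin_def)
      ultimately show False using out1 by blast
    qed
  qed
qed

text \<open>Exceptional directions have total measure of order \<open>1 / M ^ m\<close> and are
  charged the trivial bound 2; elsewhere the length itself is of that order. The integrable majorant
  \<open>g\<close> adds up these contributions.\<close>

lemma shadow_length_average:
  fixes C :: "nat \<Rightarrow> complex" and M :: nat
  assumes M: "M \<ge> 3" and Cs: "\<forall>j<M. cmod (C j) \<le> 1 / 4" and inj: "inj_on C {..<M}"
    and j: "j0 < M" "j1 < M" "j2 < M"
    and indep: "Im (cnj (C j1 - C j0) * (C j2 - C j0)) \<noteq> 0"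
  shows "\<exists>(K :: real) (E :: nat) (m0 :: nat). \<forall>m n. m \<ge> m0 \<longrightarrow> n \<ge> M ^ (E * m\<^sup>2) \<longrightarrow>
    (\<exists>g. integrable lborel g \<and> integral\<^sup>L lborel g \<le> K / real M ^ m \<and>
      (\<forall>\<theta>\<in>{0..<pi}. digit_system.shadow_length M (digits_at C \<theta>) n \<le> g \<theta>) \<and> (\<forall>\<theta>. 0 \<le> g \<theta>))"
proof -
  have C: "cmod (C j) \<le> 1 / 4" if "j < M" for j using Cs that by blast
  \<comment> \<open>As \<open>contraction\<close> depends on \<open>M\<close> alone, zero digits
    give access to it before a direction is fixed.\<close>
  interpret z: digit_system M "\<lambda>_. 0" by standard (use M in auto)
  define d1 d2 where "d1 = C j1 - C j0" and "d2 = C j2 - C j0"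
  define Del where "Del = \<bar>Im (cnj d1 * d2)\<bar>"
  have Del: "Del > 0" using indep by (simp add: Del_def d1_def d2_def)
  define V where "V = real ((2 * M + 1)\<^sup>2)"
  have V: "V \<ge> 1" unfolding V_def by (simp add: power2_eq_square)
  have M1: "real M \<ge> 3" using M by simp
  \<comment> \<open>Allowing \<open>b0 * m\<close> far indices, any more of them push the middle
    block below \<open>M ^ (- m * M)\<close>.\<close>
  obtain b0 where b0: "z.contraction ^ b0 < 1 / real M ^ M"
    using real_arch_pow_inv[of "1 / real M ^ M" z.contraction] z.contraction_bounds M by auto
  \<comment> \<open>The block is then made so long that its \<open>V ^ b * 2 ^ l\<close> branches
    lose against vectors of length \<open>M ^ l\<close>. Here \<open>2 / M <= 2 / 3\<close>, and
    \<open>M ^ 3\<close> pays for the order of \<open>X^2\<close> starting pairs and one further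
    factor \<open>X\<close>.\<close>
  obtain l0 where l0: "(2 / 3) ^ l0 < 1 / (real M ^ 3 * V ^ b0)"
    using real_arch_pow_inv[of "1 / (real M ^ 3 * V ^ b0)" "2 / 3"] V M by auto
  have l0_pos: "l0 \<ge> 1"
  proof (rule ccontr)
    assume "\<not> l0 \<ge> 1"
    then have "1 < 1 / (real M ^ 3 * V ^ b0)" using l0 by (simp add: not_le)
    moreover have "1 * 1 \<le> real M ^ 3 * V ^ b0" using M1 V by (intro mult_mono one_le_power) auto
    ultimately show False by (simp add: less_divide_eq)
  qed
  define K1 where "K1 = (\<Sum>(i, j) | i < M \<and> j < M \<and> i \<noteq> j. 20 / cmod (C i - C j))"
  define K where "K = pi * 57602 + 2 * (360 * pi / Del\<^sup>2 + K1)"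
  define E where "E = 2 * ((l0 + 5) * M) + l0 + 8"
  \<comment> \<open>The entries secure, in turn, the cover constants, \<open>t > 1\<close>, and a
    middle block long enough for the branch vectors to outgrow rounding.\<close>
  define B where "B = max (9 * 4 ^ M * real M) (max 3841 (4 * pi / Del))"
  define m0 where "m0 = nat \<lceil>B\<rceil>"
  show ?thesis
  proof (rule exI[of _ K], rule exI[of _ E], rule exI[of _ m0], intro allI impI)
    fix m n assume m: "m \<ge> m0" and n: "n \<ge> M ^ (E * m\<^sup>2)"
    define X where "X = real M ^ m"
    define l where "l = l0 * m"
    define b where "b = b0 * m"
    have "real m < X"
      using of_nat_less_two_power[of m, where ?'a = real] power_mono[of 2 "real M" m] M1 unfolding X_def by linarith
    moreover have "B \<le> real m" using m unfolding m0_def by linarith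
    ultimately have BX: "B \<le> X" by linarith
    then have big: "X \<ge> 9 * 4 ^ M * real M" "X > 3840" "4 * pi / Del \<le> X" by (auto simp: B_def)
    have m1: "m \<ge> 1" using \<open>B \<le> real m\<close> by (auto simp: B_def)
    have X: "X > 0" using big by linarith
    define Dif where "Dif = (\<lambda>(p :: int, q :: int). of_int p * d2 - of_int q * d1)"
    define S where "S = {- (int M ^ m)..int M ^ m} \<times> {- (int M ^ m)..int M ^ m}"
    define D0 where "D0 = Del\<^sup>2 * real M ^ l / (4 * pi)"
    define R where "R = {c \<in> branches M S l b. D0 \<le> cmod (Dif c)}"
    define Q where "Q = {(i, j). i < M \<and> j < M \<and> i \<noteq> j}"
    have D0: "D0 > 0" using Del M by (simp add: D0_def)
    have finS: "finite S" by (simp add: S_def)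
    have finR: "finite R" unfolding R_def by (rule finite_subset[OF Collect_restrict finite_branches[OF finS]])
    have finQ: "finite Q"
      by (rule finite_subset[of _ "{..<M} \<times> {..<M}"]) (auto simp: Q_def)
    define f where "f = (\<lambda>\<theta>. 57602 / X * indicator {0..<pi} \<theta>)"
    define g1 where "g1 = (\<lambda>\<theta>. \<Sum>c\<in>R. indicator (thin (Dif c) (1 / 2)) \<theta> :: real)"
    define g2 where "g2 = (\<lambda>\<theta>. \<Sum>p\<in>Q. indicator (thin (C (fst p) - C (snd p)) (1 / X)) \<theta> :: real)"
    define g where "g = (\<lambda>\<theta>. f \<theta> + 2 * (g1 \<theta> + g2 \<theta>))"
    have int: "integrable lborel f" "integrable lborel g1" "integrable lborel g2"
      unfolding f_def g1_def g2_def
      by (auto intro!: Bochner_Integration.integrable_sum integrable_thin integrable_mult_right integrable_real_indicator)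
    have intf: "integral\<^sup>L lborel f = pi * 57602 / X"
      by (simp add: f_def)
    have g1_le: "integral\<^sup>L lborel g1 \<le> 360 * pi / Del\<^sup>2 / X"
    proof -
      have "integral\<^sup>L lborel g1 = (\<Sum>c\<in>R. integral\<^sup>L lborel (indicator (thin (Dif c) (1 / 2))))"
        unfolding g1_def by (rule Bochner_Integration.integral_sum[OF integrable_thin])
      also have "\<dots> \<le> (\<Sum>c\<in>R. 10 / D0)"
      proof (rule sum_mono)
        fix c assume "c \<in> R"
        then have c: "D0 \<le> cmod (Dif c)" by (simp add: R_def)
        then have "Dif c \<noteq> 0" using D0 by auto
        then have "integral\<^sup>L lborel (indicator (thin (Dif c) (1 / 2))) \<le> 20 * (1 / 2) / cmod (Dif c)"
          by (intro integral_thin_le) auto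
        also have "\<dots> \<le> 10 / D0" using c D0 by (simp add: frac_le)
        finally show "integral\<^sup>L lborel (indicator (thin (Dif c) (1 / 2))) \<le> 10 / D0" .
      qed
      also have "\<dots> = real (card R) * (10 / D0)" by simp
      also have "\<dots> \<le> (9 * X\<^sup>2 * V ^ b * 2 ^ l) * (10 / D0)"
      proof (rule mult_right_mono)
        have "card R \<le> card (branches M S l b)"
          unfolding R_def by (intro card_mono finite_branches finS) auto
        also have "\<dots> \<le> card S * ((2 * M + 1)\<^sup>2) ^ b * 2 ^ l" by (rule card_branches_le[OF finS])
        finally have "real (card R) \<le> real (card S * ((2 * M + 1)\<^sup>2) ^ b * 2 ^ l)" by (rule of_nat_mono)
        also have "\<dots> = real (card S) * V ^ b * 2 ^ l" by (simp add: V_def)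
        also have "real (card S) \<le> 9 * X\<^sup>2"
        proof -
          have "card {- (int M ^ m)..int M ^ m} = 2 * M ^ m + 1"
            by (simp add: nat_add_distrib nat_power_eq nat_mult_distrib)
          then have "real (card {- (int M ^ m)..int M ^ m}) = 2 * X + 1" by (simp add: X_def)
          then have "real (card S) = (2 * X + 1)\<^sup>2"
            by (simp only: S_def card_cartesian_product power2_eq_square of_nat_mult)
          also have "\<dots> \<le> (3 * X)\<^sup>2" using big by (intro power_mono) auto
          finally show ?thesis by (simp add: power_mult_distrib)
        qed
        finally show "real (card R) \<le> 9 * X\<^sup>2 * V ^ b * 2 ^ l" using V by (simp add: mult_right_mono)
      qed (use D0 in simp)
      also have "\<dots> = 360 * pi / Del\<^sup>2 * (X\<^sup>2 * V ^ b * (2 / real M) ^ l)"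
        using Del M1 by (simp add: D0_def power_divide field_simps)
      also have "\<dots> \<le> 360 * pi / Del\<^sup>2 * (1 / X)"
      proof (rule mult_left_mono)
        have "real M ^ 3 * V ^ b0 * (2 / real M) ^ l0 \<le> real M ^ 3 * V ^ b0 * (2 / 3) ^ l0"
          using M1 V by (intro mult_left_mono power_mono divide_left_mono) auto
        also have "\<dots> \<le> 1" using l0 M1 V by (simp add: field_simps)
        finally have "(real M ^ 3 * V ^ b0 * (2 / real M) ^ l0) ^ m \<le> 1"
          using M1 V by (intro power_le_one) auto
        then have "X ^ 3 * V ^ b * (2 / real M) ^ l \<le> 1"
          by (simp add: X_def b_def l_def power_mult_distrib power_mult[symmetric] mult.commute)
        then show "X\<^sup>2 * V ^ b * (2 / real M) ^ l \<le> 1 / X"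
          using X by (simp add: le_divide_eq power2_eq_square power3_eq_cube mult_ac)
      qed simp
      finally show ?thesis by simp
    qed
    have g2_le: "integral\<^sup>L lborel g2 \<le> K1 / X"
    proof -
      have "integral\<^sup>L lborel g2 = (\<Sum>p\<in>Q. integral\<^sup>L lborel (indicator (thin (C (fst p) - C (snd p)) (1 / X))))"
        unfolding g2_def by (rule Bochner_Integration.integral_sum[OF integrable_thin])
      also have "\<dots> \<le> (\<Sum>p\<in>Q. 20 / cmod (C (fst p) - C (snd p)) / X)"
      proof (rule sum_mono)
        fix p assume "p \<in> Q"
        then have "C (fst p) - C (snd p) \<noteq> 0" using inj by (auto simp: Q_def inj_on_def)
        from integral_thin_le[OF this, of "1 / X"] X
        show "integral\<^sup>L lborel (indicator (thin (C (fst p) - C (snd p)) (1 / X))) \<le> 20 / cmod (C (fst p) - C (snd p)) / X"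
          by (simp add: mult.commute)
      qed
      also have "\<dots> = K1 / X" unfolding K1_def Q_def[symmetric] by (simp add: sum_divide_distrib case_prod_beta)
      finally show ?thesis .
    qed
    have nonneg: "0 \<le> f \<theta>" "0 \<le> g1 \<theta>" "0 \<le> g2 \<theta>" for \<theta>
      using X unfolding f_def g1_def g2_def by (auto intro!: sum_nonneg)
    have bound: "digit_system.shadow_length M (digits_at C \<theta>) n \<le> g \<theta>" if th: "\<theta> \<in> {0..<pi}" for \<theta>
    proof (cases "(\<exists>c\<in>R. \<theta> \<in> thin (Dif c) (1 / 2)) \<or> (\<exists>p\<in>Q. \<theta> \<in> thin (C (fst p) - C (snd p)) (1 / X))")
      case True
      have "1 \<le> g1 \<theta> + g2 \<theta>"
        using True
      proof (elim disjE bexE)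
        fix c assume c: "c \<in> R" "\<theta> \<in> thin (Dif c) (1 / 2)"
        have "indicator (thin (Dif c) (1 / 2)) \<theta> \<le> g1 \<theta>"
          unfolding g1_def using c finR by (intro member_le_sum) auto
        then show ?thesis using c nonneg(3)[of \<theta>] by simp
      next
        fix p assume p: "p \<in> Q" "\<theta> \<in> thin (C (fst p) - C (snd p)) (1 / X)"
        have "indicator (thin (C (fst p) - C (snd p)) (1 / X)) \<theta> \<le> g2 \<theta>"
          unfolding g2_def using p finQ by (intro member_le_sum[where f = "\<lambda>p. indicator (thin (C (fst p) - C (snd p)) (1 / X)) \<theta>"]) auto
        then show ?thesis using p nonneg(2)[of \<theta>] by simp
      qed
      moreover have "digit_system.shadow_length M (digits_at C \<theta>) n \<le> 2"
        by (rule digit_system.shadow_length_le_2[OF digit_system_digits_at[OF M C]])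
      ultimately show ?thesis using nonneg(1)[of \<theta>] unfolding g_def by argo
    next
      case False
      have con: "z.contraction ^ b \<le> 1 / real M ^ (m * M)"
      proof -
        have "z.contraction ^ b = (z.contraction ^ b0) ^ m" by (simp add: b_def power_mult)
        also have "\<dots> \<le> (1 / real M ^ M) ^ m" using b0 z.contraction_bounds by (intro power_mono) auto
        finally show ?thesis by (simp add: power_one_over power_mult[symmetric] mult.commute)
      qed
      have lbig: "4 * pi \<le> real M ^ (l0 * m) * Del"
      proof -
        have "4 * pi \<le> X * Del" using big(3) Del by (simp add: field_simps)
        also have "\<dots> \<le> real M ^ (l0 * m) * Del"
          unfolding X_def using l0_pos M1 Del by (intro mult_right_mono power_increasing) auto
        finally show ?thesis .
      qed
      have "digit_system.shadow_length M (digits_at C \<theta>) n \<le> 57602 / real M ^ m"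
      proof (rule shadow_length_outside_thin[OF M C j _ con m1 _ _ _ th])
        show "0 < \<bar>Im (cnj (C j1 - C j0) * (C j2 - C j0))\<bar>" using indep by simp
        show "real M ^ m \<ge> 9 * 4 ^ M * real M" "real M ^ m > 3840" using big by (auto simp: X_def)
        show "4 * pi \<le> real M ^ (l0 * m) * \<bar>Im (cnj (C j1 - C j0) * (C j2 - C j0))\<bar>"
          using lbig by (simp add: Del_def d1_def d2_def)
        show "\<theta> \<notin> thin ((\<lambda>(p, q). of_int p * (C j2 - C j0) - of_int q * (C j1 - C j0)) c) (1 / 2)"
          if "c \<in> {c \<in> branches M ({- (int M ^ m)..int M ^ m} \<times> {- (int M ^ m)..int M ^ m}) (l0 * m) b.
            \<bar>Im (cnj (C j1 - C j0) * (C j2 - C j0))\<bar>\<^sup>2 * real M ^ (l0 * m) / (4 * pi)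
              \<le> cmod ((\<lambda>(p, q). of_int p * (C j2 - C j0) - of_int q * (C j1 - C j0)) c)}" for c
          using that False unfolding R_def D0_def S_def Dif_def Del_def d1_def d2_def l_def by blast
        show "\<theta> \<notin> thin (C i - C j) (1 / real M ^ m)" if "i < M" "j < M" "i \<noteq> j" for i j
          using that False unfolding Q_def X_def by force
        show "n \<ge> M ^ ((2 * ((l0 + 5) * M) + l0 + 8) * m\<^sup>2)" using n by (simp add: E_def)
      qed
      also have "\<dots> = f \<theta>" using th by (simp add: f_def X_def)
      also have "\<dots> \<le> g \<theta>" using nonneg[of \<theta>] by (simp add: g_def)
      finally show ?thesis .
    qed
    show "\<exists>g. integrable lborel g \<and> integral\<^sup>L lborel g \<le> K / real M ^ m \<and>
      (\<forall>\<theta>\<in>{0..<pi}. digit_system.shadow_length M (digits_at C \<theta>) n \<le> g \<theta>) \<and> (\<forall>\<theta>. 0 \<le> g \<theta>)"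
    proof (intro exI[of _ g] conjI ballI allI bound)
      show "integrable lborel g" unfolding g_def using int by auto
      have "integral\<^sup>L lborel g = integral\<^sup>L lborel f + 2 * (integral\<^sup>L lborel g1 + integral\<^sup>L lborel g2)"
        unfolding g_def using int by simp
      also have "\<dots> \<le> pi * 57602 / X + 2 * (360 * pi / Del\<^sup>2 / X + K1 / X)"
        using intf g1_le g2_le by (intro add_mono mult_left_mono) auto
      also have "\<dots> = K / X" by (simp add: K_def add_divide_distrib)
      finally show "integral\<^sup>L lborel g \<le> K / real M ^ m" by (simp add: X_def)
      show "0 \<le> g \<theta>" for \<theta> using nonneg[of \<theta>] by (simp add: g_def)
    qed
  qed
qed

section \<open>From the planar sets to words, and the final estimate\<close>

lemma scaled_proj_word_map:
  fixes c C :: "nat \<Rightarrow> complex"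
  assumes M: "M > 0" and C: "\<And>j. C j = of_real (r * real M) * c j" and T: "\<And>j z. T j z = z / of_nat M + c j"
    and dig: "digit_system M (digits_at C \<theta>)"
  shows "r * real M ^ length w * proj \<theta> (word_map T w z)
    = r * proj \<theta> z + digit_system.pos M (digits_at C \<theta>) w"
proof (induction w)
  case Nil
  show ?case by (simp add: word_map_def digit_system.pos.simps[OF dig])
next
  case (Cons j w)
  have step: "word_map T (j # w) z = word_map T w z / of_nat M + c j" by (simp add: word_map_def T)
  have lin: "proj \<theta> (x / of_nat M + y) = proj \<theta> x / real M + proj \<theta> y" for x y
    by (simp add: proj_def distrib_right del: times_complex.sel)
  have dg: "digits_at C \<theta> j = r * real M * proj \<theta> (c j)"
  proof -
    have re: "Re (of_real s * z) = s * Re z" for s z by simp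
    have "C j * cis (- \<theta>) = of_real (r * real M) * (c j * exp (- \<i> * complex_of_real \<theta>))"
      by (simp add: C cis_conv_exp mult.assoc)
    then show ?thesis unfolding digits_at_def proj_def by (simp only: re)
  qed
  have "r * real M ^ length (j # w) * proj \<theta> (word_map T (j # w) z)
      = r * real M ^ length w * proj \<theta> (word_map T w z) + real M ^ length w * (r * real M * proj \<theta> (c j))"
    using M unfolding step lin by (simp add: field_simps)
  then show ?case unfolding Cons digit_system.pos.simps[OF dig] dg by simp
qed

text \<open>After scaling by \<open>r * M ^ n\<close> the cylinder of a word projects within
  distance 1 of its position, because \<open>r\<close> shrinks \<open>U\<close> into the closed unit
  disc.\<close>

lemma measure_proj_gen_set_le:
  fixes c C :: "nat \<Rightarrow> complex"
  assumes M: "M > 0" and C: "\<And>j. C j = of_real (r * real M) * c j" and T: "\<And>j z. T j z = z / of_nat M + c j"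
    and dig: "digit_system M (digits_at C \<theta>)"
    and r: "r > 0" "\<And>z. z \<in> U \<Longrightarrow> r * cmod z \<le> 1"
  shows "measure lebesgue (proj \<theta> ` gen_set M T U n)
    \<le> digit_system.shadow_length M (digits_at C \<theta>) n / r"
proof -
  interpret digit_system M "digits_at C \<theta>" by (rule dig)
  define a where "a = 1 / (r * real M ^ n)"
  have a: "a > 0" using r M by (simp add: a_def)
  have sub: "proj \<theta> ` gen_set M T U n \<subseteq> (\<lambda>x. a * x) ` shadow n"
  proof
    fix y assume "y \<in> proj \<theta> ` gen_set M T U n"
    then obtain w z where w: "length w = n" "set w \<subseteq> {..<M}" and z: "z \<in> U" and y: "y = proj \<theta> (word_map T w z)"
      by (auto simp: gen_set_def)
    have eq: "r * real M ^ n * y = r * proj \<theta> z + pos w"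
      using scaled_proj_word_map[OF M C T dig, where w = w and z = z] w y by simp
    have "\<bar>proj \<theta> z\<bar> \<le> cmod z"
    proof -
      have "\<bar>proj \<theta> z\<bar> \<le> cmod (z * exp (- \<i> * complex_of_real \<theta>))" unfolding proj_def by (rule abs_Re_le_cmod)
      also have "\<dots> = cmod z" by (simp add: norm_mult)
      finally show ?thesis .
    qed
    then have "\<bar>r * proj \<theta> z\<bar> \<le> r * cmod z" using r by (simp add: abs_mult)
    also have "\<dots> \<le> 1" using r(2)[OF z] .
    finally have "\<bar>r * proj \<theta> z\<bar> \<le> 1" .
    then have "r * real M ^ n * y \<in> {pos w - 1..pos w + 1}" unfolding eq abs_le_iff by auto
    then have "r * real M ^ n * y \<in> shadow n" using w by (auto simp: shadow_def wrds_def)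
    moreover have "y = a * (r * real M ^ n * y)" using r M by (simp add: a_def)
    ultimately show "y \<in> (\<lambda>x. a * x) ` shadow n" by blast
  qed
  have comp: "compact ((\<lambda>x. a * x) ` shadow n)"
    by (intro compact_continuous_image compact_shadow continuous_intros)
  have "measure lebesgue (proj \<theta> ` gen_set M T U n) \<le> measure lebesgue ((\<lambda>x. a * x) ` shadow n)"
  proof (cases "proj \<theta> ` gen_set M T U n \<in> sets lebesgue")
    case True
    then show ?thesis by (intro measure_mono_fmeasurable sub lmeasurable_compact comp)
  next
    case False
    \<comment> \<open>\<open>measure\<close> takes the value 0 on a set that is not
      measurable.\<close>
    then show ?thesis by (simp add: measure_notin_sets)
  qed
  also have "\<dots> = a * measure lebesgue (shadow n)" unfolding measure_scale_lebesgue using a by simp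
  also have "\<dots> = shadow_length n / r" by (simp add: shadow_length_def a_def)
  finally show ?thesis .
qed

text \<open>If the integrand is not integrable its integral is 0 by convention, and the bound still
  holds because \<open>g\<close> is nonnegative.\<close>

lemma Fav_le_integral:
  assumes g: "integrable lborel g" "\<And>\<theta>. 0 \<le> g \<theta>"
    and le: "\<And>\<theta>. \<theta> \<in> {0..<pi} \<Longrightarrow> measure lebesgue (proj \<theta> ` A) \<le> g \<theta>"
  shows "Fav A \<le> integral\<^sup>L lborel g / pi"
proof -
  have "(LBINT \<theta>:{0..<pi}. measure lebesgue (proj \<theta> ` A)) \<le> integral\<^sup>L lborel g"
    unfolding set_lebesgue_integral_def
    by (rule Bochner_Integration.integral_mono'[OF g(1)]) (use le g(2) in \<open>auto simp: indicator_def\<close>)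
  then show ?thesis unfolding Fav_def by (simp add: divide_right_mono)
qed

text \<open>If all these products were real, every difference from \<open>c 0\<close> would be a
  real multiple of a single nonzero one, or all would vanish.\<close>

lemma independent_triple_if_not_collinear:
  fixes c :: "nat \<Rightarrow> complex"
  assumes "\<not> collinear (c ` {..<M})" "M > 0"
  obtains i j where "i < M" "j < M" "Im (cnj (c i - c 0) * (c j - c 0)) \<noteq> 0"
proof -
  have "\<exists>i<M. \<exists>j<M. Im (cnj (c i - c 0) * (c j - c 0)) \<noteq> 0"
  proof (rule ccontr)
    assume "\<not> (\<exists>i<M. \<exists>j<M. Im (cnj (c i - c 0) * (c j - c 0)) \<noteq> 0)"
    then have zero: "Im (cnj (c i - c 0) * (c j - c 0)) = 0" if "i < M" "j < M" for i j
      using that by blast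
    have "collinear (c ` {..<M})"
    proof (cases "\<exists>i<M. c i \<noteq> c 0")
      case False
      then have "c ` {..<M} \<subseteq> {c 0}" by blast
      then show ?thesis by (rule collinear_subset[OF collinear_sing])
    next
      case True
      then obtain i where i: "i < M" "c i \<noteq> c 0" by blast
      define d where "d = c i - c 0"
      have d: "d \<noteq> 0" using i by (simp add: d_def)
      have "\<exists>s. c j - c 0 = s *\<^sub>R d" if "j < M" for j
      proof -
        have "cnj d * (c j - c 0) = of_real (Re (cnj d * (c j - c 0)))"
          using zero[OF i(1) that] by (simp add: complex_eq_iff d_def)
        then have "d * cnj d * (c j - c 0) = of_real (Re (cnj d * (c j - c 0))) * d"
          by (metis mult.assoc mult.commute)
        then have "of_real ((cmod d)\<^sup>2) * (c j - c 0) = of_real (Re (cnj d * (c j - c 0))) * d"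
          by (simp only: complex_norm_square)
        moreover have "c j - c 0 = of_real ((cmod d)\<^sup>2) * (c j - c 0) / of_real ((cmod d)\<^sup>2)"
          using d by simp
        ultimately have "c j - c 0 = of_real (Re (cnj d * (c j - c 0))) * d / of_real ((cmod d)\<^sup>2)"
          by metis
        then have "c j - c 0 = of_real (Re (cnj d * (c j - c 0)) / (cmod d)\<^sup>2) * d"
          by (simp only: of_real_divide times_divide_eq_left)
        then show ?thesis by (metis scaleR_conv_of_real)
      qed
      then obtain s where s: "\<And>j. j < M \<Longrightarrow> c j - c 0 = s j *\<^sub>R d" by metis
      show ?thesis
        unfolding collinear_def
      proof (intro exI[of _ d] ballI)
        fix x y assume "x \<in> c ` {..<M}" "y \<in> c ` {..<M}"
        then obtain p q where "p < M" "q < M" "x = c p" "y = c q" by auto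
        then have "x - y = (s p - s q) *\<^sub>R d"
          using s[of p] s[of q] by (metis diff_diff_eq2 diff_add_cancel scaleR_left_diff_distrib)
        then show "\<exists>c. x - y = c *\<^sub>R d" by blast
      qed
    qed
    then show False using assms(1) by blast
  qed
  then show ?thesis using that by blast
qed

theorem theorem2:
  fixes M :: nat and c :: "nat \<Rightarrow> complex" and T :: "nat \<Rightarrow> complex \<Rightarrow> complex"
    and U :: "complex set"
  assumes "M \<ge> 3"
    and "\<And>j z. T j z = z / of_nat M + c j"
    and "\<not> collinear (c ` {..<M})"
    and "open U" and "bounded U" and "U \<noteq> {}"
    and "\<And>j. j < M \<Longrightarrow> T j ` U \<subseteq> U"
    and "\<And>j k. j < M \<Longrightarrow> k < M \<Longrightarrow> j \<noteq> k \<Longrightarrow> T j ` U \<inter> T k ` U = {}"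
  shows "\<exists>\<kappa> > 0. \<exists>C. \<forall>n \<ge> 2.
           Fav (gen_set M T U n) \<le> C * exp (- \<kappa> * sqrt (ln (real n)))"
proof -
  have M: "M \<ge> 3" "M > 0" using assms(1) by auto
  obtain B where B: "\<And>z. z \<in> U \<Longrightarrow> cmod z \<le> B" using assms(5) by (auto simp: bounded_iff)
  \<comment> \<open>This scale makes the digits at most 1/4 in modulus and places \<open>U\<close>
    in the closed unit disc.\<close>
  define r where "r = 1 / (4 * real M * (\<Sum>j<M. cmod (c j)) + \<bar>B\<bar> + 1)"
  have den: "4 * real M * (\<Sum>j<M. cmod (c j)) + \<bar>B\<bar> + 1 > 0"
    by (intro add_nonneg_pos add_nonneg_nonneg mult_nonneg_nonneg sum_nonneg) auto
  have r: "r > 0" using den by (simp add: r_def)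
  have rU: "r * cmod z \<le> 1" if "z \<in> U" for z
  proof -
    have "0 \<le> 4 * real M * (\<Sum>j<M. cmod (c j))" by (intro mult_nonneg_nonneg sum_nonneg) auto
    then have "cmod z \<le> 4 * real M * (\<Sum>j<M. cmod (c j)) + \<bar>B\<bar> + 1" using B[OF that] by linarith
    then show ?thesis using den by (simp add: r_def divide_le_eq)
  qed
  define C where "C j = of_real (r * real M) * c j" for j
  have C: "cmod (C j) \<le> 1 / 4" if "j < M" for j
  proof -
    have "cmod (c j) \<le> (\<Sum>j<M. cmod (c j))" using that by (intro member_le_sum) auto
    then have "4 * real M * cmod (c j) \<le> 4 * real M * (\<Sum>j<M. cmod (c j))" by (intro mult_left_mono) auto
    then have "4 * real M * cmod (c j) \<le> 4 * real M * (\<Sum>j<M. cmod (c j)) + \<bar>B\<bar> + 1" by linarith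
    then have "r * (4 * real M * cmod (c j)) \<le> 1" using den by (simp add: r_def divide_le_eq)
    moreover have "cmod (C j) = r * real M * cmod (c j)" using r by (simp add: C_def norm_mult)
    ultimately show ?thesis by simp
  qed
  have Cs: "\<forall>j<M. cmod (C j) \<le> 1 / 4" using C by blast
  have rM: "r * real M \<noteq> 0" using r M by simp
  \<comment> \<open>Equal digits would mean equal maps, whose images of the nonempty
    \<open>U\<close> could not be disjoint.\<close>
  have inj: "inj_on C {..<M}"
  proof (rule inj_onI)
    fix i j assume ij: "i \<in> {..<M}" "j \<in> {..<M}" "C i = C j"
    then have "c i = c j" using rM by (simp add: C_def)
    then have "T i = T j" using assms(2) by (intro ext) simp
    then show "i = j" using assms(6) assms(8)[of i j] ij by (cases "i = j") auto
  qed
  obtain j1 j2 where j: "j1 < M" "j2 < M" "Im (cnj (c j1 - c 0) * (c j2 - c 0)) \<noteq> 0"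
    using independent_triple_if_not_collinear[OF assms(3) M(2)] by blast
  have eq: "cnj (C j1 - C 0) * (C j2 - C 0) = of_real ((r * real M)\<^sup>2) * (cnj (c j1 - c 0) * (c j2 - c 0))"
  proof -
    define s where "s = r * real M"
    have "C i - C k = of_real s * (c i - c k)" for i k by (simp add: C_def s_def right_diff_distrib)
    then show ?thesis unfolding s_def[symmetric]
      by (simp only: complex_cnj_mult complex_cnj_complex_of_real power2_eq_square of_real_mult mult_ac)
  qed
  have indep: "Im (cnj (C j1 - C 0) * (C j2 - C 0)) \<noteq> 0"
  proof -
    have im: "Im (of_real s * z) = s * Im z" for s z by simp
    have "(r * real M)\<^sup>2 \<noteq> 0" using rM by simp
    with j(3) show ?thesis unfolding eq im by (simp only: mult_eq_0_iff not_False_eq_True de_Morgan_disj)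
  qed
  obtain K :: real and E m0 :: nat where avg: "\<forall>m n. m \<ge> m0 \<longrightarrow> n \<ge> M ^ (E * m\<^sup>2) \<longrightarrow>
    (\<exists>g. integrable lborel g \<and> integral\<^sup>L lborel g \<le> K / real M ^ m \<and>
      (\<forall>\<theta>\<in>{0..<pi}. digit_system.shadow_length M (digits_at C \<theta>) n \<le> g \<theta>) \<and> (\<forall>\<theta>. 0 \<le> g \<theta>))"
    using shadow_length_average[OF M(1) Cs inj M(2) j(1,2) indep] by (elim exE) (rule that)
  have dig: "digit_system M (digits_at C \<theta>)" for \<theta> by (rule digit_system_digits_at[OF M(1) C])
  have meas: "measure lebesgue (proj \<theta> ` gen_set M T U n) \<le> digit_system.shadow_length M (digits_at C \<theta>) n / r" for \<theta> n
    by (rule measure_proj_gen_set_le[OF M(2) C_def assms(2) dig r rU])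
  \<comment> \<open>One entry serves the averaged estimate, the other the trivial one with shadow
    length at most 2.\<close>
  define A where "A = max (K / (r * pi)) (2 / r)"
  have A: "A > 0" using r by (simp add: A_def less_max_iff_disj)
  have Fav_m: "Fav (gen_set M T U n) \<le> A / real M ^ m" if mn: "m \<ge> m0" "n \<ge> M ^ (E * m\<^sup>2)" for m n
  proof -
    obtain g where g: "integrable lborel g" "integral\<^sup>L lborel g \<le> K / real M ^ m"
      "\<And>\<theta>. \<theta> \<in> {0..<pi} \<Longrightarrow> digit_system.shadow_length M (digits_at C \<theta>) n \<le> g \<theta>" "\<And>\<theta>. 0 \<le> g \<theta>"
      using avg[THEN spec, THEN spec, THEN mp, THEN mp, OF mn] by blast
    have "Fav (gen_set M T U n) \<le> integral\<^sup>L lborel (\<lambda>\<theta>. g \<theta> / r) / pi"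
    proof (rule Fav_le_integral)
      show "integrable lborel (\<lambda>\<theta>. g \<theta> / r)" using g(1) by simp
      show "0 \<le> g \<theta> / r" for \<theta> using g(4) r by simp
      show "measure lebesgue (proj \<theta> ` gen_set M T U n) \<le> g \<theta> / r" if "\<theta> \<in> {0..<pi}" for \<theta>
        using meas[of \<theta> n] divide_right_mono[OF g(3)[OF that], of r] r by linarith
    qed
    also have "\<dots> = integral\<^sup>L lborel g / (r * pi)" by simp
    also have "\<dots> \<le> (K / real M ^ m) / (r * pi)" using g(2) r by (intro divide_right_mono) auto
    also have "\<dots> = (K / (r * pi)) / real M ^ m" by simp
    also have "\<dots> \<le> A / real M ^ m" unfolding A_def by (intro divide_right_mono) auto
    finally show ?thesis .
  qed
  have Fav_A: "Fav (gen_set M T U n) \<le> A" for n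
  proof -
    have "Fav (gen_set M T U n) \<le> integral\<^sup>L lborel (\<lambda>\<theta>. 2 / r * indicator {0..<pi} \<theta>) / pi"
    proof (rule Fav_le_integral)
      show "integrable lborel (\<lambda>\<theta>. 2 / r * indicator {0..<pi} \<theta>)"
        by (intro integrable_mult_right integrable_real_indicator) auto
      show "0 \<le> 2 / r * indicator {0..<pi} \<theta>" for \<theta> using r by simp
      show "measure lebesgue (proj \<theta> ` gen_set M T U n) \<le> 2 / r * indicator {0..<pi} \<theta>" if "\<theta> \<in> {0..<pi}" for \<theta>
        using meas[of \<theta> n] divide_right_mono[OF digit_system.shadow_length_le_2[OF dig], of r \<theta> n] r that by simp
    qed
    also have "\<dots> = 2 / r" by simp
    also have "\<dots> \<le> A" by (simp add: A_def)
    finally show ?thesis .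
  qed
  \<comment> \<open>Adding 1 keeps the later divisor positive.\<close>
  define E' where "E' = real E + 1"
  define L where "L = ln (real M)"
  have L: "L > 0" using M by (simp add: L_def)
  have E': "E' > 0" by (simp add: E'_def)
  define \<kappa> where "\<kappa> = sqrt (L / E')"
  have kap: "\<kappa> > 0" using L E' by (simp add: \<kappa>_def)
  have "Fav (gen_set M T U n) \<le> (A * real M ^ (m0 + 1)) * exp (- \<kappa> * sqrt (ln (real n)))" if "n \<ge> 2" for n
  proof -
    \<comment> \<open>The solution of \<open>M ^ (E' * x^2) = n\<close>; its integer part is the
      parameter \<open>m\<close>.\<close>
    define x where "x = sqrt (ln (real n) / (E' * L))"
    have lnn: "ln (real n) \<ge> 0" using that by simp
    have x: "x \<ge> 0" using lnn E' L by (simp add: x_def)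
    define m where "m = nat \<lfloor>x\<rfloor>"
    have m: "real m \<le> x" "x \<le> real m + 1" using x unfolding m_def by linarith+
    have ex: "exp (- \<kappa> * sqrt (ln (real n))) = exp (- (x * L))"
    proof -
      have "x * L = sqrt (ln (real n) / (E' * L)) * sqrt (L\<^sup>2)" using L by (simp add: x_def)
      also have "\<dots> = sqrt (ln (real n) / (E' * L) * L\<^sup>2)" by (simp only: real_sqrt_mult)
      also have "ln (real n) / (E' * L) * L\<^sup>2 = L / E' * ln (real n)" using L by (simp add: power2_eq_square)
      also have "sqrt (L / E' * ln (real n)) = \<kappa> * sqrt (ln (real n))" by (simp only: real_sqrt_mult \<kappa>_def)
      finally show ?thesis by simp
    qed
    have pow: "real M ^ k = exp (real k * L)" for k
      using M by (simp add: L_def exp_of_nat_mult)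
    \<comment> \<open>Rounding \<open>x\<close> down costs at most one factor
      \<open>M\<close>.\<close>
    have xm: "1 \<le> real M ^ (m + 1) * exp (- (x * L))"
    proof -
      have "x * L \<le> real (m + 1) * L" using m L by (intro mult_right_mono) auto
      then show ?thesis unfolding pow by (simp add: exp_add[symmetric] mult_exp_exp)
    qed
    show ?thesis
    proof (cases "m \<ge> m0")
      case True
      have "real (M ^ (E * m\<^sup>2)) \<le> real n"
      proof -
        have "(real m)\<^sup>2 \<le> x\<^sup>2" using m by (intro power_mono) auto
        also have "x\<^sup>2 = ln (real n) / (E' * L)" using lnn E' L by (simp add: x_def)
        finally have "(real m)\<^sup>2 * (E' * L) \<le> ln (real n)" using E' L by (simp add: pos_le_divide_eq)
        moreover have "real (E * m\<^sup>2) * L \<le> (real m)\<^sup>2 * (E' * L)"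
          using L by (simp add: E'_def algebra_simps)
        ultimately have "exp (real (E * m\<^sup>2) * L) \<le> exp (ln (real n))" by simp
        then show ?thesis using that pow[of "E * m\<^sup>2"] by simp
      qed
      then have "n \<ge> M ^ (E * m\<^sup>2)" by linarith
      then have "Fav (gen_set M T U n) \<le> A / real M ^ m" by (rule Fav_m[OF True])
      also have "\<dots> \<le> A / real M ^ m * (real M ^ (m + 1) * exp (- (x * L)))"
        using mult_left_mono[OF xm, of "A / real M ^ m"] A by simp
      also have "\<dots> = A * real M ^ 1 * exp (- (x * L))" using M by (simp add: power_add)
      also have "\<dots> \<le> A * real M ^ (m0 + 1) * exp (- (x * L))"
        using A M by (intro mult_right_mono mult_left_mono power_increasing) auto
      finally show ?thesis unfolding ex .
    next
      case False
      \<comment> \<open>Below the starting scale \<open>m0\<close> the trivial bound suffices, the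
        constant being enlarged by \<open>M ^ (m0 + 1)\<close>.\<close>
      have "Fav (gen_set M T U n) \<le> A * 1" using Fav_A by simp
      also have "\<dots> \<le> A * (real M ^ (m + 1) * exp (- (x * L)))" using xm A by (intro mult_left_mono) auto
      also have "\<dots> \<le> A * (real M ^ (m0 + 1) * exp (- (x * L)))"
        using A M False by (intro mult_right_mono mult_left_mono power_increasing) auto
      finally show ?thesis unfolding ex by (simp add: mult.assoc)
    qed
  qed
  then show ?thesis using kap by blast
qed

end
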